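(* Every separable unital UHF algebra is a prime model (of its theory).
   Context: Logic of metric structures for C*-algebras. Terms are *-polynomials with complex coefficients (without constant term) in the variables $x_n$, $n\in\mathbb N$. Formulas are defined recursively: (1) $\|t\|$ is an (atomic) formula for every term $t$; (2) if $\phi,\psi$ are formulas and $f\colon[0,\infty)^2\to[0,\infty)$ is continuous, then $f(\phi,\psi)$ is a formula; (3) if $\phi$ is a formula and $n,k\in\mathbb N$, then $\inf_{\|x_n\|\le k}\phi$ and $\sup_{\|x_n\|\le k}\phi$ are formulas. Formulas are interpreted in C*-algebras in the obvious way. The theory of a C*-algebra $A$ is the assignment $\phi\mapsto\phi^A$ on sentences (formulas without free variables); a model of the theory of $A$ is a C*-algebra $B$ with $\phi^B=\phi^A$ for all sentences $\phi$. An elementary embedding $\Phi\colon A\to B$ is a *-homomorphism with $\phi(\Phi(\bar a))^B=\phi(\bar a)^A$ for all formulas $\phi$ and all tuples $\bar a$ in $A$; an elementary submodel of $B$ is a C*-subalgebra whose inclusion map is elementary. A model of a theory $T$ is prime if it is isomorphic to an elementary submodel of every other model of $T$. A unital C*-algebra is UHF if it is a tensor product of full matrix algebras $M_n(\mathbb C)$. *)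

theory Defs
  imports "HOL-Analysis.Analysis"
begin

section \<open>C*-algebras\<close>

text \<open>No unit is assumed, and the zero algebra is allowed. Completeness and submultiplicativity of
  the norm come from \<^class>\<open>banach\<close> and \<^class>\<open>real_normed_algebra\<close>.\<close>

class cstar_algebra = real_normed_algebra + banach +
  fixes scaleC :: "complex \<Rightarrow> 'a \<Rightarrow> 'a" (infixr "*\<^sub>C" 75)
    and star :: "'a \<Rightarrow> 'a"
  assumes scaleC_add_right: "c *\<^sub>C (x + y) = c *\<^sub>C x + c *\<^sub>C y"
    and scaleC_add_left: "(c + d) *\<^sub>C x = c *\<^sub>C x + d *\<^sub>C x"
    and scaleC_scaleC: "c *\<^sub>C (d *\<^sub>C x) = (c * d) *\<^sub>C x"
    and scaleC_of_real: "complex_of_real r *\<^sub>C x = r *\<^sub>R x"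
    and mult_scaleC_left: "(c *\<^sub>C x) * y = c *\<^sub>C (x * y)"
    and mult_scaleC_right: "x * (c *\<^sub>C y) = c *\<^sub>C (x * y)"
    and norm_scaleC: "norm (c *\<^sub>C x) = cmod c * norm x"
    and star_add: "star (x + y) = star x + star y"
    and star_scaleC: "star (c *\<^sub>C x) = cnj c *\<^sub>C star x"
    and star_mult: "star (x * y) = star y * star x"
    and star_star: "star (star x) = x"
    and cstar_identity: "norm (star x * x) = (norm x)\<^sup>2"

class unital_cstar_algebra = cstar_algebra + monoid_mult

instantiation complex :: unital_cstar_algebra
begin
definition "scaleC_complex = ((*) :: complex \<Rightarrow> complex \<Rightarrow> complex)"
definition "star_complex = cnj"
instance
  by standard
    (simp_all add: scaleC_complex_def star_complex_def algebra_simps scaleR_conv_of_real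
      norm_mult power2_eq_square)
end

definition cstar_subalgebra :: "'a::cstar_algebra set \<Rightarrow> bool" where
  "cstar_subalgebra S \<longleftrightarrow> closed S \<and> 0 \<in> S \<and>
     (\<forall>x\<in>S. \<forall>y\<in>S. x + y \<in> S \<and> x * y \<in> S) \<and>
     (\<forall>x\<in>S. star x \<in> S \<and> (\<forall>c. c *\<^sub>C x \<in> S))"

definition star_hom :: "'a::cstar_algebra set \<Rightarrow> 'b::cstar_algebra set \<Rightarrow> ('a \<Rightarrow> 'b) \<Rightarrow> bool" where
  "star_hom S S' \<Phi> \<longleftrightarrow> \<Phi> ` S \<subseteq> S' \<and>
     (\<forall>x\<in>S. \<forall>y\<in>S. \<Phi> (x + y) = \<Phi> x + \<Phi> y \<and> \<Phi> (x * y) = \<Phi> x * \<Phi> y) \<and>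
     (\<forall>x\<in>S. \<Phi> (star x) = star (\<Phi> x) \<and> (\<forall>c. \<Phi> (c *\<^sub>C x) = c *\<^sub>C \<Phi> x))"

definition star_isomorphic :: "'a::cstar_algebra set \<Rightarrow> 'b::cstar_algebra set \<Rightarrow> bool" where
  "star_isomorphic S S' \<longleftrightarrow> (\<exists>\<Phi>. star_hom S S' \<Phi> \<and> bij_betw \<Phi> S S')"

section \<open>Logic of metric structures for C*-algebras\<close>

text \<open>Expressions for *-polynomials without constant term; \<open>TZero\<close> makes the zero polynomial
  a term without variables.\<close>

datatype cterm =
    TZero
  | TVar nat
  | TAdd cterm cterm
  | TMult cterm cterm
  | TScale complex cterm
  | TStar cterm

primrec term_vars :: "cterm \<Rightarrow> nat set" where
  "term_vars TZero = {}"
| "term_vars (TVar n) = {n}"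
| "term_vars (TAdd s t) = term_vars s \<union> term_vars t"
| "term_vars (TMult s t) = term_vars s \<union> term_vars t"
| "term_vars (TScale c t) = term_vars t"
| "term_vars (TStar t) = term_vars t"

primrec term_val :: "(nat \<Rightarrow> 'a::cstar_algebra) \<Rightarrow> cterm \<Rightarrow> 'a" where
  "term_val v TZero = 0"
| "term_val v (TVar n) = v n"
| "term_val v (TAdd s t) = term_val v s + term_val v t"
| "term_val v (TMult s t) = term_val v s * term_val v t"
| "term_val v (TScale c t) = c *\<^sub>C term_val v t"
| "term_val v (TStar t) = star (term_val v t)"

text \<open>Values of a connective outside \<open>[0,\<infinity>)\<^sup>2\<close> are irrelevant, since formulas take
  nonnegative values.\<close>

typedef connective =
  "{f :: real \<times> real \<Rightarrow> real. continuous_on ({0..} \<times> {0..}) f \<and> f ` ({0..} \<times> {0..}) \<subseteq> {0..}}"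
  by (rule exI[of _ "\<lambda>_. 0"]) auto

text \<open>\<open>FInf n k \<phi>\<close> and \<open>FSup n k \<phi>\<close> stand for the infimum and supremum of \<open>\<phi>\<close> over
  \<open>\<parallel>x\<^sub>n\<parallel> \<le> k\<close>.\<close>

datatype formula =
    FNorm cterm
  | FConn connective formula formula
  | FInf nat nat formula
  | FSup nat nat formula

primrec free_vars :: "formula \<Rightarrow> nat set" where
  "free_vars (FNorm t) = term_vars t"
| "free_vars (FConn f \<phi> \<psi>) = free_vars \<phi> \<union> free_vars \<psi>"
| "free_vars (FInf n k \<phi>) = free_vars \<phi> - {n}"
| "free_vars (FSup n k \<phi>) = free_vars \<phi> - {n}"

definition is_sentence :: "formula \<Rightarrow> bool" where
  "is_sentence \<phi> \<longleftrightarrow> free_vars \<phi> = {}"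

text \<open>The value of a formula in the C*-algebra with carrier \<open>S\<close>, a C*-subalgebra of \<open>'a\<close>. The
  infima and suprema are over nonempty sets of reals that are bounded, because the connectives are
  bounded on bounded sets.\<close>

primrec interp :: "'a::cstar_algebra set \<Rightarrow> (nat \<Rightarrow> 'a) \<Rightarrow> formula \<Rightarrow> real" where
  "interp S v (FNorm t) = norm (term_val v t)"
| "interp S v (FConn f \<phi> \<psi>) = Rep_connective f (interp S v \<phi>, interp S v \<psi>)"
| "interp S v (FInf n k \<phi>) = (INF x\<in>{x\<in>S. norm x \<le> real k}. interp S (v(n := x)) \<phi>)"
| "interp S v (FSup n k \<phi>) = (SUP x\<in>{x\<in>S. norm x \<le> real k}. interp S (v(n := x)) \<phi>)"

text \<open>On sentences the choice of the assignment does not matter.\<close>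

definition theory_of :: "'a::cstar_algebra set \<Rightarrow> formula \<Rightarrow> real" where
  "theory_of S = restrict (\<lambda>\<phi>. interp S (\<lambda>_. 0) \<phi>) {\<phi>. is_sentence \<phi>}"

definition models :: "'a::cstar_algebra set \<Rightarrow> (formula \<Rightarrow> real) \<Rightarrow> bool" where
  "models S T \<longleftrightarrow> cstar_subalgebra S \<and> theory_of S = T"

text \<open>Tuples are rendered as assignments of all the variables; the value of a formula depends only
  on its finitely many free variables.\<close>

definition elementary_embedding ::
    "'a::cstar_algebra set \<Rightarrow> 'b::cstar_algebra set \<Rightarrow> ('a \<Rightarrow> 'b) \<Rightarrow> bool" where
  "elementary_embedding S S' \<Phi> \<longleftrightarrow> star_hom S S' \<Phi> \<and>
     (\<forall>\<phi> v. range v \<subseteq> S \<longrightarrow> interp S' (\<Phi> \<circ> v) \<phi> = interp S v \<phi>)"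

definition elementary_submodel :: "'a::cstar_algebra set \<Rightarrow> 'a set \<Rightarrow> bool" where
  "elementary_submodel S S' \<longleftrightarrow>
     cstar_subalgebra S \<and> S \<subseteq> S' \<and> elementary_embedding S S' (\<lambda>x. x)"

text \<open>A definition cannot quantify over types, so the type \<open>'b\<close> in which the other models live is a
  parameter; a theorem whose \<open>'b\<close> is a type variable speaks about all of them.\<close>

definition prime_model ::
    "'b::cstar_algebra itself \<Rightarrow> (formula \<Rightarrow> real) \<Rightarrow> 'a::cstar_algebra set \<Rightarrow> bool" where
  "prime_model TB T A \<longleftrightarrow> models A T \<and>
     (\<forall>B::'b set. models B T \<longrightarrow> (\<exists>S. elementary_submodel S B \<and> star_isomorphic A S))"

section \<open>Tensor products of full matrix algebras\<close>

text \<open>Square matrices with rows and columns indexed by a finite set \<open>X\<close> are functions of two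
  arguments, of which only the values on \<open>X\<close> matter. They form the C*-algebra of operators on the
  Hilbert space \<open>\<complex>\<^sup>X\<close>; the algebra \<open>M\<^sub>n(\<complex>)\<close> is the case \<open>X = {..<n}\<close>.\<close>

type_synonym 'x cmatrix = "'x \<Rightarrow> 'x \<Rightarrow> complex"

definition matrix_add :: "'x cmatrix \<Rightarrow> 'x cmatrix \<Rightarrow> 'x cmatrix" where
  "matrix_add a b = (\<lambda>p q. a p q + b p q)"

definition matrix_scale :: "complex \<Rightarrow> 'x cmatrix \<Rightarrow> 'x cmatrix" where
  "matrix_scale c a = (\<lambda>p q. c * a p q)"

definition matrix_mult :: "'x set \<Rightarrow> 'x cmatrix \<Rightarrow> 'x cmatrix \<Rightarrow> 'x cmatrix" where
  "matrix_mult X a b = (\<lambda>p q. \<Sum>r\<in>X. a p r * b r q)"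

definition matrix_adjoint :: "'x cmatrix \<Rightarrow> 'x cmatrix" where
  "matrix_adjoint a = (\<lambda>p q. cnj (a q p))"

definition matrix_one :: "'x cmatrix" where
  "matrix_one = (\<lambda>p q. if p = q then 1 else 0)"

definition matrix_norm :: "'x set \<Rightarrow> 'x cmatrix \<Rightarrow> real" where
  "matrix_norm X a =
     (SUP v\<in>{v. L2_set (\<lambda>q. cmod (v q)) X \<le> 1}. L2_set (\<lambda>p. cmod (\<Sum>q\<in>X. a p q * v q)) X)"

definition matrix_embedding :: "'x set \<Rightarrow> ('x cmatrix \<Rightarrow> 'a::unital_cstar_algebra) \<Rightarrow> bool" where
  "matrix_embedding X \<theta> \<longleftrightarrow>
     (\<forall>a b. \<theta> (matrix_add a b) = \<theta> a + \<theta> b) \<and>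
     (\<forall>c a. \<theta> (matrix_scale c a) = c *\<^sub>C \<theta> a) \<and>
     (\<forall>a b. \<theta> (matrix_mult X a b) = \<theta> a * \<theta> b) \<and>
     (\<forall>a. \<theta> (matrix_adjoint a) = star (\<theta> a)) \<and>
     \<theta> matrix_one = 1 \<and>
     (\<forall>a. norm (\<theta> a) = matrix_norm X a)"

text \<open>For finite \<open>F\<close> the tensor product of the \<open>M\<^bsub>k i\<^esub>(\<complex>)\<close>, \<open>i \<in> F\<close>, acts on the tensor product of
  the \<open>\<complex>\<^bsup>k i\<^esup>\<close>, whose basis is the set \<open>tensor_index k F\<close>. The elementary tensor of matrices \<open>a i\<close>
  is their Kronecker product, and these span all matrices.\<close>

definition tensor_index :: "('i \<Rightarrow> nat) \<Rightarrow> 'i set \<Rightarrow> ('i \<Rightarrow> nat) set" where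
  "tensor_index k F = (\<Pi>\<^sub>E i\<in>F. {..<k i})"

definition elementary_tensor :: "'i set \<Rightarrow> ('i \<Rightarrow> nat cmatrix) \<Rightarrow> ('i \<Rightarrow> nat) cmatrix" where
  "elementary_tensor F a = (\<lambda>p q. \<Prod>i\<in>F. a i (p i) (q i))"

lemma elementary_tensor_mult:
  assumes "finite F"
  shows "matrix_mult (tensor_index k F) (elementary_tensor F a) (elementary_tensor F b) =
    elementary_tensor F (\<lambda>i. matrix_mult {..<k i} (a i) (b i))"
  using assms
  by (simp add: matrix_mult_def elementary_tensor_def tensor_index_def prod_sum_PiE prod.distrib)

lemma elementary_tensor_adjoint:
  "matrix_adjoint (elementary_tensor F a) = elementary_tensor F (\<lambda>i. matrix_adjoint (a i))"
  by (simp add: matrix_adjoint_def elementary_tensor_def)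

lemma elementary_tensor_matrix_unit:
  assumes "finite F" "p \<in> tensor_index k F" "q \<in> tensor_index k F"
    "p' \<in> tensor_index k F" "q' \<in> tensor_index k F"
  shows "elementary_tensor F (\<lambda>i r s. if r = p i \<and> s = q i then 1 else 0) p' q' =
    (if p' = p \<and> q' = q then 1 else 0)"
proof (cases "p' = p \<and> q' = q")
  case True
  then show ?thesis by (simp add: elementary_tensor_def)
next
  case False
  then obtain i where "i \<in> F" "p' i \<noteq> p i \<or> q' i \<noteq> q i"
    using assms(2-5) unfolding tensor_index_def by (metis PiE_ext)
  then show ?thesis
    using assms(1) False unfolding elementary_tensor_def by (subst prod_zero) auto
qed

text \<open>The C*-tensor product of a family of matrix algebras is the inductive limit of the tensor
  products over finite \<open>F \<subseteq> I\<close> along the maps \<open>a \<mapsto> a \<otimes> 1\<close>, that is, the completion of their union.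
  The maps \<open>\<theta> F\<close> are the canonical ones into the limit.\<close>

definition is_matrix_tensor_product ::
    "'i set \<Rightarrow> ('i \<Rightarrow> nat) \<Rightarrow> ('i set \<Rightarrow> ('i \<Rightarrow> nat) cmatrix \<Rightarrow> 'a::unital_cstar_algebra) \<Rightarrow> bool" where
  "is_matrix_tensor_product I k \<theta> \<longleftrightarrow>
     (\<forall>F. finite F \<and> F \<subseteq> I \<longrightarrow> matrix_embedding (tensor_index k F) (\<theta> F)) \<and>
     (\<forall>F G a. finite G \<and> F \<subseteq> G \<and> G \<subseteq> I \<and> (\<forall>i\<in>G - F. a i = matrix_one) \<longrightarrow>
        \<theta> G (elementary_tensor G a) = \<theta> F (elementary_tensor F a)) \<and>
     closure (\<Union>F\<in>{F. finite F \<and> F \<subseteq> I}. range (\<theta> F)) = UNIV"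

text \<open>The index set of the family is a subset of the type \<open>'i\<close>, which is a parameter for the same
  reason as in \<open>prime_model\<close>.\<close>

definition uhf :: "'i itself \<Rightarrow> 'a::unital_cstar_algebra itself \<Rightarrow> bool" where
  "uhf TI TA \<longleftrightarrow>
     (\<exists>(I::'i set) k (\<theta>::'i set \<Rightarrow> ('i \<Rightarrow> nat) cmatrix \<Rightarrow> 'a).
        (\<forall>i\<in>I. 1 \<le> k i) \<and> is_matrix_tensor_product I k \<theta>)"

end

theory Submission
  imports Defs
begin

text \<open>A copy of \<open>M\<^sub>d(\<complex>)\<close> in a C*-algebra is encoded by its first column of matrix units, and column
  tuples satisfy two crucial facts. First, their defining relations are stable: approximate columns
  are near exact ones, in every C*-algebra. Second, exact unital columns in a UHF algebra \<open>A\<close> are, after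
  a small perturbation into a finite stage, conjugate by a unitary, because they have the same trace
  there. Hence the relations isolate the type of a column in \<open>A\<close>: a formula takes nearly the same
  value at all approximate unital columns. This is expressed by sentences, so it passes to every model
  \<open>B\<close> of the theory of \<open>A\<close>, and every unital embedding of a finite stage of \<open>A\<close> into \<open>B\<close> preserves all
  formulas. In particular, such an embedding extends approximately to the next stage. Embeddings
  of the successive stages, chosen with summable errors, converge to an elementary embedding of \<open>A\<close>.\<close>

text \<open>Three obstacles shape the proof. A model \<open>B\<close> need not come with a unit, so
  unitality of a column means that its sum of diagonal matrix units acts as a left unit, which a
  supremum over the unit ball can test; that sum is a projection, so acting almost as a unit forces
  it to act as one. Connectives are continuous, so the implication "an approximate column gives
  \<open>\<phi>\<close> almost the value \<open>r\<close>" is coded as the vanishing of a minimum of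
  two truncated differences, quantified by suprema. Finally, an infimum with value 0 need not be
  attained in \<open>B\<close>: it gives approximate witnesses, which stability turns into exact
  columns that lie only near the wanted position. This is why consecutive embeddings agree merely up
  to a tolerance and a limit has to be taken. Stability is obtained by polynomial iterations in
  place of functional calculus; their iterates stay in a given subalgebra, so that one lemma serves
  both the finite stages of \<open>A\<close> and \<open>B\<close>. Separability replaces the net of
  finite tensor factors by a sequence of stages.\<close>

section \<open>Elementary algebra and limits in C*-algebras\<close>

lemma scaleC_one [simp]: "(1::complex) *\<^sub>C (x::'a::cstar_algebra) = x"
  using scaleC_of_real[of 1 x] by simp

lemma scaleC_zero_left [simp]: "(0::complex) *\<^sub>C (x::'a::cstar_algebra) = 0"
  using scaleC_of_real[of 0 x] by simp

lemma scaleC_zero_right [simp]: "c *\<^sub>C (0::'a::cstar_algebra) = 0"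
  using scaleC_add_right[of c 0 "0::'a"] by simp

lemma scaleC_minus_one: "(- 1::complex) *\<^sub>C (x::'a::cstar_algebra) = - x"
  using scaleC_of_real[of "-1" x] by simp

lemma scaleC_sum_left: "(\<Sum>i\<in>I. f i) *\<^sub>C x = (\<Sum>i\<in>I. f i *\<^sub>C (x :: 'a::cstar_algebra))"
  by (induction I rule: infinite_finite_induct) (auto simp: scaleC_add_left)

lemma scaleC_diff_right: "c *\<^sub>C (x - y) = c *\<^sub>C x - c *\<^sub>C (y :: 'a::cstar_algebra)"
  using scaleC_add_right[of c "x - y" y] by (simp add: algebra_simps)

lemma star_zero [simp]: "star (0::'a::cstar_algebra) = 0"
  using star_add[of 0 "0::'a"] by simp

lemma star_minus: "star (- x) = - star (x::'a::cstar_algebra)"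
  using star_add[of x "-x"] by (simp add: eq_neg_iff_add_eq_0 add.commute)

lemma star_diff: "star (x - y) = star x - star (y::'a::cstar_algebra)"
  using star_add[of x "-y"] by (simp add: star_minus)

lemma star_sum: "star (\<Sum>i\<in>I. f i) = (\<Sum>i\<in>I. star (f i :: 'a::cstar_algebra))"
  by (induction I rule: infinite_finite_induct) (auto simp: star_add)

lemma star_scaleR: "star (r *\<^sub>R x) = r *\<^sub>R star (x::'a::cstar_algebra)"
  using star_scaleC[of "of_real r" x] by (simp add: scaleC_of_real)

lemma norm_star [simp]: "norm (star x) = norm (x::'a::cstar_algebra)"
proof -
  have le: "norm y \<le> norm (star y)" for y :: 'a
  proof (cases "y = 0")
    case False
    have "norm y * norm y = norm (star y * y)"
      by (simp add: cstar_identity power2_eq_square)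
    also have "\<dots> \<le> norm (star y) * norm y" by (rule norm_mult_ineq)
    finally show ?thesis using False by simp
  qed simp
  show ?thesis using le[of x] le[of "star x"] by (simp add: star_star)
qed

lemma star_mult_eq_0: "star x * x = 0 \<Longrightarrow> x = (0::'a::cstar_algebra)"
  using cstar_identity[of x] by simp

lemma tendsto_star [tendsto_intros]:
  "(f \<longlongrightarrow> (l::'a::cstar_algebra)) F \<Longrightarrow> ((\<lambda>x. star (f x)) \<longlongrightarrow> star l) F"
  unfolding tendsto_iff dist_norm by (simp flip: star_diff)

lemma cstar_subalgebraD:
  assumes "cstar_subalgebra S"
  shows "closed S" "0 \<in> S"
    "\<And>x y. x \<in> S \<Longrightarrow> y \<in> S \<Longrightarrow> x + y \<in> S"
    "\<And>x y. x \<in> S \<Longrightarrow> y \<in> S \<Longrightarrow> x * y \<in> S"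
    "\<And>x. x \<in> S \<Longrightarrow> star x \<in> S"
    "\<And>c x. x \<in> S \<Longrightarrow> c *\<^sub>C x \<in> S"
    "\<And>r x. x \<in> S \<Longrightarrow> r *\<^sub>R x \<in> S"
    "\<And>x. x \<in> S \<Longrightarrow> - x \<in> S"
    "\<And>x y. x \<in> S \<Longrightarrow> y \<in> S \<Longrightarrow> x - y \<in> S"
proof -
  show S: "closed S" "0 \<in> S" "\<And>x y. x \<in> S \<Longrightarrow> y \<in> S \<Longrightarrow> x + y \<in> S"
    "\<And>x y. x \<in> S \<Longrightarrow> y \<in> S \<Longrightarrow> x * y \<in> S"
    "\<And>x. x \<in> S \<Longrightarrow> star x \<in> S"
    "\<And>c x. x \<in> S \<Longrightarrow> c *\<^sub>C x \<in> S"
    using assms by (auto simp: cstar_subalgebra_def)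
  show "\<And>r x. x \<in> S \<Longrightarrow> r *\<^sub>R x \<in> S"
    using S(6) by (metis scaleC_of_real)
  show m: "\<And>x. x \<in> S \<Longrightarrow> - x \<in> S"
    using S(6)[of _ "-1"] by (simp add: scaleC_minus_one)
  show "\<And>x y. x \<in> S \<Longrightarrow> y \<in> S \<Longrightarrow> x - y \<in> S"
    using m S(3) by (metis add_uminus_conv_diff)
qed

lemma cstar_subalgebra_sum:
  "cstar_subalgebra S \<Longrightarrow> (\<And>i. i \<in> I \<Longrightarrow> f i \<in> S) \<Longrightarrow> (\<Sum>i\<in>I. f i) \<in> S"
  by (induction I rule: infinite_finite_induct) (auto simp: cstar_subalgebraD)

lemma cstar_subalgebra_UNIV: "cstar_subalgebra UNIV"
  by (simp add: cstar_subalgebra_def)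

text \<open>Both iterations below at least halve their error in every step and move by at most a
  multiple of that error, so their limits exist and stay close to the starting point.\<close>

lemma LIMSEQ_of_geometric_steps:
  fixes s :: "nat \<Rightarrow> 'a::banach"
  assumes "\<And>n. norm (s (Suc n) - s n) \<le> c * (1/2) ^ n"
  obtains l where "s \<longlonglongrightarrow> l" "norm (l - s 0) \<le> 2 * c"
proof -
  have gs: "(\<lambda>n. c * (1/2) ^ n) sums (c * 2)"
    using sums_mult[OF geometric_sums[of "1/2::real"], of c] by simp
  have sm: "summable (\<lambda>n. s (Suc n) - s n)"
    by (rule summable_comparison_test'[OF sums_summable[OF gs]]) (rule assms)
  have "(\<lambda>n. \<Sum>i<n. s (Suc i) - s i) \<longlonglongrightarrow> (\<Sum>i. s (Suc i) - s i)"
    using sm by (rule summable_LIMSEQ)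
  then have "(\<lambda>n. s n - s 0) \<longlonglongrightarrow> (\<Sum>i. s (Suc i) - s i)"
    by (simp only: sum_lessThan_telescope)
  from tendsto_add[OF this tendsto_const[of "s 0"]]
  have lim: "s \<longlonglongrightarrow> (\<Sum>i. s (Suc i) - s i) + s 0" by simp
  have "norm (\<Sum>i. s (Suc i) - s i) \<le> (\<Sum>i. c * (1/2) ^ i)"
    by (rule norm_suminf_le[OF assms sums_summable[OF gs]])
  then have "norm (\<Sum>i. s (Suc i) - s i) \<le> 2 * c"
    using sums_unique[OF gs] by (simp only: mult.commute)
  with lim show thesis by (intro that[OF lim]) simp
qed

subsection \<open>Projections near approximate projections\<close>

text \<open>A crude a priori bound: by the C*-identity, the squared norm of an approximate
  projection exceeds its norm by at most the defect.\<close>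

lemma norm_le_two_of_square:
  fixes x :: real assumes "x\<^sup>2 \<le> x + 1" "0 \<le> x" shows "x \<le> 2"
proof (rule ccontr)
  assume "\<not> x \<le> 2"
  then have "2 * x < x * x" by simp
  with assms \<open>\<not> x \<le> 2\<close> show False by (simp add: power2_eq_square)
qed

text \<open>The map \<open>h \<mapsto> 3h\<^sup>2 - 2h\<^sup>3\<close> fixes \<open>0\<close> and \<open>1\<close> and is flat there, so its iterates starting at an
  approximate projection converge.\<close>

lemma scaleR_numeral_eq_sum:
  "2 *\<^sub>R v = v + v" "3 *\<^sub>R v = v + v + v" "4 *\<^sub>R v = v + v + v + v"
  "6 *\<^sub>R v = v + v + v + v + v + v"
  "9 *\<^sub>R v = v + v + v + v + v + v + v + v + (v::'a::real_vector)"
proof -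
  have a: "(r + s) *\<^sub>R v = t" if "r *\<^sub>R v + s *\<^sub>R v = t" for r s t using that by (simp add: scaleR_add_left)
  show 2: "2 *\<^sub>R v = v + v" using a[of 1 1] by simp
  show 3: "3 *\<^sub>R v = v + v + v" using a[of 2 1] 2 by simp
  show "4 *\<^sub>R v = v + v + v + v" using a[of 3 1] 3 by simp
  show 6: "6 *\<^sub>R v = v + v + v + v + v + v" using a[of 3 3] 3 by (simp add: add.assoc)
  show "9 *\<^sub>R v = v + v + v + v + v + v + v + v + v" using a[of 6 3] 3 6 by (simp add: add.assoc)
qed

lemma norm_mult_le:
  fixes x y :: "'a::real_normed_algebra"
  shows "norm x \<le> a \<Longrightarrow> norm y \<le> b \<Longrightarrow> norm (x * y) \<le> a * b"
  by (rule order.trans[OF norm_mult_ineq]) (intro mult_mono order.trans[OF norm_ge_zero], auto)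

text \<open>All elements are polynomials in \<open>h\<close>. With \<open>r = h - h * h\<close>, the
  defect of \<open>g\<close> is \<open>3 r^2 + 4 r^3\<close>, hence quadratic in \<open>r\<close>;
  for \<open>norm r\<close> at most 1/8 it is at most 7/16 of \<open>norm r\<close>. The
  displacement is \<open>2 r h - r\<close>, and \<open>norm h\<close> is at most 2, which gives the
  factor 5.\<close>

lemma projection_step:
  fixes h :: "'a::cstar_algebra"
  assumes sa: "star h = h" and r: "norm (h - h * h) \<le> 1/8"
  defines "g \<equiv> 3 *\<^sub>R (h * h) - 2 *\<^sub>R (h * h * h)"
  shows "star g = g" "norm (g - g * g) \<le> 1/2 * norm (h - h * h)"
    "norm (g - h) \<le> 5 * norm (h - h * h)"
proof -
  define r where "r = h - h * h"
  show "star g = g" by (simp add: g_def star_diff star_scaleR star_mult sa mult.assoc)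
  have "g - g * g = 3 *\<^sub>R (r * r) + 4 *\<^sub>R (r * r * r)"
    unfolding g_def r_def by (simp add: algebra_simps scaleR_numeral_eq_sum)
  then have "norm (g - g * g) \<le> 3 * (norm r * norm r) + 4 * (norm r * norm r * norm r)"
    by (auto intro!: order.trans[OF norm_triangle_ineq] add_mono norm_mult_le)
  also have "\<dots> \<le> 3 * (norm r * (1/8)) + 4 * (norm r * (1/8) * (1/8))"
    using assms(2) unfolding r_def[symmetric]
    by (intro add_mono mult_left_mono mult_mono) auto
  also have "\<dots> \<le> 1/2 * norm r" by simp
  finally show "norm (g - g * g) \<le> 1/2 * norm (h - h * h)" by (simp add: r_def)
  have "(norm h)\<^sup>2 = norm (h * h)" using cstar_identity[of h] sa by simp
  also have "\<dots> \<le> norm h + norm r" unfolding r_def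
    using norm_triangle_ineq4[of h "h - h * h"] by simp
  finally have "norm h \<le> 2"
    using assms(2) by (intro norm_le_two_of_square) (auto simp: r_def)
  have "g - h = 2 *\<^sub>R (r * h) - r"
    unfolding g_def r_def by (simp add: algebra_simps scaleR_numeral_eq_sum)
  then have "norm (g - h) \<le> 2 * (norm r * norm h) + norm r"
    by (auto intro!: order.trans[OF norm_triangle_ineq4] add_mono norm_mult_ineq)
  also have "\<dots> \<le> 2 * (norm r * 2) + norm r"
    using \<open>norm h \<le> 2\<close> by (intro add_mono mult_left_mono) auto
  finally show "norm (g - h) \<le> 5 * norm (h - h * h)" by (simp add: r_def)
qed

text \<open>The polynomial has no constant term, so the iterates stay in \<open>S\<close> although
  \<open>S\<close> may lack a unit. The displacements \<open>5 * d * (1/2) ^ n\<close> add up to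
  \<open>10 * d\<close>.\<close>

lemma projection_near:
  fixes h :: "'a::cstar_algebra"
  assumes S: "cstar_subalgebra S" and h: "h \<in> S" "star h = h" and r: "norm (h - h * h) \<le> 1/8"
  obtains e where "e \<in> S" "star e = e" "e * e = e" "norm (e - h) \<le> 10 * norm (h - h * h)"
proof -
  define f where "f = (\<lambda>h::'a. 3 *\<^sub>R (h * h) - 2 *\<^sub>R (h * h * h))"
  define s where "s = (\<lambda>n. (f ^^ n) h)"
  define d where "d = norm (h - h * h)"
  have s: "s n \<in> S \<and> star (s n) = s n \<and> norm (s n - s n * s n) \<le> d * (1/2) ^ n" for n
  proof (induction n)
    case 0 then show ?case using h by (simp add: s_def d_def)
  next
    case (Suc n)
    have "d * (1/2) ^ n \<le> 1/8 * 1"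
      using r by (intro mult_mono) (auto simp: d_def power_le_one)
    with Suc have le: "norm (s n - s n * s n) \<le> 1/8" by simp
    have eq: "s (Suc n) = f (s n)" by (simp add: s_def)
    have "s (Suc n) \<in> S" unfolding eq f_def using Suc S by (auto intro!: cstar_subalgebraD)
    then show ?case
      using projection_step[of "s n"] le Suc unfolding eq f_def[symmetric] by (simp add: f_def)
  qed
  have step: "norm (s (Suc n) - s n) \<le> (5 * d) * (1/2) ^ n" for n
  proof -
    have "d * (1/2) ^ n \<le> 1/8 * 1"
      using r by (intro mult_mono) (auto simp: d_def power_le_one)
    then have "norm (s n - s n * s n) \<le> 1/8" using s[of n] by linarith
    then have "norm (s (Suc n) - s n) \<le> 5 * norm (s n - s n * s n)"
      using projection_step(3)[of "s n"] s[of n] by (simp add: s_def f_def)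
    then show ?thesis using s[of n] by linarith
  qed
  obtain e where e: "s \<longlonglongrightarrow> e" "norm (e - s 0) \<le> 2 * (5 * d)"
    using LIMSEQ_of_geometric_steps[OF step] by blast
  have "e \<in> S" using closed_sequentially[OF cstar_subalgebraD(1)[OF S]] s e by blast
  moreover have "star e = e"
    using LIMSEQ_unique[OF tendsto_star[OF e(1)]] e(1) s by simp
  moreover have "e * e = e"
  proof -
    have "(\<lambda>n. norm (s n - s n * s n)) \<longlonglongrightarrow> norm (e - e * e)"
      by (intro tendsto_intros e)
    moreover have "(\<lambda>n. norm (s n - s n * s n)) \<longlonglongrightarrow> 0"
    proof (rule Lim_null_comparison)
      show "(\<lambda>n. d * (1/2) ^ n) \<longlonglongrightarrow> 0"
        using tendsto_mult_right_zero[OF LIMSEQ_power_zero[of "1/2::real"], of d] by simp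
    qed (simp add: s)
    ultimately show ?thesis using LIMSEQ_unique by fastforce
  qed
  ultimately show thesis using that e(2) by (simp add: s_def d_def)
qed

subsection \<open>Columns of matrix units\<close>

text \<open>A column \<open>v\<close> consists of the matrix units \<open>e\<^sub>a\<^sub>0\<close> of a copy of \<open>M\<^sub>d(\<complex>)\<close>; the other matrix units
  are \<open>e\<^sub>a\<^sub>b = v a * star (v b)\<close>.\<close>

definition unit_column :: "nat \<Rightarrow> (nat \<Rightarrow> 'a::cstar_algebra) \<Rightarrow> bool" where
  "unit_column d v \<longleftrightarrow> 0 < d \<and> (\<forall>a<d. \<forall>b<d. star (v a) * v b = (if a = b then v 0 else 0))"

text \<open>The sum of the diagonal matrix units, that is, the unit of the copy of the matrix
  algebra.\<close>

definition col_sum :: "nat \<Rightarrow> (nat \<Rightarrow> 'a::cstar_algebra) \<Rightarrow> 'a" where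
  "col_sum d v = (\<Sum>a<d. v a * star (v a))"

lemma norm_projection_le:
  fixes e :: "'a::cstar_algebra"
  assumes "star e = e" "e * e = e"
  shows "norm e \<le> 1"
proof (cases "e = 0")
  case False
  have "norm e * norm e = norm e" using cstar_identity[of e] assms by (simp add: power2_eq_square)
  then show ?thesis using False by simp
qed simp

text \<open>The relation for the pair (0, 0) makes \<open>v 0\<close> a selfadjoint projection. That
  it is a right unit for every \<open>v a\<close> then follows from the C*-identity, because the
  star-square of \<open>v a * v 0 - v a\<close> expands to 0.\<close>

lemma columnD:
  fixes v :: "nat \<Rightarrow> 'a::cstar_algebra"
  assumes "unit_column d v"
  shows "0 < d" "star (v 0) = v 0" "v 0 * v 0 = v 0" 
    "\<And>a b. a < d \<Longrightarrow> b < d \<Longrightarrow> star (v a) * v b = (if a = b then v 0 else 0)"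
    "\<And>a. a < d \<Longrightarrow> v a * v 0 = v a"
    "\<And>a. a < d \<Longrightarrow> v 0 * star (v a) = star (v a)"
    "\<And>a b. a < d \<Longrightarrow> b < d \<Longrightarrow> v a * v b = (if b = 0 then v a else 0)"
    "\<And>a. a < d \<Longrightarrow> norm (v a) \<le> 1"
proof -
  show d: "0 < d" and c: "\<And>a b. a < d \<Longrightarrow> b < d \<Longrightarrow> star (v a) * v b = (if a = b then v 0 else 0)"
    using assms by (auto simp: unit_column_def)
  show st: "star (v 0) = v 0" using c[of 0 0] d by (metis star_mult star_star)
  show p: "v 0 * v 0 = v 0" using c[of 0 0] d st by simp
  show r: "v a * v 0 = v a" if "a < d" for a
  proof -
    have "star (v a * v 0 - v a) * (v a * v 0 - v a) =
        v 0 * (star (v a) * v a) * v 0 - v 0 * (star (v a) * v a) - (star (v a) * v a) * v 0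
        + star (v a) * v a"
      by (simp add: star_diff star_mult st algebra_simps)
    also have "\<dots> = 0" using c[OF that that] by (simp add: p)
    finally show ?thesis using star_mult_eq_0 by fastforce
  qed
  show "v 0 * star (v a) = star (v a)" if "a < d" for a
    using r[OF that] st by (metis star_mult)
  show "v a * v b = (if b = 0 then v a else 0)" if "a < d" "b < d" for a b
  proof -
    have "v a * v b = v a * (star (v 0) * v b)" using r[OF that(1)] st
      by (metis mult.assoc)
    then show ?thesis using c[OF d that(2)] r[OF that(1)] by simp
  qed
  show "norm (v a) \<le> 1" if "a < d" for a
  proof -
    have "(norm (v a))\<^sup>2 \<le> 1" 
      using c[OF that that] norm_projection_le[OF st p] by (simp flip: cstar_identity)
    then show ?thesis by (simp add: power2_le_iff_abs_le flip: abs_le_square_iff[of _ 1, simplified])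
  qed
qed

text \<open>The sum of the norms of all entries serves as a submultiplicative norm for matrices over
  the algebra; it avoids their C*-norm at the price of factors depending on
  \<open>d\<close>.\<close>

lemma sum_norm_matrix_mult_le:
  fixes H K :: "nat \<Rightarrow> nat \<Rightarrow> 'a::real_normed_algebra"
  shows "(\<Sum>a<d. \<Sum>c<d. norm (\<Sum>b<d. H a b * K b c))
    \<le> (\<Sum>a<d. \<Sum>b<d. norm (H a b)) * (\<Sum>a<d. \<Sum>b<d. norm (K a b))"
proof -
  have "(\<Sum>a<d. \<Sum>c<d. norm (\<Sum>b<d. H a b * K b c)) \<le> (\<Sum>a<d. \<Sum>c<d. \<Sum>b<d. norm (H a b) * norm (K b c))"
    by (intro sum_mono order.trans[OF norm_sum] norm_mult_ineq)
  also have "\<dots> = (\<Sum>a<d. \<Sum>b<d. norm (H a b) * (\<Sum>c<d. norm (K b c)))"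
    by (subst sum.swap) (simp add: sum_distrib_left)
  also have "\<dots> \<le> (\<Sum>a<d. \<Sum>b<d. norm (H a b) * (\<Sum>b<d. \<Sum>c<d. norm (K b c)))"
    by (intro sum_mono mult_left_mono member_le_sum) (auto intro: sum_nonneg)
  finally show ?thesis by (simp add: sum_distrib_right)
qed

text \<open>The Newton-Schulz iteration for the inverse square root of the Gram matrix \<open>1 - H\<close>: one step
  replaces \<open>H\<close> by \<open>3/4 H\<^sup>2 + 1/4 H\<^sup>3\<close>.\<close>

lemma orthonormalize_step:
  fixes e :: "'a::cstar_algebra" and v :: "nat \<Rightarrow> 'a"
  assumes e: "star e = e" "e * e = e" and ve: "\<And>a. a < d \<Longrightarrow> v a * e = v a"
  defines "H \<equiv> \<lambda>v a b. (if a = b then e else 0) - star (v a) * v b"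
  defines "D \<equiv> \<lambda>v. \<Sum>a<d. \<Sum>b<d. norm (H v a b)"
  defines "v' \<equiv> \<lambda>a. v a + (1/2) *\<^sub>R (\<Sum>b<d. v b * H v b a)"
  assumes D: "D v \<le> 1/2"
  shows "\<And>a. a < d \<Longrightarrow> v' a * e = v' a"
    "D v' \<le> 1/2 * D v" "\<And>a. a < d \<Longrightarrow> norm (v' a - v a) \<le> D v"
proof -
  define G where "G = H v"
  have ev: "e * star (v a) = star (v a)" if "a < d" for a
    using ve[OF that] e by (metis star_mult)
  \<comment> \<open>The entries of the error matrix lie in the corner cut out by \<open>e\<close>,
    where \<open>e\<close> is the unit; thus \<open>e\<close> takes the place of 1 in the Gram
    matrix.\<close>
  have eG: "e * G a b = G a b" "G a b * e = G a b" "star (G a b) = G b a" if "a < d" "b < d" for a b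
  proof -
    show "e * G a b = G a b"
      using ev[OF that(1)] e by (simp add: G_def H_def right_diff_distrib flip: mult.assoc)
    show "G a b * e = G a b"
      using ve[OF that(2)] e by (simp add: G_def H_def left_diff_distrib mult.assoc)
    show "star (G a b) = G b a"
      using e by (simp add: G_def H_def star_diff star_mult star_star)
  qed
  have v'_eq: "v' a = v a + (1/2) *\<^sub>R (\<Sum>b<d. v b * G b a)" for a by (simp add: v'_def G_def)
  show "v' a * e = v' a" if "a < d" for a
    unfolding v'_eq using ve eG that
    by (simp add: algebra_simps sum_distrib_right mult.assoc)
  \<comment> \<open>\<open>G2\<close> and \<open>G3\<close> are the square and the cube of the
    matrix \<open>G\<close>.\<close>
  define G2 where "G2 = (\<lambda>a c. \<Sum>b<d. G a b * G b c)"
  define G3 where "G3 = (\<lambda>a c. \<Sum>b<d. G a b * G2 b c)"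
  have vv: "star (v a) * v b = (if a = b then e else 0) - G a b" for a b
    by (simp add: G_def H_def)
  have star_v': "star (v' a) = star (v a) + (1/2) *\<^sub>R (\<Sum>b<d. G a b * star (v b))" if "a < d" for a
    unfolding v'_eq using that by (simp add: star_add star_scaleR star_sum star_mult eG)
  have s1: "star (v a) * (\<Sum>b<d. v b * K b) = K a - (\<Sum>b<d. G a b * K b)"
    if "a < d" "\<And>b. b < d \<Longrightarrow> e * K b = K b" for a K
  proof -
    have "star (v a) * (\<Sum>b<d. v b * K b) = (\<Sum>b<d. (star (v a) * v b) * K b)"
      by (simp add: sum_distrib_left mult.assoc)
    also have "\<dots> = (\<Sum>b<d. (if a = b then K a else 0) - G a b * K b)"
      unfolding vv using that by (intro sum.cong) (auto simp: algebra_simps)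
    also have "\<dots> = K a - (\<Sum>b<d. G a b * K b)"
      using that by (simp add: sum_subtractf)
    finally show ?thesis .
  qed
  \<comment> \<open>The new Gram matrix is
    \<open>(1 + G/2) (1 - G) (1 + G/2) = 1 - 3/4 G^2 - 1/4 G^3\<close>, with \<open>e\<close> as 1.
    The facts \<open>t1\<close>, \<open>t2\<close> and \<open>t3\<close> compute the terms linear
    and quadratic in the correction.\<close>
  have H': "H v' a c = (3/4) *\<^sub>R G2 a c + (1/4) *\<^sub>R G3 a c" if ac: "a < d" "c < d" for a c
  proof -
    have t1: "star (v a) * (\<Sum>b<d. v b * G b c) = G a c - G2 a c" if "a < d" for a
      using s1[OF that, of "\<lambda>b. G b c"] eG ac by (simp add: G2_def)
    have t2: "(\<Sum>b<d. G a b * star (v b)) * v c = G a c - G2 a c"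
    proof -
      have "(\<Sum>b<d. G a b * star (v b)) * v c = star (star (v c) * (\<Sum>b<d. v b * G b a))"
        using ac by (simp add: star_mult star_sum star_star eG)
      also have "\<dots> = star (G c a - (\<Sum>b<d. G c b * G b a))"
        using s1[OF ac(2), of "\<lambda>b. G b a"] eG ac by simp
      also have "\<dots> = G a c - G2 a c"
        using ac by (simp add: star_diff star_sum star_mult eG G2_def)
      finally show ?thesis .
    qed
    have t3: "(\<Sum>b<d. G a b * star (v b)) * (\<Sum>b<d. v b * G b c) = G2 a c - G3 a c"
    proof -
      have "(\<Sum>b<d. G a b * star (v b)) * (\<Sum>b<d. v b * G b c) =
          (\<Sum>b<d. G a b * (star (v b) * (\<Sum>b<d. v b * G b c)))"
        by (simp add: sum_distrib_right mult.assoc)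
      also have "\<dots> = (\<Sum>b<d. G a b * G b c - G a b * G2 b c)"
        by (intro sum.cong) (auto simp: t1 algebra_simps)
      finally show ?thesis by (simp add: sum_subtractf G2_def G3_def)
    qed
    have "star (v' a) * v' c = star (v a) * v c + (1/2) *\<^sub>R (star (v a) * (\<Sum>b<d. v b * G b c))
      + (1/2) *\<^sub>R ((\<Sum>b<d. G a b * star (v b)) * v c)
      + (1/4) *\<^sub>R ((\<Sum>b<d. G a b * star (v b)) * (\<Sum>b<d. v b * G b c))"
      unfolding star_v'[OF ac(1)] v'_eq[of c] by (simp add: distrib_left distrib_right scaleR_add_right)
    also have "\<dots> = (if a = c then e else 0) - G a c + (1/2) *\<^sub>R (G a c - G2 a c)
      + (1/2) *\<^sub>R (G a c - G2 a c) + (1/4) *\<^sub>R (G2 a c - G3 a c)"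
      unfolding t1[OF ac(1)] t2 t3 vv ..
    also have "\<dots> = (if a = c then e else 0) - ((1/2) *\<^sub>R G2 a c + (1/2) *\<^sub>R G2 a c
        - (1/4) *\<^sub>R G2 a c + (1/4) *\<^sub>R G3 a c)"
    proof -
      have "(1/2) *\<^sub>R G a c + (1/2) *\<^sub>R G a c = G a c" by (simp flip: scaleR_add_left)
      then show ?thesis by (simp add: algebra_simps)
    qed
    also have "(1/2) *\<^sub>R G2 a c + (1/2) *\<^sub>R G2 a c - (1/4) *\<^sub>R G2 a c = (3/4) *\<^sub>R G2 a c"
      using scaleR_diff_left[of 1 "1/4" "G2 a c"] by (simp flip: scaleR_add_left)
    finally show ?thesis by (simp add: H_def)
  qed
  have Dv: "D v = (\<Sum>a<d. \<Sum>b<d. norm (G a b))" by (simp add: D_def G_def)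
  have D0: "0 \<le> D v" unfolding Dv by (intro sum_nonneg) auto
  have D2: "(\<Sum>a<d. \<Sum>c<d. norm (G2 a c)) \<le> D v * D v"
    unfolding G2_def Dv by (rule sum_norm_matrix_mult_le)
  have D3: "(\<Sum>a<d. \<Sum>c<d. norm (G3 a c)) \<le> D v * (D v * D v)"
    unfolding G3_def
    by (rule order.trans[OF sum_norm_matrix_mult_le]) (use D2 D0 Dv in \<open>auto intro!: mult_mono sum_nonneg\<close>)
  have "D v' \<le> (\<Sum>a<d. \<Sum>c<d. 3/4 * norm (G2 a c) + 1/4 * norm (G3 a c))"
    unfolding D_def by (intro sum_mono) (auto simp: H' intro!: order.trans[OF norm_triangle_ineq])
  also have "\<dots> = 3/4 * (\<Sum>a<d. \<Sum>c<d. norm (G2 a c)) + 1/4 * (\<Sum>a<d. \<Sum>c<d. norm (G3 a c))"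
    by (simp add: sum.distrib sum_distrib_left)
  also have "\<dots> \<le> 3/4 * (D v * D v) + 1/4 * (D v * (D v * D v))"
    using D2 D3 by simp
  also have "\<dots> \<le> 3/4 * (D v * (1/2)) + 1/4 * (D v * ((1/2) * (1/2)))"
    using D D0 by (intro add_mono mult_left_mono mult_mono) auto
  also have "\<dots> \<le> 1/2 * D v" using D0 by simp
  finally show "D v' \<le> 1/2 * D v" .
  show "norm (v' a - v a) \<le> D v" if a: "a < d" for a
  proof -
    have le: "norm (G b c) \<le> D v" if "b < d" "c < d" for b c
    proof -
      have "norm (G b c) \<le> (\<Sum>c<d. norm (G b c))" using that by (intro member_le_sum) auto
      also have "\<dots> \<le> D v" unfolding Dv using that
        by (intro member_le_sum[of b _ "\<lambda>b. \<Sum>c<d. norm (G b c)"]) (auto intro: sum_nonneg)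
      finally show ?thesis .
    qed
    have nv: "norm (v b) \<le> 2" if "b < d" for b
    proof (rule norm_le_two_of_square)
      have "(norm (v b))\<^sup>2 = norm (e - G b b)" using vv[of b b] by (simp flip: cstar_identity)
      also have "\<dots> \<le> norm e + norm (G b b)" by (rule norm_triangle_ineq4)
      also have "\<dots> \<le> 1 + 1/2" using norm_projection_le[OF e] le[OF that that] D by simp
      finally have *: "(norm (v b))\<^sup>2 \<le> 3/2" by simp
      show "(norm (v b))\<^sup>2 \<le> norm (v b) + 1"
      proof (cases "norm (v b) \<ge> 1/2")
        case False
        then have "(norm (v b))\<^sup>2 \<le> (1/2)\<^sup>2" by (intro power_mono) auto
        also have "\<dots> \<le> norm (v b) + 1" using norm_ge_zero[of "v b"] by (simp add: power2_eq_square)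
        finally show ?thesis .
      qed (use * in simp)
    qed simp
    have "norm (v' a - v a) = 1/2 * norm (\<Sum>b<d. v b * G b a)" by (simp add: v'_eq)
    also have "\<dots> \<le> 1/2 * (\<Sum>b<d. 2 * norm (G b a))"
      using nv by (intro mult_left_mono order.trans[OF norm_sum] sum_mono norm_mult_le) auto
    also have "\<dots> = (\<Sum>b<d. norm (G b a))" by (simp flip: sum_distrib_left)
    also have "\<dots> \<le> D v" unfolding Dv using a by (intro sum_mono member_le_sum) auto
    finally show ?thesis .
  qed
qed

text \<open>The error after \<open>n\<close> steps is at most \<open>D v * (1/2) ^ n\<close> and
  also bounds the next displacement. The limits \<open>w a\<close> are partial isometries with
  common initial projection \<open>e\<close> and mutually orthogonal ranges.\<close>

lemma orthonormalize:
  fixes e :: "'a::cstar_algebra" and v :: "nat \<Rightarrow> 'a"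
  assumes S: "cstar_subalgebra S" "e \<in> S" "\<And>a. a < d \<Longrightarrow> v a \<in> S"
    and e: "star e = e" "e * e = e" and ve: "\<And>a. a < d \<Longrightarrow> v a * e = v a"
  defines "D \<equiv> \<lambda>v. \<Sum>a<d. \<Sum>b<d. norm ((if a = b then e else 0) - star (v a) * v b)"
  assumes D: "D v \<le> 1/2"
  obtains w where "\<And>a. a < d \<Longrightarrow> w a \<in> S" "\<And>a. a < d \<Longrightarrow> w a * e = w a"
    "\<And>a b. a < d \<Longrightarrow> b < d \<Longrightarrow> star (w a) * w b = (if a = b then e else 0)"
    "\<And>a. a < d \<Longrightarrow> norm (w a - v a) \<le> 2 * D v"
proof -
  define f where "f = (\<lambda>(v::nat \<Rightarrow> 'a) a. v a + (1/2) *\<^sub>R (\<Sum>b<d. v b * ((if b = a then e else 0) - star (v b) * v a)))"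
  define s where "s = (\<lambda>n. (f ^^ n) v)"
  have ss: "s (Suc n) = f (s n)" for n by (simp add: s_def)
  have st: "\<And>a. a < d \<Longrightarrow> f u a * e = f u a" "D (f u) \<le> 1/2 * D u"
      "\<And>a. a < d \<Longrightarrow> norm (f u a - u a) \<le> D u"
    if "\<And>a. a < d \<Longrightarrow> u a * e = u a" "D u \<le> 1/2" for u
    using orthonormalize_step[OF e that(1) that(2)[unfolded D_def]] unfolding D_def f_def by auto
  have s: "(\<forall>a<d. s n a \<in> S \<and> s n a * e = s n a) \<and> D (s n) \<le> D v * (1/2) ^ n" for n
  proof (induction n)
    case 0 then show ?case using S ve by (simp add: s_def)
  next
    case (Suc n)
    have "D v * (1/2) ^ n \<le> 1/2 * 1" using D by (intro mult_mono) (auto simp: power_le_one)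
    with Suc have "D (s n) \<le> 1/2" by linarith
    note st = st[OF _ this]
    have "s (Suc n) a \<in> S" if "a < d" for a
      unfolding ss f_def using Suc S that
      by (intro cstar_subalgebraD(3,7)[OF S(1)] cstar_subalgebra_sum[OF S(1)] cstar_subalgebraD(4)[OF S(1)]
          cstar_subalgebraD(9)[OF S(1)] cstar_subalgebraD(5)[OF S(1)])
        (auto simp: cstar_subalgebraD)
    with st Suc show ?case unfolding ss by fastforce
  qed
  have step: "norm (s (Suc n) a - s n a) \<le> D v * (1/2) ^ n" if "a < d" for n a
  proof -
    have "D v * (1/2) ^ n \<le> 1/2 * 1" using D by (intro mult_mono) (auto simp: power_le_one)
    with s[of n] have "D (s n) \<le> 1/2" by linarith
    note st = st[OF _ this]
    have "norm (s (Suc n) a - s n a) \<le> D (s n)"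
      unfolding ss by (rule st(3)) (use s that in auto)
    then show ?thesis using s[of n] by linarith
  qed
  have "\<exists>l. (\<lambda>n. s n a) \<longlonglongrightarrow> l \<and> norm (l - s 0 a) \<le> 2 * D v" if "a < d" for a
    using LIMSEQ_of_geometric_steps[of "\<lambda>n. s n a", OF step[OF that]] by metis
  then obtain w where w: "\<And>a. a < d \<Longrightarrow> (\<lambda>n. s n a) \<longlonglongrightarrow> w a"
    "\<And>a. a < d \<Longrightarrow> norm (w a - s 0 a) \<le> 2 * D v" by metis
  show thesis
  proof (rule that)
    show "w a \<in> S" if "a < d" for a
      using closed_sequentially[OF cstar_subalgebraD(1)[OF S(1)] _ w(1)[OF that]] s that by blast
    show "w a * e = w a" if "a < d" for a
    proof (rule LIMSEQ_unique[OF _ w(1)[OF that]])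
      show "(\<lambda>n. s n a) \<longlonglongrightarrow> w a * e"
        using tendsto_mult[OF w(1)[OF that] tendsto_const[of e]] s that by simp
    qed
    show "norm (w a - v a) \<le> 2 * D v" if "a < d" for a using w(2)[OF that] by (simp add: s_def)
    show "star (w a) * w b = (if a = b then e else 0)" if ab: "a < d" "b < d" for a b
    proof -
      have le: "norm ((if a = b then e else 0) - star (s n a) * s n b) \<le> D v * (1/2) ^ n" for n
      proof -
        have "norm ((if a = b then e else 0) - star (s n a) * s n b)
           \<le> (\<Sum>b<d. norm ((if a = b then e else 0) - star (s n a) * s n b))"
          using ab by (intro member_le_sum) auto
        also have "\<dots> \<le> D (s n)" unfolding D_def using ab
          by (intro member_le_sum[of a _ "\<lambda>a. \<Sum>b<d. norm ((if a = b then e else 0) - star (s n a) * s n b)"])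
            (auto intro: sum_nonneg)
        finally show ?thesis using s[of n] by linarith
      qed
      have "(\<lambda>n. (if a = b then e else 0) - star (s n a) * s n b) \<longlonglongrightarrow> (if a = b then e else 0) - star (w a) * w b"
        using ab by (intro tendsto_intros w)
      moreover have "(\<lambda>n. (if a = b then e else 0) - star (s n a) * s n b) \<longlonglongrightarrow> 0"
      proof (rule Lim_null_comparison)
        show "(\<lambda>n. D v * (1/2) ^ n) \<longlonglongrightarrow> 0"
          using tendsto_mult_right_zero[OF LIMSEQ_power_zero[of "1/2::real"], of "D v"] by simp
      qed (use le in simp)
      ultimately show ?thesis using LIMSEQ_unique by fastforce
    qed
  qed
qed

lemma col_sum_projection:
  assumes "unit_column d (w :: nat \<Rightarrow> 'a::cstar_algebra)"
  shows "a < d \<Longrightarrow> col_sum d w * w a = w a" "star (col_sum d w) = col_sum d w"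
    "col_sum d w * col_sum d w = col_sum d w"
proof -
  show w: "col_sum d w * w a = w a" if "a < d" for a
  proof -
    have "col_sum d w * w a = (\<Sum>b<d. w b * (star (w b) * w a))"
      by (simp add: col_sum_def sum_distrib_right mult.assoc)
    also have "\<dots> = (\<Sum>b<d. if b = a then w a else 0)"
      using that by (intro sum.cong) (auto simp: columnD[OF assms])
    finally show ?thesis using that by simp
  qed
  show "star (col_sum d w) = col_sum d w"
    by (simp add: col_sum_def star_sum star_mult star_star)
  have "col_sum d w * col_sum d w = (\<Sum>a<d. (col_sum d w * w a) * star (w a))"
    by (subst (2) col_sum_def) (simp add: sum_distrib_left mult.assoc)
  also have "\<dots> = col_sum d w" by (simp add: w) (simp add: col_sum_def)
  finally show "col_sum d w * col_sum d w = col_sum d w" .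
qed

text \<open>\<open>1 - col_sum d w\<close> acts as a projection on \<open>S\<close>, so it vanishes as soon as its norm is below 1.\<close>

lemma column_unit_gap:
  assumes S: "cstar_subalgebra S" and w: "unit_column d w" "\<And>a. a < d \<Longrightarrow> w a \<in> S"
    and gap: "\<And>z. z \<in> S \<Longrightarrow> norm (z - col_sum d w * z) \<le> 1/2 * norm z"
    and z: "z \<in> S"
  shows "col_sum d w * z = z"
proof -
  define y where "y = z - col_sum d w * z"
  have "col_sum d w \<in> S" unfolding col_sum_def
    by (intro cstar_subalgebra_sum[OF S] cstar_subalgebraD(4)[OF S] cstar_subalgebraD(5)[OF S])
      (auto intro: w)
  then have "y \<in> S" unfolding y_def using z S by (auto intro: cstar_subalgebraD)
  moreover have "col_sum d w * y = 0"
    unfolding y_def using col_sum_projection(3)[OF w(1)] by (simp add: right_diff_distrib flip: mult.assoc)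
  ultimately have "norm y \<le> 1/2 * norm y" using gap[of y] by simp
  then show ?thesis by (simp add: y_def)
qed

section \<open>Stability of the column relations\<close>

text \<open>The element \<open>star (x 0) * x 0\<close> is selfadjoint and nearly idempotent, so a
  projection \<open>e\<close> lies near it; cutting the \<open>x a\<close> down by \<open>e\<close>
  gives a row that can be orthonormalized. The two smallness conditions on \<open>\<delta>\<close>
  are those of the two iterations: \<open>6 * \<delta>\<close> is at most 1/8, and
  \<open>62 * d^2 * \<delta>\<close> is at most 1/2.\<close>

lemma column_near_explicit:
  fixes x :: "nat \<Rightarrow> 'a::cstar_algebra"
  assumes S: "cstar_subalgebra S" "\<And>a. a < d \<Longrightarrow> x a \<in> S" and d: "0 < d"
    and x: "\<And>a b. a < d \<Longrightarrow> b < d \<Longrightarrow> norm (star (x a) * x b - (if a = b then x 0 else 0)) \<le> \<delta>"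
    and \<delta>: "48 * \<delta> \<le> 1" "124 * (real d)\<^sup>2 * \<delta> \<le> 1"
  obtains w where "\<And>a. a < d \<Longrightarrow> w a \<in> S" "unit_column d w"
    "\<And>a. a < d \<Longrightarrow> norm (w a - x a) \<le> 2 * (124 * (real d)\<^sup>2 * \<delta> + sqrt (248 * \<delta>)) + 61 * \<delta>"
proof -
  define h where "h = star (x 0) * x 0"
  have \<delta>0: "0 \<le> \<delta>" using x[OF d d] norm_ge_zero order.trans by blast
  have h1: "norm (h - x 0) \<le> \<delta>" using x[OF d d] by (simp add: h_def)
  have sh: "star h = h" by (simp add: h_def star_mult star_star)
  have h2: "norm (h - star (x 0)) \<le> \<delta>"
    using h1 sh norm_star[of "h - x 0"] by (simp add: star_diff)
  have n0: "norm (x 0) \<le> 2"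
  proof (rule norm_le_two_of_square)
    have "(norm (x 0))\<^sup>2 = norm (x 0 + (h - x 0))" by (simp add: h_def flip: cstar_identity)
    also have "\<dots> \<le> norm (x 0) + \<delta>" using norm_triangle_ineq h1 by (smt (verit))
    finally show "(norm (x 0))\<^sup>2 \<le> norm (x 0) + 1" using \<delta> by linarith
  qed simp
  have nh: "norm h \<le> 4" unfolding h_def using n0 norm_mult_le[of "star (x 0)" 2 "x 0" 2] by simp
  have "h * h - h = h * (h - x 0) + (h - star (x 0)) * x 0"
    by (simp add: h_def algebra_simps)
  then have "norm (h * h - h) \<le> 4 * \<delta> + \<delta> * 2"
    by (simp only:) (intro order.trans[OF norm_triangle_ineq] add_mono norm_mult_le nh n0 h1 h2)
  then have hh: "norm (h - h * h) \<le> 6 * \<delta>" by (simp add: norm_minus_commute)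
  have "h \<in> S" unfolding h_def using S d by (auto intro!: cstar_subalgebraD)
  moreover have "norm (h - h * h) \<le> 1/8" using hh \<delta> by linarith
  ultimately obtain e where e: "e \<in> S" "star e = e" "e * e = e" "norm (e - h) \<le> 10 * norm (h - h * h)"
    using projection_near[OF S(1) _ sh] by metis
  \<comment> \<open>Ten times the defect \<open>6 * \<delta>\<close>, plus the distance
    \<open>\<delta>\<close> from \<open>h\<close> to \<open>x 0\<close>.\<close>
  have ex: "norm (e - x 0) \<le> 61 * \<delta>"
    using norm_triangle_ineq[of "e - h" "h - x 0"] e(4) hh h1 by simp
  have ne: "norm e \<le> 1" by (rule norm_projection_le) (use e in auto)
  have k: "norm ((if a = b then e else 0) - star (x a) * x b) \<le> 62 * \<delta>" if "a < d" "b < d" for a b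
    using norm_triangle_ineq4[of "e - x 0" "star (x a) * x b - x 0"] x[OF that] ex \<delta>0
    by (auto split: if_splits simp: norm_minus_commute)
  define u where "u = (\<lambda>a. x a * e)"
  define D where "D = (\<Sum>a<d. \<Sum>b<d. norm ((if a = b then e else 0) - star (u a) * u b))"
  have "norm ((if a = b then e else 0) - star (u a) * u b) \<le> 62 * \<delta>" if "a < d" "b < d" for a b
  proof -
    have "(if a = b then e else 0) - star (u a) * u b = e * ((if a = b then e else 0) - star (x a) * x b) * e"
      by (simp add: u_def star_mult e algebra_simps)
    then show ?thesis
      using norm_mult_le[OF norm_mult_le[OF ne k[OF that]] ne] by simp
  qed
  then have "D \<le> (\<Sum>a<d. \<Sum>b<d. 62 * \<delta>)" unfolding D_def by (intro sum_mono) auto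
  then have D: "D \<le> 62 * (real d)\<^sup>2 * \<delta>" by (simp add: power2_eq_square mult_ac)
  have uS: "u a \<in> S" if "a < d" for a using S e that by (auto simp: u_def intro: cstar_subalgebraD)
  have ue: "u a * e = u a" for a using e by (simp add: u_def mult.assoc)
  have D12: "D \<le> 1/2" using D \<delta> by simp
  obtain w where w: "\<And>a. a < d \<Longrightarrow> w a \<in> S" "\<And>a. a < d \<Longrightarrow> w a * e = w a"
    "\<And>a b. a < d \<Longrightarrow> b < d \<Longrightarrow> star (w a) * w b = (if a = b then e else 0)"
    "\<And>a. a < d \<Longrightarrow> norm (w a - u a) \<le> 2 * D"
    using orthonormalize[OF S(1) e(1) uS e(2,3) ue D12[unfolded D_def]] unfolding D_def by blast
  define \<kappa> where "\<kappa> = 124 * (real d)\<^sup>2 * \<delta> + sqrt (248 * \<delta>)"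
  have wx: "norm (w a - x a) \<le> \<kappa>" if "a < d" for a
  proof -
    define g where "g = e - star (x a) * x a"
    \<comment> \<open>Only the star-square of \<open>x a - x a * e\<close> is directly controlled,
      by four terms of norm at most \<open>62 * \<delta>\<close>; this is the origin of the square
      root in the estimate.\<close>
    have "star (x a - u a) * (x a - u a) = (e * g - g) - (e * g * e - g * e)"
      by (simp add: u_def g_def star_diff star_mult e algebra_simps)
    moreover have "norm \<dots> \<le> (62 * \<delta> + 62 * \<delta>) + (62 * \<delta> + 62 * \<delta>)"
    proof -
      have g: "norm g \<le> 62 * \<delta>" using k[OF that that] by (simp add: g_def)
      show ?thesis
        using norm_mult_le[OF ne g] norm_mult_le[OF norm_mult_le[OF ne g] ne] norm_mult_le[OF g ne] g
        by (intro order.trans[OF norm_triangle_ineq4] add_mono) auto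
    qed
    ultimately have "(norm (x a - u a))\<^sup>2 \<le> 248 * \<delta>" by (simp flip: cstar_identity)
    then have "norm (x a - u a) \<le> sqrt (248 * \<delta>)" by (simp add: real_le_rsqrt)
    moreover have "norm (w a - u a) \<le> 124 * (real d)\<^sup>2 * \<delta>" using w(4)[OF that] D by simp
    ultimately show ?thesis
      using norm_triangle_ineq4[of "w a - u a" "x a - u a"] by (simp add: \<kappa>_def)
  qed
  \<comment> \<open>The orthonormal row starts with \<open>w 0\<close>, which is close to
    \<open>e\<close> but need not be a projection. Multiplication by \<open>star (w 0)\<close> moves
    the common initial projection from \<open>e\<close> to \<open>w 0 * star (w 0)\<close>, which is
    then the entry \<open>y 0\<close>.\<close>
  define y where "y = (\<lambda>a. w a * star (w 0))"
  show thesis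
  proof (rule that)
    show "y a \<in> S" if "a < d" for a unfolding y_def using that d w S by (auto intro!: cstar_subalgebraD)
    have "star (y a) * y b = (if a = b then y 0 else 0)" if "a < d" "b < d" for a b
    proof -
      have "star (y a) * y b = w 0 * (star (w a) * w b) * star (w 0)"
        by (simp add: y_def star_mult star_star mult.assoc)
      also have "\<dots> = (if a = b then y 0 else 0)"
        unfolding w(3)[OF that] using w(2)[OF d] by (simp add: y_def)
      finally show ?thesis .
    qed
    then show "unit_column d y" using d by (simp add: unit_column_def)
    show "norm (y a - x a) \<le> 2 * (124 * (real d)\<^sup>2 * \<delta> + sqrt (248 * \<delta>)) + 61 * \<delta>" if "a < d" for a
    proof -
      have "(norm (w a))\<^sup>2 \<le> 1" using w(3)[OF that that] ne by (simp flip: cstar_identity)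
      then have nw: "norm (w a) \<le> 1" by (simp add: power2_le_iff_abs_le flip: abs_le_square_iff[of _ 1, simplified])
      have "norm (w 0 - e) \<le> \<kappa> + 61 * \<delta>"
        using norm_triangle_ineq4[of "w 0 - x 0" "e - x 0"] wx[OF d] ex by simp
      then have "norm (star (w 0) - e) \<le> \<kappa> + 61 * \<delta>"
        using norm_star[of "w 0 - e"] e(2) by (simp add: star_diff)
      then have "norm (w a * (star (w 0) - e)) \<le> 1 * (\<kappa> + 61 * \<delta>)" using nw by (intro norm_mult_le)
      moreover have "y a - x a = w a * (star (w 0) - e) + (w a - x a)"
        using w(2)[OF that] by (simp add: y_def algebra_simps)
      ultimately have "norm (y a - x a) \<le> 1 * (\<kappa> + 61 * \<delta>) + \<kappa>"
        using norm_triangle_ineq[of "w a * (star (w 0) - e)" "w a - x a"] wx[OF that] by (simp only:)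
      then have "norm (y a - x a) \<le> 2 * \<kappa> + 61 * \<delta>" by (simp only: mult_1 mult_2 add_ac)
      then show ?thesis unfolding \<kappa>_def .
    qed
  qed
qed

text \<open>The number \<open>\<delta>\<close> depends on \<open>d\<close> and \<open>\<eta>\<close>
  alone and serves all subalgebras \<open>S\<close> at once. The condition on \<open>z\<close> says
  that the sum is almost a left unit on \<open>S\<close>; the corrected column has a projection as
  its sum, and \<open>column_unit_gap\<close> makes that projection an exact left unit.\<close>

lemma unital_column_near:
  assumes d: "0 < d" and \<eta>: "0 < \<eta>"
  shows "\<exists>\<delta>>0. \<forall>S (x :: nat \<Rightarrow> 'a::cstar_algebra). cstar_subalgebra S \<longrightarrow> (\<forall>a<d. x a \<in> S) \<longrightarrow>
    (\<forall>a<d. \<forall>b<d. norm (star (x a) * x b - (if a = b then x 0 else 0)) \<le> \<delta>) \<longrightarrow>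
    (\<forall>z\<in>S. norm (z - col_sum d x * z) \<le> \<delta> * norm z) \<longrightarrow>
    (\<exists>w. (\<forall>a<d. w a \<in> S) \<and> unit_column d w \<and> (\<forall>z\<in>S. col_sum d w * z = z) \<and> (\<forall>a<d. norm (w a - x a) \<le> \<eta>))"
proof -
  define \<kappa> where "\<kappa> = (\<lambda>\<delta>. 2 * (124 * (real d)\<^sup>2 * \<delta> + sqrt (248 * \<delta>)) + 61 * \<delta>)"
  \<comment> \<open>Moving the column by \<open>\<epsilon>\<close> changes each of the
    \<open>d\<close> summands of \<open>col_sum\<close> by at most \<open>3 * \<epsilon>\<close>,
    hence the sum by at most 1/4. Together with \<open>\<delta>\<close> at most 1/48 this stays
    below the 1/2 required by \<open>column_unit_gap\<close>.\<close>
  define \<epsilon> where "\<epsilon> = min (min \<eta> 1) (1 / (12 * real d))"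
  have \<epsilon>: "0 < \<epsilon>" "\<epsilon> \<le> \<eta>" "\<epsilon> \<le> 1" "12 * real d * \<epsilon> \<le> 1"
  proof -
    show "0 < \<epsilon>" "\<epsilon> \<le> \<eta>" "\<epsilon> \<le> 1" using d \<eta> by (auto simp: \<epsilon>_def)
    have "12 * real d * \<epsilon> \<le> 12 * real d * (1 / (12 * real d))"
      unfolding \<epsilon>_def by (intro mult_left_mono) auto
    then show "12 * real d * \<epsilon> \<le> 1" using d by simp
  qed
  have "(\<kappa> \<longlongrightarrow> \<kappa> 0) (at_right 0)" unfolding \<kappa>_def by (intro tendsto_intros)
  then have "eventually (\<lambda>\<delta>. \<kappa> \<delta> < \<epsilon>) (at_right 0)"
    using \<epsilon> by (intro order_tendstoD(2)) (auto simp: \<kappa>_def)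
  moreover have "eventually (\<lambda>\<delta>. 0 < \<delta> \<and> 48 * \<delta> \<le> 1 \<and> 124 * (real d)\<^sup>2 * \<delta> \<le> 1) (at_right (0::real))"
    unfolding eventually_at_right_field
    using d by (intro exI[of _ "min (1/48) (1 / (124 * (real d)\<^sup>2))"]) (auto simp: field_simps)
  ultimately have "eventually (\<lambda>\<delta>. \<kappa> \<delta> < \<epsilon> \<and> 0 < \<delta> \<and> 48 * \<delta> \<le> 1 \<and> 124 * (real d)\<^sup>2 * \<delta> \<le> 1) (at_right (0::real))"
    by (rule eventually_conj)
  then obtain \<delta> where \<delta>: "\<kappa> \<delta> < \<epsilon>" "0 < \<delta>" "48 * \<delta> \<le> 1" "124 * (real d)\<^sup>2 * \<delta> \<le> 1"
    using eventually_happens[of _ "at_right (0::real)"] by (auto simp: trivial_limit_at_right_real)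
  show ?thesis
  proof (intro exI[of _ \<delta>] conjI allI impI)
    fix S and x :: "nat \<Rightarrow> 'a"
    assume S: "cstar_subalgebra S" "\<forall>a<d. x a \<in> S"
      and x: "\<forall>a<d. \<forall>b<d. norm (star (x a) * x b - (if a = b then x 0 else 0)) \<le> \<delta>"
      and u: "\<forall>z\<in>S. norm (z - col_sum d x * z) \<le> \<delta> * norm z"
    obtain w where w: "\<And>a. a < d \<Longrightarrow> w a \<in> S" "unit_column d w" "\<And>a. a < d \<Longrightarrow> norm (w a - x a) \<le> \<kappa> \<delta>"
      using column_near_explicit[OF S(1) _ d _ \<delta>(3,4), of x] S(2) x unfolding \<kappa>_def by metis
    have wx: "norm (w a - x a) \<le> \<epsilon>" if "a < d" for a using w(3)[OF that] \<delta>(1) by linarith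
    have ww: "norm (w a * star (w a) - x a * star (x a)) \<le> 3 * \<epsilon>" if "a < d" for a
    proof -
      have nw: "norm (w a) \<le> 1" by (rule columnD(8)[OF w(2) that])
      have nx: "norm (x a) \<le> 2"
        using norm_triangle_ineq4[of "w a" "w a - x a"] wx[OF that] nw \<epsilon>(3) by simp
      have "w a * star (w a) - x a * star (x a) = (w a - x a) * star (w a) + x a * star (w a - x a)"
        by (simp add: algebra_simps star_diff)
      moreover have "norm \<dots> \<le> \<epsilon> * 1 + 2 * \<epsilon>"
        using nw nx wx[OF that]
        by (intro order.trans[OF norm_triangle_ineq] add_mono norm_mult_le) simp_all
      ultimately show ?thesis by simp
    qed
    have cc: "norm (col_sum d w - col_sum d x) \<le> 1/4"
    proof -
      have "norm (col_sum d w - col_sum d x) = norm (\<Sum>a<d. w a * star (w a) - x a * star (x a))"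
        by (simp add: col_sum_def sum_subtractf)
      also have "\<dots> \<le> (\<Sum>a<d. 3 * \<epsilon>)" using ww by (intro order.trans[OF norm_sum] sum_mono) auto
      also have "\<dots> \<le> 1/4" using \<epsilon>(4) by simp
      finally show ?thesis .
    qed
    have "norm (z - col_sum d w * z) \<le> 1/2 * norm z" if "z \<in> S" for z
    proof -
      have eq: "z - col_sum d w * z = (z - col_sum d x * z) - (col_sum d w - col_sum d x) * z"
        by (simp add: algebra_simps)
      have b1: "norm \<dots> \<le> \<delta> * norm z + 1/4 * norm z"
        using u that cc
        by (intro order.trans[OF norm_triangle_ineq4[of "z - col_sum d x * z"]] add_mono norm_mult_le) auto
      have "\<delta> * norm z \<le> 1/48 * norm z" using \<delta>(3) by (intro mult_right_mono) auto
      then show ?thesis unfolding eq using b1 norm_ge_zero[of z] by linarith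
    qed
    then have "col_sum d w * z = z" if "z \<in> S" for z
      using column_unit_gap[OF S(1) w(2,1) _ that] by blast
    then show "\<exists>w. (\<forall>a<d. w a \<in> S) \<and> unit_column d w \<and> (\<forall>z\<in>S. col_sum d w * z = z) \<and> (\<forall>a<d. norm (w a - x a) \<le> \<eta>)"
      using w(1,2) wx \<epsilon>(2) by (meson order.trans)
  qed (use \<delta> in auto)
qed

subsection \<open>Matrix algebras and unitary conjugacy of columns\<close>

definition mat_val :: "nat \<Rightarrow> (nat \<Rightarrow> nat \<Rightarrow> complex) \<Rightarrow> (nat \<Rightarrow> 'a::cstar_algebra) \<Rightarrow> 'a" where
  "mat_val d c v = (\<Sum>p<d. \<Sum>q<d. c p q *\<^sub>C (v p * star (v q)))"

text \<open>For a unital column this is the span of the matrix units, see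
  \<open>mat_alg_eq_range\<close>. Describing it by the compressions
  \<open>star (v p) * x * v q\<close> exhibits it as an intersection of preimages of closed sets, so
  that it is visibly closed.\<close>

definition mat_alg :: "nat \<Rightarrow> (nat \<Rightarrow> 'a::cstar_algebra) \<Rightarrow> 'a set" where
  "mat_alg d v = {x. \<forall>p<d. \<forall>q<d. \<exists>c. star (v p) * x * v q = c *\<^sub>C v 0}"

lemma closed_range_scaleC: "closed (range (\<lambda>c. c *\<^sub>C (e::'a::cstar_algebra)))"
proof (cases "e = 0")
  case False
  have "bounded_linear (\<lambda>c. c *\<^sub>C e)"
    by (rule bounded_linear_intro[of _ "norm e"])
      (simp_all add: scaleC_add_left norm_scaleC scaleR_conv_of_real scaleC_of_real flip: scaleC_scaleC)
  then have "complete ((\<lambda>c. c *\<^sub>C e) ` UNIV)"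
    using False
    by (intro complete_isometric_image[of "norm e"]) (auto simp: norm_scaleC complete_UNIV mult.commute)
  then show ?thesis by (rule complete_imp_closed)
qed simp

locale unital_column =
  fixes D :: nat and E :: "nat \<Rightarrow> 'a::unital_cstar_algebra"
  assumes E: "unit_column D E" and unit: "col_sum D E = 1"
begin

lemmas ED = columnD[OF E]

lemma mat_algI: "(\<And>p q. p < D \<Longrightarrow> q < D \<Longrightarrow> star (E p) * x * E q = c p q *\<^sub>C E 0) \<Longrightarrow> x \<in> mat_alg D E"
  unfolding mat_alg_def by blast

lemma mat_algE:
  assumes "x \<in> mat_alg D E"
  obtains c where "\<And>p q. p < D \<Longrightarrow> q < D \<Longrightarrow> star (E p) * x * E q = c p q *\<^sub>C E 0"
proof -
  have "\<forall>p q. \<exists>c. p < D \<longrightarrow> q < D \<longrightarrow> star (E p) * x * E q = c *\<^sub>C E 0"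
    using assms unfolding mat_alg_def by blast
  then show thesis using that by metis
qed

text \<open>The expansion of an element into its matrix entries, obtained from
  \<open>x = 1 * x * 1\<close>.\<close>

lemma sandwich_sum: "x = (\<Sum>p<D. \<Sum>q<D. E p * (star (E p) * x * E q) * star (E q))"
proof -
  have "x = col_sum D E * x * col_sum D E" by (simp add: unit)
  also have "\<dots> = (\<Sum>p<D. \<Sum>q<D. E p * (star (E p) * x * E q) * star (E q))"
    unfolding col_sum_def by (simp add: sum_distrib_left sum_distrib_right mult.assoc) (rule sum.swap)
  finally show ?thesis .
qed

lemma eq_mat_val:
  assumes "\<And>p q. p < D \<Longrightarrow> q < D \<Longrightarrow> star (E p) * x * E q = c p q *\<^sub>C E 0"
  shows "x = mat_val D c E"
  by (subst sandwich_sum, unfold mat_val_def, intro sum.cong refl)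
    (simp add: assms mult_scaleC_left mult_scaleC_right ED(5))

lemma entry_mat_val:
  assumes "p < D" "q < D"
  shows "star (E p) * mat_val D c E * E q = c p q *\<^sub>C E 0"
proof -
  have "star (E p) * mat_val D c E * E q =
      (\<Sum>p'<D. \<Sum>q'<D. c p' q' *\<^sub>C ((star (E p) * E p') * (star (E q') * E q)))"
    by (simp add: mat_val_def sum_distrib_left sum_distrib_right mult_scaleC_left mult_scaleC_right mult.assoc)
  also have "\<dots> = (\<Sum>p'<D. if p = p' then c p' q *\<^sub>C E 0 else 0)"
  proof (intro sum.cong refl)
    fix p' assume p': "p' \<in> {..<D}"
    have "(\<Sum>q'<D. c p' q' *\<^sub>C ((star (E p) * E p') * (star (E q') * E q))) =
       (\<Sum>q'<D. if q' = q then (if p = p' then c p' q *\<^sub>C E 0 else 0) else 0)"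
      using p' assms by (intro sum.cong refl) (auto simp: ED)
    then show "(\<Sum>q'<D. c p' q' *\<^sub>C ((star (E p) * E p') * (star (E q') * E q))) =
       (if p = p' then c p' q *\<^sub>C E 0 else 0)"
      using assms by simp
  qed
  finally show ?thesis using assms by simp
qed

lemma mat_val_in: "mat_val D c E \<in> mat_alg D E"
  using entry_mat_val by (rule mat_algI)

lemma mat_alg_eq_range: "mat_alg D E = range (\<lambda>c. mat_val D c E)"
  using eq_mat_val mat_val_in by (auto elim!: mat_algE)

lemma entry_mult:
  "star (E p) * (x * y) * E q = (\<Sum>r<D. (star (E p) * x * E r) * (star (E r) * y * E q))"
proof -
  have "star (E p) * (x * y) * E q = star (E p) * x * col_sum D E * y * E q" by (simp add: unit mult.assoc)
  then show ?thesis unfolding col_sum_def by (simp add: sum_distrib_left sum_distrib_right mult.assoc)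
qed

lemma mat_alg_subalgebra: "cstar_subalgebra (mat_alg D E)"
  unfolding cstar_subalgebra_def
proof (intro conjI ballI allI)
  have "closed {x. star (E p) * x * E q \<in> range (\<lambda>c. c *\<^sub>C E 0)}" for p q
    by (rule closed_vimage[OF closed_range_scaleC, of "\<lambda>x. star (E p) * x * E q", unfolded vimage_def])
      (intro continuous_intros)
  then have "closed (\<Inter>p\<in>{..<D}. \<Inter>q\<in>{..<D}. {x. star (E p) * x * E q \<in> range (\<lambda>c. c *\<^sub>C E 0)})"
    by (intro closed_INT ballI)
  moreover have "mat_alg D E = (\<Inter>p\<in>{..<D}. \<Inter>q\<in>{..<D}. {x. star (E p) * x * E q \<in> range (\<lambda>c. c *\<^sub>C E 0)})"
    unfolding mat_alg_def by (auto simp: image_iff)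
  ultimately show "closed (mat_alg D E)" by simp
  show "0 \<in> mat_alg D E" by (rule mat_algI[of _ "\<lambda>_ _. 0"]) simp
  fix x assume "x \<in> mat_alg D E"
  then obtain a where a: "\<And>p q. p < D \<Longrightarrow> q < D \<Longrightarrow> star (E p) * x * E q = a p q *\<^sub>C E 0" by (rule mat_algE) blast
  show "star x \<in> mat_alg D E"
  proof (rule mat_algI)
    fix p q assume "p < D" "q < D"
    have "star (E p) * star x * E q = star (star (E q) * x * E p)" by (simp add: star_mult star_star mult.assoc)
    also have "\<dots> = cnj (a q p) *\<^sub>C E 0" using a[OF \<open>q < D\<close> \<open>p < D\<close>] by (simp add: star_scaleC ED)
    finally show "star (E p) * star x * E q = cnj (a q p) *\<^sub>C E 0" .
  qed
  show "c *\<^sub>C x \<in> mat_alg D E" for c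
    by (rule mat_algI[of _ "\<lambda>p q. c * a p q"]) (simp add: mult_scaleC_left mult_scaleC_right a scaleC_scaleC)
  fix y assume "y \<in> mat_alg D E"
  then obtain b where b: "\<And>p q. p < D \<Longrightarrow> q < D \<Longrightarrow> star (E p) * y * E q = b p q *\<^sub>C E 0" by (rule mat_algE) blast
  show "x + y \<in> mat_alg D E"
    by (rule mat_algI[of _ "\<lambda>p q. a p q + b p q"]) (simp add: distrib_left distrib_right a b scaleC_add_left)
  show "x * y \<in> mat_alg D E"
    by (rule mat_algI[of _ "\<lambda>p q. \<Sum>r<D. a p r * b r q"])
      (simp add: entry_mult a b scaleC_sum_left mult_scaleC_left mult_scaleC_right scaleC_scaleC ED(3) mult.commute)
qed

lemmas sub = cstar_subalgebraD[OF mat_alg_subalgebra] cstar_subalgebra_sum[OF mat_alg_subalgebra]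

lemma E_in: "a < D \<Longrightarrow> E a \<in> mat_alg D E"
  by (rule mat_algI[of _ "\<lambda>p q. if p = a \<and> q = 0 then 1 else 0"]) (use ED in auto)

section \<open>The trace and the equivalence of projections in a matrix algebra\<close>

text \<open>On \<open>mat_alg D E\<close> this is the unnormalized trace times \<open>E 0\<close>.
  Keeping it inside the algebra avoids choosing coefficients.\<close>

definition tr :: "'a \<Rightarrow> 'a" where
  "tr x = (\<Sum>r<D. star (E r) * x * E r)"

lemma tr_add: "tr (x + y) = tr x + tr y"
  by (simp add: tr_def distrib_left distrib_right sum.distrib)

lemma tr_diff: "tr (x - y) = tr x - tr y"
  by (simp add: tr_def left_diff_distrib right_diff_distrib sum_subtractf)

lemma tr_sum: "tr (\<Sum>i\<in>I. f i) = (\<Sum>i\<in>I. tr (f i))"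
proof -
  have "tr 0 = 0" by (simp add: tr_def)
  then show ?thesis by (induction I rule: infinite_finite_induct) (auto simp: tr_add)
qed

lemma tr_commute:
  assumes "x \<in> mat_alg D E" "y \<in> mat_alg D E"
  shows "tr (x * y) = tr (y * x)"
proof -
  obtain a where a: "\<And>p q. p < D \<Longrightarrow> q < D \<Longrightarrow> star (E p) * x * E q = a p q *\<^sub>C E 0"
    using assms(1) by (rule mat_algE) blast
  obtain b where b: "\<And>p q. p < D \<Longrightarrow> q < D \<Longrightarrow> star (E p) * y * E q = b p q *\<^sub>C E 0"
    using assms(2) by (rule mat_algE) blast
  have "tr (x * y) = (\<Sum>p<D. \<Sum>r<D. (star (E p) * x * E r) * (star (E r) * y * E p))"
    by (simp add: tr_def entry_mult)
  also have "\<dots> = (\<Sum>p<D. \<Sum>r<D. (star (E r) * y * E p) * (star (E p) * x * E r))"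
    by (intro sum.cong refl) (simp add: a b mult_scaleC_left mult_scaleC_right scaleC_scaleC mult.commute)
  also have "\<dots> = tr (y * x)" by (subst sum.swap) (simp add: tr_def entry_mult)
  finally show ?thesis .
qed

lemma tr_unit: "tr (E 0) = E 0"
proof -
  have "tr (E 0) = (\<Sum>r<D. if r = 0 then E 0 else 0)"
    unfolding tr_def by (intro sum.cong refl) (use ED in auto)
  then show ?thesis using ED(1) by simp
qed

text \<open>Each diagonal unit \<open>v a * star (v a)\<close> has the trace of
  \<open>star (v a) * v a = v 0\<close>, and the \<open>d\<close> diagonal units add up to 1. So the
  initial projections of any two unital columns of the same length have equal trace.\<close>

lemma tr_unital_column:
  assumes v: "unit_column d v" "\<And>a. a < d \<Longrightarrow> v a \<in> mat_alg D E" "col_sum d v = 1"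
  shows "tr (v 0) = (1 / real d) *\<^sub>R tr 1"
proof -
  have "tr 1 = (\<Sum>a<d. tr (v a * star (v a)))" by (simp add: tr_sum flip: v(3)) (simp add: col_sum_def tr_sum)
  also have "\<dots> = (\<Sum>a<d. tr (v 0))"
    using v by (intro sum.cong refl) (subst tr_commute, auto simp: sub columnD)
  finally show ?thesis using columnD(1)[OF v(1)] by (simp add: sum_constant_scaleR)
qed

text \<open>The scalar is the squared Euclidean length of column \<open>r\<close> of the matrix of
  \<open>z\<close>.\<close>

lemma diagonal_entry:
  assumes "z \<in> mat_alg D E" "r < D"
  obtains c where "0 \<le> c" "star (z * E r) * (z * E r) = c *\<^sub>R E 0"
proof -
  obtain a where a: "\<And>p q. p < D \<Longrightarrow> q < D \<Longrightarrow> star (E p) * z * E q = a p q *\<^sub>C E 0"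
    using assms(1) by (rule mat_algE) blast
  have "star (z * E r) * (z * E r) = star (E r) * (star z * z) * E r"
    by (simp add: star_mult mult.assoc)
  also have "\<dots> = (\<Sum>s<D. star (star (E s) * z * E r) * (star (E s) * z * E r))"
    unfolding entry_mult by (simp add: star_mult star_star mult.assoc)
  also have "\<dots> = (\<Sum>s<D. (cmod (a s r))\<^sup>2 *\<^sub>R E 0)"
    using assms(2) by (intro sum.cong refl)
      (simp add: a star_scaleC mult_scaleC_left mult_scaleC_right scaleC_scaleC ED(2,3)
        complex_norm_square[symmetric] mult.commute flip: scaleC_of_real of_real_power)
  also have "\<dots> = (\<Sum>s<D. (cmod (a s r))\<^sup>2) *\<^sub>R E 0" by (simp add: scaleR_sum_left)
  finally show thesis by (rule that[rotated]) (auto intro: sum_nonneg)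
qed

text \<open>The diagonal entries of a projection \<open>q\<close> are the star-squares of the
  \<open>q * E r\<close>, so \<open>q\<close> annihilates every \<open>E r\<close> and therefore
  their sum 1. This gives faithfulness of the trace on projections.\<close>

lemma projection_eq_0I:
  assumes q: "q \<in> mat_alg D E" "star q = q" "q * q = q" and "\<And>r. r < D \<Longrightarrow> star (E r) * q * E r = 0"
  shows "q = 0"
proof -
  have qE: "q * E r = 0" if "r < D" for r
  proof (rule star_mult_eq_0)
    have "star (q * E r) * (q * E r) = star (E r) * (q * q) * E r"
      by (simp add: star_mult q(2) mult.assoc)
    then show "star (q * E r) * (q * E r) = 0" using assms(4)[OF that] q by simp
  qed
  have "q = q * col_sum D E" by (simp add: unit)
  also have "\<dots> = (\<Sum>r<D. (q * E r) * star (E r))" by (simp add: col_sum_def sum_distrib_left mult.assoc)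
  also have "\<dots> = 0" by (simp add: qE)
  finally show ?thesis .
qed

lemma tr_projection:
  assumes q: "q \<in> mat_alg D E" "star q = q" "q * q = q"
  obtains t where "0 \<le> t" "tr q = t *\<^sub>R E 0" "t = 0 \<Longrightarrow> q = 0"
proof -
  have "\<exists>c\<ge>0. star (E r) * q * E r = c *\<^sub>R E 0" if "r < D" for r
  proof -
    have "star (E r) * q * E r = star (q * E r) * (q * E r)"
    proof -
      have "star (q * E r) * (q * E r) = star (E r) * (q * q) * E r"
        by (simp add: star_mult q(2) mult.assoc)
      then show ?thesis by (simp add: q(3))
    qed
    then show ?thesis using diagonal_entry[OF q(1) that] by metis
  qed
  then obtain c where c: "\<And>r. r < D \<Longrightarrow> 0 \<le> c r" "\<And>r. r < D \<Longrightarrow> star (E r) * q * E r = c r *\<^sub>R E 0"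
    by metis
  show thesis
  proof
    show "0 \<le> (\<Sum>r<D. c r)" using c(1) by (intro sum_nonneg) auto
    show "tr q = (\<Sum>r<D. c r) *\<^sub>R E 0" by (simp add: tr_def c(2) scaleR_sum_left)
    assume "(\<Sum>r<D. c r) = 0"
    then have "c r = 0" if "r < D" for r using that c(1) by (subst (asm) sum_nonneg_eq_0_iff) auto
    then show "q = 0" using c(2) by (intro projection_eq_0I[OF q]) auto
  qed
qed

lemma E0_neq_0: "1 \<noteq> (0::'a) \<Longrightarrow> E 0 \<noteq> 0"
proof
  assume "1 \<noteq> (0::'a)" "E 0 = 0"
  then have "E a = 0" if "a < D" for a using ED(5)[OF that] by simp
  then have "col_sum D E = 0" by (simp add: col_sum_def)
  with unit \<open>1 \<noteq> 0\<close> show False by simp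
qed

text \<open>Some \<open>q * E r\<close> is nonzero, and its star-square is a positive multiple of
  \<open>E 0\<close>; after normalization it is a partial isometry from \<open>E 0\<close> onto a
  rank-one projection below \<open>q\<close>.\<close>

lemma minimal_subprojection:
  assumes q: "q \<in> mat_alg D E" "star q = q" "q * q = q" and "q \<noteq> 0"
  obtains w where "w \<in> mat_alg D E" "star w * w = E 0" "q * w = w"
proof -
  obtain r where r: "r < D" "star (E r) * q * E r \<noteq> 0" using projection_eq_0I[OF q] \<open>q \<noteq> 0\<close> by blast
  have eq: "star (q * E r) * (q * E r) = star (E r) * q * E r"
  proof -
    have "star (q * E r) * (q * E r) = star (E r) * (q * q) * E r"
      by (simp add: star_mult q(2) mult.assoc)
    then show ?thesis by (simp add: q(3))
  qed
  obtain c where c: "0 \<le> c" "star (q * E r) * (q * E r) = c *\<^sub>R E 0"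
    using diagonal_entry[OF q(1) r(1)] .
  with r(2) eq have "0 < c" by (cases "c = 0") auto
  show thesis
  proof
    show "(1 / sqrt c) *\<^sub>R (q * E r) \<in> mat_alg D E" using q r by (auto intro: sub E_in)
    show "star ((1 / sqrt c) *\<^sub>R (q * E r)) * ((1 / sqrt c) *\<^sub>R (q * E r)) = E 0"
      using c(2) \<open>0 < c\<close> by (simp add: star_scaleR)
    show "q * ((1 / sqrt c) *\<^sub>R (q * E r)) = (1 / sqrt c) *\<^sub>R (q * E r)"
      using q(3) by (simp flip: mult.assoc)
  qed
qed

text \<open>Removes the rank-one projection \<open>w * star w\<close> from \<open>q\<close>; the
  trace drops by exactly one \<open>E 0\<close>.\<close>

lemma subtract_minimal:
  assumes q: "q \<in> mat_alg D E" "star q = q" "q * q = q"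
    and w: "w \<in> mat_alg D E" "star w * w = E 0" "q * w = w"
  defines "q' \<equiv> q - w * star w"
  shows "q' \<in> mat_alg D E" "star q' = q'" "q' * q' = q'" "tr q' = tr q - E 0" "q' * w = 0" "w * E 0 = w"
proof -
  have wq: "star w * q = star w" using w(3) q(2) by (metis star_mult)
  show wE: "w * E 0 = w"
  proof -
    have "star (w * E 0 - w) * (w * E 0 - w) = 
      E 0 * (star w * w) * E 0 - E 0 * (star w * w) - (star w * w) * E 0 + star w * w"
      by (simp add: star_diff star_mult ED(2) algebra_simps)
    also have "\<dots> = 0" by (simp add: w(2) ED(3))
    finally show ?thesis using star_mult_eq_0 by fastforce
  qed
  show "q' \<in> mat_alg D E" unfolding q'_def using q w by (auto intro: sub)
  show "star q' = q'" by (simp add: q'_def star_diff star_mult star_star q)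
  show q'w: "q' * w = 0" by (simp add: q'_def left_diff_distrib mult.assoc w wE)
  have "q' * q' = q' * q - (q' * w) * star w" by (subst (2) q'_def) (simp add: right_diff_distrib mult.assoc)
  also have "\<dots> = q'" by (simp add: q'w) (simp add: q'_def left_diff_distrib q mult.assoc wq)
  finally show "q' * q' = q'" .
  show "tr q' = tr q - E 0"
    using tr_commute[OF w(1) sub(5)[OF w(1)]] by (simp add: q'_def tr_diff w(2) tr_unit)
qed

text \<open>Murray-von Neumann equivalence by peeling off rank-one subprojections on both sides and
  matching them through \<open>E 0\<close>. The induction is on a natural number above the common
  real trace \<open>t\<close>, which falls by 1 in each round.\<close>

lemma equivalent_projections:
  assumes "1 \<noteq> (0::'a)"
    and "p \<in> mat_alg D E" "star p = p" "p * p = p" "q \<in> mat_alg D E" "star q = q" "q * q = q"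
    and "tr p = tr q"
  shows "\<exists>s\<in>mat_alg D E. star s * s = q \<and> s * star s = p"
proof -
  have "\<exists>s\<in>mat_alg D E. star s * s = q \<and> s * star s = p"
    if "p \<in> mat_alg D E" "star p = p" "p * p = p" "q \<in> mat_alg D E" "star q = q" "q * q = q"
      "tr p = t *\<^sub>R E 0" "tr q = t *\<^sub>R E 0" "t < real n" for n p q t
    using that
  proof (induction n arbitrary: p q t)
    \<comment> \<open>Here \<open>t\<close> is negative, while the trace of a projection is a
      nonnegative multiple of the nonzero element \<open>E 0\<close>.\<close>
    case 0
    obtain t' where "0 \<le> t'" "tr p = t' *\<^sub>R E 0" using tr_projection[OF 0(1-3)] by metis
    then have "t' = t" using 0(7) E0_neq_0[OF assms(1)] by simp
    then show ?case using 0 \<open>0 \<le> t'\<close> by simp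
  next
    case (Suc n)
    obtain t1 where t1: "tr p = t1 *\<^sub>R E 0" "t1 = 0 \<Longrightarrow> p = 0" using tr_projection[OF Suc(2-4)] by metis
    obtain t2 where t2: "tr q = t2 *\<^sub>R E 0" "t2 = 0 \<Longrightarrow> q = 0" using tr_projection[OF Suc(5-7)] by metis
    have t: "t1 = t" "t2 = t" using t1 t2 Suc(8,9) E0_neq_0[OF assms(1)] by auto
    show ?case
    proof (cases "t = 0")
      case True
      then show ?thesis using t t1 t2 by (intro bexI[of _ 0]) (auto simp: sub)
    next
      case False
      then have "p \<noteq> 0" "q \<noteq> 0" using t1(1) t2(1) t E0_neq_0[OF assms(1)] by (auto simp: tr_def)
      obtain w where w: "w \<in> mat_alg D E" "star w * w = E 0" "p * w = w"
        using minimal_subprojection[OF Suc(2-4) \<open>p \<noteq> 0\<close>] .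
      obtain y where y: "y \<in> mat_alg D E" "star y * y = E 0" "q * y = y"
        using minimal_subprojection[OF Suc(5-7) \<open>q \<noteq> 0\<close>] .
      note p' = subtract_minimal[OF Suc(2-4) w] and q' = subtract_minimal[OF Suc(5-7) y]
      have tt: "t *\<^sub>R E 0 - E 0 = (t - 1) *\<^sub>R E 0" by (simp add: scaleR_left_diff_distrib)
      obtain s where s: "s \<in> mat_alg D E" "star s * s = q - y * star y" "s * star s = p - w * star w"
        using Suc.IH[OF p'(1-3) q'(1-3), of "t - 1"] p'(4) q'(4) Suc(8-10) tt by auto
      \<comment> \<open>The range projection of \<open>s\<close> is \<open>p - w * star w\<close>,
        which is orthogonal to \<open>w\<close>; likewise its initial projection is orthogonal to
        \<open>y\<close>. Hence the cross terms of \<open>s + w * star y\<close> vanish.\<close>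
      have sw: "star s * w = 0"
      proof (rule star_mult_eq_0)
        have "star (star s * w) * (star s * w) = star w * ((s * star s) * w)"
          by (simp add: star_mult star_star mult.assoc)
        then show "star (star s * w) * (star s * w) = 0" using p'(5) by (simp add: s(3))
      qed
      have ws: "star w * s = 0" using sw by (metis star_mult star_star star_zero)
      have sy: "s * y = 0"
      proof (rule star_mult_eq_0)
        have "star (s * y) * (s * y) = star y * ((star s * s) * y)"
          by (simp add: star_mult star_star mult.assoc)
        then show "star (s * y) * (s * y) = 0" using q'(5) by (simp add: s(2))
      qed
      have ys: "star y * star s = 0" using sy by (metis star_mult star_zero)
      have yE: "E 0 * star y = star y" "E 0 * star w = star w"
        using q'(6) p'(6) by (metis star_mult ED(2))+
      show ?thesis
      proof (intro bexI[of _ "s + w * star y"] conjI)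
        have "star (s + w * star y) * (s + w * star y) =
            star s * s + (star s * w) * star y + y * (star w * s) + y * ((star w * w) * star y)"
          by (simp add: star_add star_mult star_star algebra_simps)
        then show "star (s + w * star y) * (s + w * star y) = q"
          by (simp add: sw ws w(2) yE s(2))
        have "(s + w * star y) * star (s + w * star y) =
            s * star s + (s * y) * star w + w * (star y * star s) + w * ((star y * y) * star w)"
          by (simp add: star_add star_mult star_star algebra_simps)
        then show "(s + w * star y) * star (s + w * star y) = p"
          by (simp add: sy ys y(2) yE s(3))
        show "s + w * star y \<in> mat_alg D E" using s w y by (auto intro: sub)
      qed
    qed
  qed
  moreover obtain t where "tr p = t *\<^sub>R E 0" using tr_projection[OF assms(2-4)] by metis
  moreover obtain n where "t < real n" using reals_Archimedean2 by blast
  ultimately show ?thesis using assms by metis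
qed

text \<open>By equality of traces some \<open>s\<close> carries \<open>w 0\<close> to
  \<open>v 0\<close>. The unitary transports it to all diagonal positions: \<open>u\<close> is the
  sum of the \<open>v a * s * star (w a)\<close>, and it maps the range of each diagonal unit of
  \<open>w\<close> onto that of \<open>v\<close>.\<close>

lemma unital_columns_conjugate:
  assumes "1 \<noteq> (0::'a)"
    and v: "unit_column d v" "\<And>a. a < d \<Longrightarrow> v a \<in> mat_alg D E" "col_sum d v = 1"
    and w: "unit_column d w" "\<And>a. a < d \<Longrightarrow> w a \<in> mat_alg D E" "col_sum d w = 1"
  obtains u where "star u * u = 1" "u * star u = 1" "\<And>a. a < d \<Longrightarrow> u * w a * star u = v a"
proof -
  note vD = columnD[OF v(1)] and wD = columnD[OF w(1)]
  have "tr (v 0) = tr (w 0)" using tr_unital_column[OF v] tr_unital_column[OF w] by simp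
  then obtain s where s: "star s * s = w 0" "s * star s = v 0"
    using equivalent_projections[OF assms(1) v(2) vD(2,3) w(2) wD(2,3)] vD(1) by blast
  have sw: "s * w 0 = s"
  proof -
    have "star (s * w 0 - s) * (s * w 0 - s) =
      w 0 * (star s * s) * w 0 - w 0 * (star s * s) - (star s * s) * w 0 + star s * s"
      by (simp add: star_diff star_mult wD(2) algebra_simps)
    also have "\<dots> = 0" by (simp add: s wD(3))
    finally show ?thesis using star_mult_eq_0 by fastforce
  qed
  have vs: "v 0 * s = s" using sw s by (metis mult.assoc)
  define u where "u = (\<Sum>a<d. v a * s * star (w a))"
  have su: "star u = (\<Sum>a<d. w a * star s * star (v a))"
    by (simp add: u_def star_sum star_mult star_star mult.assoc)
  have uw: "u * w b = v b * s" if "b < d" for b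
  proof -
    have "u * w b = (\<Sum>a<d. v a * s * (star (w a) * w b))" by (simp add: u_def sum_distrib_right mult.assoc)
    also have "\<dots> = (\<Sum>a<d. if a = b then v b * (s * w 0) else 0)"
      using that by (intro sum.cong refl) (auto simp: wD mult.assoc)
    finally show ?thesis using that sw by simp
  qed
  have uv: "star u * v b = w b * star s" if "b < d" for b
  proof -
    have "star s * v 0 = star s" using vs vD(2) by (metis star_mult)
    have "star u * v b = (\<Sum>a<d. w a * star s * (star (v a) * v b))" by (simp add: su sum_distrib_right mult.assoc)
    also have "\<dots> = (\<Sum>a<d. if a = b then w b * (star s * v 0) else 0)"
      using that by (intro sum.cong refl) (auto simp: vD mult.assoc)
    finally show ?thesis using that \<open>star s * v 0 = star s\<close> by simp
  qed
  have "u * star u = (\<Sum>b<d. (u * w b) * star s * star (v b))"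
    by (subst su) (simp add: sum_distrib_left mult.assoc)
  also have "\<dots> = (\<Sum>b<d. v b * (s * star s) * star (v b))" by (simp add: uw mult.assoc)
  also have "\<dots> = col_sum d v" by (simp add: col_sum_def s vD(5))
  finally have 1: "u * star u = 1" using v(3) by simp
  have "star u * u = (\<Sum>b<d. (star u * v b) * s * star (w b))"
    by (subst (2) u_def) (simp add: sum_distrib_left mult.assoc)
  also have "\<dots> = (\<Sum>b<d. w b * (star s * s) * star (w b))" by (simp add: uv mult.assoc)
  also have "\<dots> = col_sum d w" by (simp add: col_sum_def s wD(5))
  finally have 2: "star u * u = 1" using w(3) by simp
  have vu: "v b * u = v b * s" if "b < d" for b
  proof -
    have "v b * u = (\<Sum>a<d. (v b * v a) * (s * star (w a)))" by (simp add: u_def sum_distrib_left mult.assoc)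
    also have "\<dots> = (\<Sum>a<d. if a = 0 then v b * (s * w 0) else 0)"
      using that by (intro sum.cong refl) (auto simp: vD wD(2))
    finally show ?thesis using vD(1) sw by simp
  qed
  have "u * w b * star u = v b" if "b < d" for b
  proof -
    have "u * w b * star u = v b * (u * star u)" using uw[OF that] vu[OF that] by (simp flip: mult.assoc)
    then show ?thesis by (simp add: 1)
  qed
  with 2 1 show thesis by (rule that)
qed

end

subsection \<open>Continuity of formulas\<close>

lemma finite_term_vars [simp]: "finite (term_vars t)"
  by (induction t) auto

lemma finite_free_vars [simp]: "finite (free_vars \<phi>)"
  by (induction \<phi>) auto

lemma term_val_bounded:
  "\<exists>B. \<forall>v :: nat \<Rightarrow> 'a::cstar_algebra. (\<forall>i\<in>term_vars t. norm (v i) \<le> M) \<longrightarrow> norm (term_val v t) \<le> B"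
proof (induction t)
  case TZero
  then show ?case by (intro exI[of _ 0]) simp
next
  case (TVar n)
  then show ?case by (intro exI[of _ M]) simp
next
  case (TAdd s t)
  then obtain B C where B: "\<And>v :: nat \<Rightarrow> 'a. (\<forall>i\<in>term_vars s. norm (v i) \<le> M) \<Longrightarrow> norm (term_val v s) \<le> B"
    and C: "\<And>v :: nat \<Rightarrow> 'a. (\<forall>i\<in>term_vars t. norm (v i) \<le> M) \<Longrightarrow> norm (term_val v t) \<le> C" by blast
  have "norm (term_val v (TAdd s t)) \<le> B + C" if "\<forall>i\<in>term_vars (TAdd s t). norm (v i) \<le> M" for v :: "nat \<Rightarrow> 'a"
    unfolding term_val.simps
    by (rule order.trans[OF norm_triangle_ineq]) (intro add_mono B C, use that in auto)
  then show ?case by blast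
next
  case (TMult s t)
  then obtain B C where B: "\<And>v :: nat \<Rightarrow> 'a. (\<forall>i\<in>term_vars s. norm (v i) \<le> M) \<Longrightarrow> norm (term_val v s) \<le> B"
    and C: "\<And>v :: nat \<Rightarrow> 'a. (\<forall>i\<in>term_vars t. norm (v i) \<le> M) \<Longrightarrow> norm (term_val v t) \<le> C" by blast
  have "norm (term_val v (TMult s t)) \<le> B * C" if "\<forall>i\<in>term_vars (TMult s t). norm (v i) \<le> M" for v :: "nat \<Rightarrow> 'a"
    unfolding term_val.simps by (intro norm_mult_le B C) (use that in auto)
  then show ?case by blast
next
  case (TScale c t)
  then obtain B where B: "\<And>v :: nat \<Rightarrow> 'a. (\<forall>i\<in>term_vars t. norm (v i) \<le> M) \<Longrightarrow> norm (term_val v t) \<le> B" by blast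
  have "norm (term_val v (TScale c t)) \<le> cmod c * B" if "\<forall>i\<in>term_vars (TScale c t). norm (v i) \<le> M" for v :: "nat \<Rightarrow> 'a"
    unfolding term_val.simps norm_scaleC by (intro mult_left_mono B) (use that in auto)
  then show ?case by blast
next
  case (TStar t)
  then show ?case by simp
qed

lemma term_val_uniformly_continuous:
  assumes "0 < \<epsilon>"
  shows "\<exists>\<delta>>0. \<forall>v w :: nat \<Rightarrow> 'a::cstar_algebra. (\<forall>i\<in>term_vars t. norm (v i) \<le> M \<and> norm (w i) \<le> M \<and> norm (v i - w i) < \<delta>)
    \<longrightarrow> norm (term_val v t - term_val w t) < \<epsilon>"
  using assms
proof (induction t arbitrary: \<epsilon>)
  case TZero then show ?case by (auto intro: exI[of _ 1])
next
  case (TVar n) then show ?case by (intro exI[of _ \<epsilon>]) auto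
next
  case (TAdd s t)
  obtain \<delta>1 where \<delta>1: "\<delta>1 > 0" "\<And>v w :: nat \<Rightarrow> 'a. (\<forall>i\<in>term_vars s. norm (v i) \<le> M \<and> norm (w i) \<le> M \<and> norm (v i - w i) < \<delta>1)
    \<Longrightarrow> norm (term_val v s - term_val w s) < \<epsilon>/2" using TAdd(1)[of "\<epsilon>/2"] TAdd(3) by auto
  obtain \<delta>2 where \<delta>2: "\<delta>2 > 0" "\<And>v w :: nat \<Rightarrow> 'a. (\<forall>i\<in>term_vars t. norm (v i) \<le> M \<and> norm (w i) \<le> M \<and> norm (v i - w i) < \<delta>2)
    \<Longrightarrow> norm (term_val v t - term_val w t) < \<epsilon>/2" using TAdd(2)[of "\<epsilon>/2"] TAdd(3) by auto
  show ?case
  proof (intro exI[of _ "min \<delta>1 \<delta>2"] conjI allI impI)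
    fix v w :: "nat \<Rightarrow> 'a"
    assume "\<forall>i\<in>term_vars (TAdd s t). norm (v i) \<le> M \<and> norm (w i) \<le> M \<and> norm (v i - w i) < min \<delta>1 \<delta>2"
    then have "norm (term_val v s - term_val w s) < \<epsilon>/2" "norm (term_val v t - term_val w t) < \<epsilon>/2"
      using \<delta>1(2)[of v w] \<delta>2(2)[of v w] by auto
    then show "norm (term_val v (TAdd s t) - term_val w (TAdd s t)) < \<epsilon>"
      using norm_triangle_ineq[of "term_val v s - term_val w s" "term_val v t - term_val w t"]
      by (simp add: algebra_simps)
  qed (use \<delta>1 \<delta>2 in auto)
next
  case (TMult s t)
  obtain B where B: "\<And>v :: nat \<Rightarrow> 'a. (\<forall>i\<in>term_vars s. norm (v i) \<le> M) \<Longrightarrow> norm (term_val v s) \<le> B"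
    using term_val_bounded by blast
  obtain C where C: "\<And>v :: nat \<Rightarrow> 'a. (\<forall>i\<in>term_vars t. norm (v i) \<le> M) \<Longrightarrow> norm (term_val v t) \<le> C"
    using term_val_bounded by blast
  \<comment> \<open>The summand 1 keeps \<open>L\<close> positive, so that the error can be divided
    by it.\<close>
  define L where "L = \<bar>B\<bar> + \<bar>C\<bar> + 1"
  have L: "L > 0" by (simp add: L_def)
  then have \<epsilon>': "\<epsilon> / (2 * L) > 0" using TMult(3) by simp
  obtain \<delta>1 where \<delta>1: "\<delta>1 > 0" "\<And>v w :: nat \<Rightarrow> 'a. (\<forall>i\<in>term_vars s. norm (v i) \<le> M \<and> norm (w i) \<le> M \<and> norm (v i - w i) < \<delta>1)
    \<Longrightarrow> norm (term_val v s - term_val w s) < \<epsilon> / (2 * L)" using TMult(1)[OF \<epsilon>'] by auto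
  obtain \<delta>2 where \<delta>2: "\<delta>2 > 0" "\<And>v w :: nat \<Rightarrow> 'a. (\<forall>i\<in>term_vars t. norm (v i) \<le> M \<and> norm (w i) \<le> M \<and> norm (v i - w i) < \<delta>2)
    \<Longrightarrow> norm (term_val v t - term_val w t) < \<epsilon> / (2 * L)" using TMult(2)[OF \<epsilon>'] by auto
  show ?case
  proof (intro exI[of _ "min \<delta>1 \<delta>2"] conjI allI impI)
    fix v w :: "nat \<Rightarrow> 'a"
    assume a: "\<forall>i\<in>term_vars (TMult s t). norm (v i) \<le> M \<and> norm (w i) \<le> M \<and> norm (v i - w i) < min \<delta>1 \<delta>2"
    then have d: "norm (term_val v s - term_val w s) < \<epsilon> / (2 * L)" "norm (term_val v t - term_val w t) < \<epsilon> / (2 * L)"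
      using \<delta>1(2)[of v w] \<delta>2(2)[of v w] by auto
    have b: "norm (term_val w s) \<le> L" "norm (term_val v t) < L"
      using B[of w] C[of v] a by (auto simp: L_def)
    have eq: "term_val v (TMult s t) - term_val w (TMult s t) =
      (term_val v s - term_val w s) * term_val v t + term_val w s * (term_val v t - term_val w t)"
      by (simp add: algebra_simps)
    have "norm ((term_val v s - term_val w s) * term_val v t) < \<epsilon> / (2 * L) * L"
      by (rule order.strict_trans1[OF norm_mult_ineq mult_strict_mono'[OF d(1) b(2)]]) auto
    moreover have "norm (term_val w s * (term_val v t - term_val w t)) \<le> L * (\<epsilon> / (2 * L))"
      using b d by (intro norm_mult_le) auto
    ultimately have "norm (term_val v (TMult s t) - term_val w (TMult s t)) < \<epsilon> / (2 * L) * L + L * (\<epsilon> / (2 * L))"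
      unfolding eq using norm_triangle_ineq[of "(term_val v s - term_val w s) * term_val v t" "term_val w s * (term_val v t - term_val w t)"] 
      by linarith
    then show "norm (term_val v (TMult s t) - term_val w (TMult s t)) < \<epsilon>" using L by simp
  qed (use \<delta>1 \<delta>2 in auto)
next
  case (TScale c t)
  have \<epsilon>': "\<epsilon> / (cmod c + 1) > 0" using TScale(2) by (simp add: add_nonneg_pos)
  obtain \<delta> where \<delta>: "\<delta> > 0" "\<And>v w :: nat \<Rightarrow> 'a. (\<forall>i\<in>term_vars t. norm (v i) \<le> M \<and> norm (w i) \<le> M \<and> norm (v i - w i) < \<delta>)
    \<Longrightarrow> norm (term_val v t - term_val w t) < \<epsilon> / (cmod c + 1)" using TScale(1)[OF \<epsilon>'] by auto
  show ?case
  proof (intro exI[of _ \<delta>] conjI allI impI)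
    fix v w :: "nat \<Rightarrow> 'a"
    assume "\<forall>i\<in>term_vars (TScale c t). norm (v i) \<le> M \<and> norm (w i) \<le> M \<and> norm (v i - w i) < \<delta>"
    then have "norm (term_val v t - term_val w t) < \<epsilon> / (cmod c + 1)" using \<delta>(2)[of v w] by auto
    then have "(cmod c + 1) * norm (term_val v t - term_val w t) < \<epsilon>"
      by (simp add: pos_less_divide_eq add_nonneg_pos mult.commute)
    moreover have "cmod c * norm (term_val v t - term_val w t) \<le> (cmod c + 1) * norm (term_val v t - term_val w t)"
      by (intro mult_right_mono) auto
    ultimately show "norm (term_val v (TScale c t) - term_val w (TScale c t)) < \<epsilon>"
      by (simp add: norm_scaleC flip: scaleC_diff_right)
  qed (use \<delta> in auto)
next
  case (TStar t)
  then show ?case by (simp flip: star_diff)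
qed

lemma Rep_connective_nonneg: "0 \<le> s \<Longrightarrow> 0 \<le> t \<Longrightarrow> 0 \<le> Rep_connective f (s, t)"
  using Rep_connective[of f] by (auto simp: image_subset_iff)

lemma continuous_on_Rep_connective: "continuous_on ({0..} \<times> {0..}) (Rep_connective f)"
  using Rep_connective[of f] by auto

lemma zero_ball_nonempty: "0 \<in> S \<Longrightarrow> {x \<in> S. norm (x::'a::real_normed_vector) \<le> real k} \<noteq> {}"
  by (metis (mono_tags) empty_iff mem_Collect_eq norm_zero of_nat_0_le_iff)

text \<open>The bound is uniform over assignments of norm at most \<open>M\<close>: the arguments of
  a connective then stay in a compact rectangle, and the infima and suprema are taken over bounded
  sets of reals. A quantified variable raises \<open>M\<close> to
  \<open>max M (real k)\<close>.\<close>

lemma interp_bounded: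
  fixes S :: "'a::cstar_algebra set"
  assumes S: "0 \<in> S"
  shows "\<exists>B. \<forall>v. (\<forall>i\<in>free_vars \<phi>. norm (v i) \<le> M) \<longrightarrow> 0 \<le> interp S v \<phi> \<and> interp S v \<phi> \<le> B"
proof (induction \<phi> arbitrary: M)
  case (FNorm t)
  show ?case using term_val_bounded[of t M, where 'a='a] by simp
next
  case (FConn f \<phi> \<psi>)
  obtain B where B: "\<And>v. (\<forall>i\<in>free_vars \<phi>. norm (v i) \<le> M) \<Longrightarrow> 0 \<le> interp S v \<phi> \<and> interp S v \<phi> \<le> B"
    using FConn(1) by blast
  obtain C where C: "\<And>v. (\<forall>i\<in>free_vars \<psi>. norm (v i) \<le> M) \<Longrightarrow> 0 \<le> interp S v \<psi> \<and> interp S v \<psi> \<le> C"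
    using FConn(2) by blast
  have "compact (Rep_connective f ` ({0..B} \<times> {0..C}))"
    by (intro compact_continuous_image continuous_on_subset[OF continuous_on_Rep_connective] compact_Times) auto
  then have "bounded (Rep_connective f ` ({0..B} \<times> {0..C}))" by (rule compact_imp_bounded)
  then obtain D where D: "\<And>x. x \<in> {0..B} \<times> {0..C} \<Longrightarrow> norm (Rep_connective f x) \<le> D"
    unfolding bounded_iff by blast
  show ?case
  proof (intro exI[of _ D] allI impI)
    fix v :: "nat \<Rightarrow> 'a" assume "\<forall>i\<in>free_vars (FConn f \<phi> \<psi>). norm (v i) \<le> M"
    then have "0 \<le> interp S v \<phi> \<and> interp S v \<phi> \<le> B" "0 \<le> interp S v \<psi> \<and> interp S v \<psi> \<le> C"
      using B C by auto
    then show "0 \<le> interp S v (FConn f \<phi> \<psi>) \<and> interp S v (FConn f \<phi> \<psi>) \<le> D"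
      using D[of "(interp S v \<phi>, interp S v \<psi>)"] Rep_connective_nonneg[of "interp S v \<phi>" "interp S v \<psi>" f]
      by simp
  qed
next
  case (FInf n k \<phi>)
  obtain B where B: "\<And>v. (\<forall>i\<in>free_vars \<phi>. norm (v i) \<le> max M (real k)) \<Longrightarrow> 0 \<le> interp S v \<phi> \<and> interp S v \<phi> \<le> B"
    using FInf by blast
  show ?case
  proof (intro exI[of _ B] allI impI)
    fix v :: "nat \<Rightarrow> 'a" assume v: "\<forall>i\<in>free_vars (FInf n k \<phi>). norm (v i) \<le> M"
    have b: "0 \<le> interp S (v(n := x)) \<phi> \<and> interp S (v(n := x)) \<phi> \<le> B" if "norm x \<le> real k" for x
      using v that by (intro B) (auto simp: le_max_iff_disj)
    have "0 \<le> interp S v (FInf n k \<phi>)"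
      unfolding interp.simps by (rule cINF_greatest[OF zero_ball_nonempty[OF S]]) (use b in simp)
    moreover have "interp S v (FInf n k \<phi>) \<le> interp S (v(n := 0)) \<phi>"
      unfolding interp.simps
      by (rule cINF_lower[OF bdd_belowI2[of _ 0]]) (use b S in simp_all)
    ultimately show "0 \<le> interp S v (FInf n k \<phi>) \<and> interp S v (FInf n k \<phi>) \<le> B" using b[of 0] by simp
  qed
next
  case (FSup n k \<phi>)
  obtain B where B: "\<And>v. (\<forall>i\<in>free_vars \<phi>. norm (v i) \<le> max M (real k)) \<Longrightarrow> 0 \<le> interp S v \<phi> \<and> interp S v \<phi> \<le> B"
    using FSup by blast
  show ?case
  proof (intro exI[of _ B] allI impI)
    fix v :: "nat \<Rightarrow> 'a" assume v: "\<forall>i\<in>free_vars (FSup n k \<phi>). norm (v i) \<le> M"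
    have b: "0 \<le> interp S (v(n := x)) \<phi> \<and> interp S (v(n := x)) \<phi> \<le> B" if "norm x \<le> real k" for x
      using v that by (intro B) (auto simp: le_max_iff_disj)
    have "interp S v (FSup n k \<phi>) \<le> B"
      unfolding interp.simps by (rule cSUP_least[OF zero_ball_nonempty[OF S]]) (use b in simp)
    moreover have "interp S (v(n := 0)) \<phi> \<le> interp S v (FSup n k \<phi>)"
      unfolding interp.simps
      by (rule cSUP_upper[OF _ bdd_aboveI2[of _ _ B]]) (use b S in simp_all)
    ultimately show "0 \<le> interp S v (FSup n k \<phi>) \<and> interp S v (FSup n k \<phi>) \<le> B" using b[of 0] by simp
  qed
qed

lemma interp_nonneg: "0 \<in> S \<Longrightarrow> 0 \<le> interp S v \<phi>"
proof -
  assume "0 \<in> S"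
  have "norm (v i) \<le> (\<Sum>i\<in>free_vars \<phi>. norm (v i))" if "i \<in> free_vars \<phi>" for i
    using that by (intro member_le_sum) auto
  then show ?thesis using interp_bounded[OF \<open>0 \<in> S\<close>, of \<phi> "\<Sum>i\<in>free_vars \<phi>. norm (v i)"] by blast
qed

lemma interp_update_bounded:
  assumes "0 \<in> S"
  obtains B where "\<And>x :: 'a::cstar_algebra. norm x \<le> k \<Longrightarrow> interp S (v(n := x)) \<phi> \<le> B"
proof -
  define M where "M = max k (\<Sum>i\<in>free_vars \<phi>. norm (v i))"
  have M: "norm (v i) \<le> M" if "i \<in> free_vars \<phi>" for i
    using that by (auto simp: M_def le_max_iff_disj intro: member_le_sum)
  obtain B where B: "\<And>v. (\<forall>i\<in>free_vars \<phi>. norm (v i) \<le> M) \<Longrightarrow> 0 \<le> interp S v \<phi> \<and> interp S v \<phi> \<le> B"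
    using interp_bounded[OF assms] by metis
  show thesis
  proof (rule that)
    fix x :: 'a assume "norm x \<le> k"
    then have "norm x \<le> M" by (simp add: M_def)
    then show "interp S (v(n := x)) \<phi> \<le> B" using B[of "v(n := x)"] M by simp
  qed
qed

lemma abs_INF_diff_le:
  fixes f g :: "'a \<Rightarrow> real"
  assumes "X \<noteq> {}" "bdd_below (f ` X)" "bdd_below (g ` X)" "\<And>x. x \<in> X \<Longrightarrow> \<bar>f x - g x\<bar> \<le> \<epsilon>"
  shows "\<bar>(INF x\<in>X. f x) - (INF x\<in>X. g x)\<bar> \<le> \<epsilon>"
proof -
  have "(INF x\<in>X. f x) - \<epsilon> \<le> (INF x\<in>X. g x)"
  proof (rule cINF_greatest[OF assms(1)])
    fix x assume "x \<in> X"
    then show "(INF x\<in>X. f x) - \<epsilon> \<le> g x" using cINF_lower[OF assms(2)] assms(4) by fastforce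
  qed
  moreover have "(INF x\<in>X. g x) - \<epsilon> \<le> (INF x\<in>X. f x)"
  proof (rule cINF_greatest[OF assms(1)])
    fix x assume "x \<in> X"
    then show "(INF x\<in>X. g x) - \<epsilon> \<le> f x" using cINF_lower[OF assms(3)] assms(4) by fastforce
  qed
  ultimately show ?thesis by linarith
qed

lemma abs_SUP_diff_le:
  fixes f g :: "'a \<Rightarrow> real"
  assumes "X \<noteq> {}" "bdd_above (f ` X)" "bdd_above (g ` X)" "\<And>x. x \<in> X \<Longrightarrow> \<bar>f x - g x\<bar> \<le> \<epsilon>"
  shows "\<bar>(SUP x\<in>X. f x) - (SUP x\<in>X. g x)\<bar> \<le> \<epsilon>"
proof -
  have "(SUP x\<in>X. f x) \<le> (SUP x\<in>X. g x) + \<epsilon>"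
  proof (rule cSUP_least[OF assms(1)])
    fix x assume "x \<in> X"
    then show "f x \<le> (SUP x\<in>X. g x) + \<epsilon>" using cSUP_upper[OF _ assms(3)] assms(4) by fastforce
  qed
  moreover have "(SUP x\<in>X. g x) \<le> (SUP x\<in>X. f x) + \<epsilon>"
  proof (rule cSUP_least[OF assms(1)])
    fix x assume "x \<in> X"
    then show "g x \<le> (SUP x\<in>X. f x) + \<epsilon>" using cSUP_upper[OF _ assms(2)] assms(4) by fastforce
  qed
  ultimately show ?thesis by linarith
qed

text \<open>On bounded assignments a connective is evaluated on a compact rectangle, where it is
  uniformly continuous. A quantifier preserves the modulus, because changing a function uniformly by
  \<open>\<epsilon>\<close> changes its infimum and supremum by at most
  \<open>\<epsilon>\<close>.\<close>

lemma interp_uniformly_continuous: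
  fixes S :: "'a::cstar_algebra set"
  assumes S: "0 \<in> S" and "0 < \<epsilon>"
  shows "\<exists>\<delta>>0. \<forall>v w. (\<forall>i\<in>free_vars \<phi>. norm (v i) \<le> M \<and> norm (w i) \<le> M \<and> norm (v i - w i) < \<delta>)
    \<longrightarrow> \<bar>interp S v \<phi> - interp S w \<phi>\<bar> \<le> \<epsilon>"
  using assms(2)
proof (induction \<phi> arbitrary: \<epsilon> M)
  case (FNorm t)
  obtain \<delta> where \<delta>: "\<delta> > 0" "\<And>v w :: nat \<Rightarrow> 'a. (\<forall>i\<in>term_vars t. norm (v i) \<le> M \<and> norm (w i) \<le> M \<and> norm (v i - w i) < \<delta>)
    \<Longrightarrow> norm (term_val v t - term_val w t) < \<epsilon>" using term_val_uniformly_continuous[OF FNorm, of t M] by auto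
  then show ?case
    by (intro exI[of _ \<delta>]) (fastforce intro: order.trans[OF norm_triangle_ineq3] less_imp_le)
next
  case (FConn f \<phi> \<psi>)
  obtain B where B: "\<And>v. (\<forall>i\<in>free_vars \<phi>. norm (v i) \<le> M) \<Longrightarrow> 0 \<le> interp S v \<phi> \<and> interp S v \<phi> \<le> B"
    using interp_bounded[OF S] by metis
  obtain C where C: "\<And>v. (\<forall>i\<in>free_vars \<psi>. norm (v i) \<le> M) \<Longrightarrow> 0 \<le> interp S v \<psi> \<and> interp S v \<psi> \<le> C"
    using interp_bounded[OF S] by metis
  have "uniformly_continuous_on ({0..B} \<times> {0..C}) (Rep_connective f)"
    by (intro compact_uniformly_continuous continuous_on_subset[OF continuous_on_Rep_connective] compact_Times) auto
  then obtain d where d: "d > 0" "\<And>x y. x \<in> {0..B} \<times> {0..C} \<Longrightarrow> y \<in> {0..B} \<times> {0..C} \<Longrightarrow> dist y x < d \<Longrightarrow>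
      dist (Rep_connective f y) (Rep_connective f x) < \<epsilon>"
    using FConn(3) unfolding uniformly_continuous_on_def by metis
  have "d / 3 > 0" using d by simp
  obtain \<delta>1 where \<delta>1: "\<delta>1 > 0" "\<And>v w. (\<forall>i\<in>free_vars \<phi>. norm (v i) \<le> M \<and> norm (w i) \<le> M \<and> norm (v i - w i) < \<delta>1)
    \<Longrightarrow> \<bar>interp S v \<phi> - interp S w \<phi>\<bar> \<le> d/3" using FConn(1)[OF \<open>d/3 > 0\<close>] by metis
  obtain \<delta>2 where \<delta>2: "\<delta>2 > 0" "\<And>v w. (\<forall>i\<in>free_vars \<psi>. norm (v i) \<le> M \<and> norm (w i) \<le> M \<and> norm (v i - w i) < \<delta>2)
    \<Longrightarrow> \<bar>interp S v \<psi> - interp S w \<psi>\<bar> \<le> d/3" using FConn(2)[OF \<open>d/3 > 0\<close>] by metis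
  show ?case
  proof (intro exI[of _ "min \<delta>1 \<delta>2"] conjI allI impI)
    fix v w :: "nat \<Rightarrow> 'a"
    assume a: "\<forall>i\<in>free_vars (FConn f \<phi> \<psi>). norm (v i) \<le> M \<and> norm (w i) \<le> M \<and> norm (v i - w i) < min \<delta>1 \<delta>2"
    have "dist (interp S v \<phi>, interp S v \<psi>) (interp S w \<phi>, interp S w \<psi>)
        \<le> \<bar>interp S v \<phi> - interp S w \<phi>\<bar> + \<bar>interp S v \<psi> - interp S w \<psi>\<bar>"
      unfolding dist_Pair_Pair dist_real_def by (rule order.trans[OF sqrt_sum_squares_le_sum_abs]) simp
    also have "\<dots> \<le> d/3 + d/3" using a by (intro add_mono \<delta>1 \<delta>2) auto
    also have "\<dots> < d" using d by simp
    finally have "dist (Rep_connective f (interp S v \<phi>, interp S v \<psi>)) (Rep_connective f (interp S w \<phi>, interp S w \<psi>)) < \<epsilon>"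
      using B[of v] B[of w] C[of v] C[of w] a by (intro d) auto
    then show "\<bar>interp S v (FConn f \<phi> \<psi>) - interp S w (FConn f \<phi> \<psi>)\<bar> \<le> \<epsilon>" by (simp add: dist_real_def)
  qed (use \<delta>1 \<delta>2 in auto)
next
  case (FInf n k \<phi>)
  obtain \<delta> where \<delta>: "\<delta> > 0" "\<And>v w. (\<forall>i\<in>free_vars \<phi>. norm (v i) \<le> max M (real k) \<and> norm (w i) \<le> max M (real k) \<and> norm (v i - w i) < \<delta>)
    \<Longrightarrow> \<bar>interp S v \<phi> - interp S w \<phi>\<bar> \<le> \<epsilon>" using FInf(1)[OF FInf(2)] by metis
  have "\<bar>interp S v (FInf n k \<phi>) - interp S w (FInf n k \<phi>)\<bar> \<le> \<epsilon>"
    if "\<forall>i\<in>free_vars (FInf n k \<phi>). norm (v i) \<le> M \<and> norm (w i) \<le> M \<and> norm (v i - w i) < \<delta>" for v w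
    unfolding interp.simps
  proof (rule abs_INF_diff_le)
    show "{x \<in> S. norm x \<le> real k} \<noteq> {}" by (rule zero_ball_nonempty[OF S])
    show "\<bar>interp S (v(n := x)) \<phi> - interp S (w(n := x)) \<phi>\<bar> \<le> \<epsilon>" if "x \<in> {x \<in> S. norm x \<le> real k}" for x
      using that \<open>\<forall>i\<in>_. _\<close> \<delta>(1) by (intro \<delta>(2)) (auto simp: le_max_iff_disj)
  qed (rule bdd_belowI2[of _ 0], rule interp_nonneg[OF S])+
  then show ?case using \<delta>(1) by blast
next
  case (FSup n k \<phi>)
  obtain \<delta> where \<delta>: "\<delta> > 0" "\<And>v w. (\<forall>i\<in>free_vars \<phi>. norm (v i) \<le> max M (real k) \<and> norm (w i) \<le> max M (real k) \<and> norm (v i - w i) < \<delta>)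
    \<Longrightarrow> \<bar>interp S v \<phi> - interp S w \<phi>\<bar> \<le> \<epsilon>" using FSup(1)[OF FSup(2)] by metis
  have bdd: "bdd_above ((\<lambda>x. interp S (v(n := x)) \<phi>) ` {x \<in> S. norm x \<le> real k})" for v
  proof -
    obtain B where "\<And>x. norm x \<le> real k \<Longrightarrow> interp S (v(n := x)) \<phi> \<le> B" using interp_update_bounded[OF S] by metis
    then show ?thesis by (intro bdd_aboveI2[of _ _ B]) simp
  qed
  have "\<bar>interp S v (FSup n k \<phi>) - interp S w (FSup n k \<phi>)\<bar> \<le> \<epsilon>"
    if "\<forall>i\<in>free_vars (FSup n k \<phi>). norm (v i) \<le> M \<and> norm (w i) \<le> M \<and> norm (v i - w i) < \<delta>" for v w
    unfolding interp.simps
  proof (rule abs_SUP_diff_le)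
    show "{x \<in> S. norm x \<le> real k} \<noteq> {}" by (rule zero_ball_nonempty[OF S])
    show "\<bar>interp S (v(n := x)) \<phi> - interp S (w(n := x)) \<phi>\<bar> \<le> \<epsilon>" if "x \<in> {x \<in> S. norm x \<le> real k}" for x
      using that \<open>\<forall>i\<in>_. _\<close> \<delta>(1) by (intro \<delta>(2)) (auto simp: le_max_iff_disj)
  qed (rule bdd)+
  then show ?case using \<delta>(1) by blast
qed

text \<open>Only finitely many variables are free and convergent sequences are bounded, so
  convergence in each free variable brings the assignments within the uniform modulus.\<close>

lemma tendsto_interp:
  fixes v :: "nat \<Rightarrow> nat \<Rightarrow> 'a::cstar_algebra"
  assumes S: "0 \<in> S" and v: "\<And>i. i \<in> free_vars \<phi> \<Longrightarrow> (\<lambda>m. v m i) \<longlonglongrightarrow> w i"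
  shows "(\<lambda>m. interp S (v m) \<phi>) \<longlonglongrightarrow> interp S w \<phi>"
proof -
  have M: "\<exists>M. \<forall>m. norm (v m i) \<le> M" if "i \<in> free_vars \<phi>" for i
    using convergent_imp_Bseq[of "\<lambda>m. v m i"] v[OF that] by (auto simp: convergent_def Bseq_def)
  then obtain M where M: "\<And>i m. i \<in> free_vars \<phi> \<Longrightarrow> norm (v m i) \<le> M i" by metis
  define K where "K = (\<Sum>i\<in>free_vars \<phi>. \<bar>M i\<bar> + norm (w i))"
  have K: "\<bar>M i\<bar> + norm (w i) \<le> K" if "i \<in> free_vars \<phi>" for i
    unfolding K_def using that by (intro member_le_sum[where f = "\<lambda>i. \<bar>M i\<bar> + norm (w i)"]) auto
  have KK: "norm (w i) \<le> K" "norm (v m i) \<le> K" if "i \<in> free_vars \<phi>" for i m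
    using K[OF that] M[OF that, of m] norm_ge_zero[of "w i"] by linarith+
  show ?thesis
  proof (rule LIMSEQ_I)
    fix r :: real assume "0 < r"
    then obtain \<delta> where \<delta>: "\<delta> > 0" "\<And>v w. (\<forall>i\<in>free_vars \<phi>. norm (v i) \<le> K \<and> norm (w i) \<le> K \<and> norm (v i - w i) < \<delta>)
      \<Longrightarrow> \<bar>interp S v \<phi> - interp S w \<phi>\<bar> \<le> r/2"
      using interp_uniformly_continuous[OF S, of "r/2" \<phi> K] by auto
    have "eventually (\<lambda>m. \<forall>i\<in>free_vars \<phi>. norm (v m i - w i) < \<delta>) sequentially"
      using v \<delta>(1) by (intro eventually_ball_finite ballI) (auto simp: tendsto_iff dist_norm)
    then have "eventually (\<lambda>m. norm (interp S (v m) \<phi> - interp S w \<phi>) < r) sequentially"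
    proof eventually_elim
      case (elim m)
      then have "\<bar>interp S (v m) \<phi> - interp S w \<phi>\<bar> \<le> r/2" using KK by (intro \<delta>(2)) auto
      then show ?case using \<open>0 < r\<close> by simp
    qed
    then show "\<exists>no. \<forall>n\<ge>no. norm (interp S (v n) \<phi> - interp S w \<phi>) < r"
      by (simp add: eventually_sequentially)
  qed
qed

lemma interp_cong_free_vars:
  "(\<And>i. i \<in> free_vars \<phi> \<Longrightarrow> v i = w i) \<Longrightarrow> interp S v \<phi> = interp S w \<phi>"
proof (induction \<phi> arbitrary: v w)
  case (FNorm t)
  have "term_val v t = term_val w t" if "\<And>i. i \<in> term_vars t \<Longrightarrow> v i = w i" using that by (induction t) auto
  then show ?case using FNorm by simp
next
  case (FConn f \<phi> \<psi>)
  have "interp S v \<phi> = interp S w \<phi>" by (rule FConn(1)) (use FConn(3) in auto)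
  moreover have "interp S v \<psi> = interp S w \<psi>" by (rule FConn(2)) (use FConn(3) in auto)
  ultimately show ?case by simp
next
  case (FInf n k \<phi>)
  have "interp S (v(n := x)) \<phi> = interp S (w(n := x)) \<phi>" for x
    by (rule FInf(1)) (use FInf(2) in auto)
  then show ?case by simp
next
  case (FSup n k \<phi>)
  have "interp S (v(n := x)) \<phi> = interp S (w(n := x)) \<phi>" for x
    by (rule FSup(1)) (use FSup(2) in auto)
  then show ?case by simp
qed

text \<open>Isometry and surjectivity make the balls of the quantifiers correspond. It is applied to
  unitary conjugations and to the final embedding, viewed as a map onto its range.\<close>

lemma interp_star_iso:
  assumes S: "cstar_subalgebra S" and hom: "star_hom S S' \<Phi>" and surj: "\<Phi> ` S = S'"
    and iso: "\<And>x. x \<in> S \<Longrightarrow> norm (\<Phi> x) = norm x"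
  shows "range v \<subseteq> S \<Longrightarrow> interp S' (\<Phi> \<circ> v) \<phi> = interp S v \<phi>"
proof (induction \<phi> arbitrary: v)
  case (FNorm t)
  have "\<Phi> 0 = 0" using iso[OF cstar_subalgebraD(2)[OF S]] by simp
  then have "term_val v t \<in> S \<and> term_val (\<Phi> \<circ> v) t = \<Phi> (term_val v t)"
    using FNorm hom by (induction t) (auto simp: cstar_subalgebraD[OF S] star_hom_def image_subset_iff)
  then show ?case unfolding interp.simps using iso by metis
next
  case (FInf n k \<phi>)
  have "{x \<in> S'. norm x \<le> real k} = \<Phi> ` {x \<in> S. norm x \<le> real k}" using iso by (auto simp flip: surj)
  moreover have "interp S' ((\<Phi> \<circ> v)(n := \<Phi> x)) \<phi> = interp S (v(n := x)) \<phi>" if "x \<in> S" for x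
    unfolding fun_upd_comp[symmetric] using FInf that by (intro FInf(1)) auto
  ultimately show ?case by (simp add: image_image comp_def)
next
  case (FSup n k \<phi>)
  have "{x \<in> S'. norm x \<le> real k} = \<Phi> ` {x \<in> S. norm x \<le> real k}" using iso by (auto simp flip: surj)
  moreover have "interp S' ((\<Phi> \<circ> v)(n := \<Phi> x)) \<phi> = interp S (v(n := x)) \<phi>" if "x \<in> S" for x
    unfolding fun_upd_comp[symmetric] using FSup that by (intro FSup(1)) auto
  ultimately show ?case by (simp add: image_image comp_def)
qed auto

subsection \<open>Formulas for columns of matrix units\<close>

lemma Rep_Abs_connective:
  assumes "continuous_on ({0..} \<times> {0..}) f" "\<And>s t. 0 \<le> s \<Longrightarrow> 0 \<le> t \<Longrightarrow> 0 \<le> f (s, t)"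
  shows "Rep_connective (Abs_connective f) = f"
  using assms by (intro Abs_connective_inverse) auto

definition FPlus :: "formula \<Rightarrow> formula \<Rightarrow> formula" where
  "FPlus = FConn (Abs_connective (\<lambda>(s, t). s + t))"

lemma interp_FPlus [simp]: "interp S v (FPlus \<phi> \<psi>) = interp S v \<phi> + interp S v \<psi>"
  unfolding FPlus_def by (simp, subst Rep_Abs_connective) (auto simp: case_prod_unfold intro!: continuous_intros)

lemma free_vars_FPlus [simp]: "free_vars (FPlus \<phi> \<psi>) = free_vars \<phi> \<union> free_vars \<psi>"
  by (simp add: FPlus_def)

primrec formula_sum :: "(nat \<Rightarrow> formula) \<Rightarrow> nat \<Rightarrow> formula" where
  "formula_sum F 0 = FNorm TZero"
| "formula_sum F (Suc n) = FPlus (formula_sum F n) (F n)"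

lemma interp_formula_sum [simp]: "interp S v (formula_sum F n) = (\<Sum>i<n. interp S v (F i))"
  by (induction n) simp_all

lemma free_vars_formula_sum [simp]: "free_vars (formula_sum F n) = (\<Union>i<n. free_vars (F i))"
  by (induction n) (simp_all add: lessThan_Suc Un_commute)

primrec term_sum :: "(nat \<Rightarrow> cterm) \<Rightarrow> nat \<Rightarrow> cterm" where
  "term_sum T 0 = TZero"
| "term_sum T (Suc n) = TAdd (term_sum T n) (T n)"

lemma term_val_term_sum [simp]: "term_val v (term_sum T n) = (\<Sum>i<n. term_val v (T i))"
  by (induction n) simp_all

lemma term_vars_term_sum [simp]: "term_vars (term_sum T n) = (\<Union>i<n. term_vars (T i))"
  by (induction n) (simp_all add: lessThan_Suc Un_commute)

abbreviation TDiff :: "cterm \<Rightarrow> cterm \<Rightarrow> cterm" where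
  "TDiff s t \<equiv> TAdd s (TScale (-1) t)"

text \<open>The first part measures the failure of the column relations, the second the failure of
  \<open>col_sum\<close> to be a left unit on \<open>S\<close>; the supremum lets this be said
  without naming a unit. The bound is written \<open>real 1\<close> to match the quantifier with
  \<open>k = 1\<close>.\<close>

definition defect :: "'a::cstar_algebra set \<Rightarrow> nat \<Rightarrow> (nat \<Rightarrow> 'a) \<Rightarrow> real" where
  "defect S d x = (\<Sum>a<d. \<Sum>b<d. norm (star (x a) * x b - (if a = b then x 0 else 0)))
     + (SUP z\<in>{z\<in>S. norm z \<le> real 1}. norm (z - col_sum d x * z))"

text \<open>The variables \<open>N + 1, \<dots>, N + d\<close> hold a column, \<open>N\<close> is a bound variable, and \<open>0, \<dots>, N - 1\<close>
  hold the elements with matrices \<open>c 0, \<dots>, c (N - 1)\<close>.\<close>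

definition column_formula :: "nat \<Rightarrow> nat \<Rightarrow> formula" where
  "column_formula N d = FPlus
     (formula_sum (\<lambda>a. formula_sum (\<lambda>b. FNorm (TDiff (TMult (TStar (TVar (N + Suc a))) (TVar (N + Suc b)))
        (if a = b then TVar (N + Suc 0) else TZero))) d) d)
     (FSup N 1 (FNorm (TDiff (TVar N)
        (TMult (term_sum (\<lambda>a. TMult (TVar (N + Suc a)) (TStar (TVar (N + Suc a)))) d) (TVar N)))))"

text \<open>Isolates the type of a tuple of matrices: the value 0 says that the column is exact and
  unital and that each of the first \<open>N\<close> variables is the element with matrix
  \<open>c j\<close> relative to it.\<close>

definition near_formula :: "nat \<Rightarrow> nat \<Rightarrow> (nat \<Rightarrow> nat \<Rightarrow> nat \<Rightarrow> complex) \<Rightarrow> formula" where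
  "near_formula N d c = FPlus (column_formula N d)
     (formula_sum (\<lambda>j. FNorm (TDiff (TVar j) (term_sum (\<lambda>p. term_sum (\<lambda>q.
        TScale (c j p q) (TMult (TVar (N + Suc p)) (TStar (TVar (N + Suc q))))) d) d))) N)"

lemma interp_column_formula:
  "interp S v (column_formula N d) = defect S d (\<lambda>a. v (N + Suc a))"
  unfolding column_formula_def defect_def interp_FPlus
  by (intro arg_cong2[where f = "(+)"])
     (auto simp: scaleC_minus_one col_sum_def intro!: sum.cong)

lemma interp_near_formula:
  "interp S v (near_formula N d c) = defect S d (\<lambda>a. v (N + Suc a))
     + (\<Sum>j<N. norm (v j - mat_val d (c j) (\<lambda>a. v (N + Suc a))))"
  by (simp add: near_formula_def interp_column_formula mat_val_def scaleC_minus_one)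

lemma free_vars_near_formula: "0 < d \<Longrightarrow> free_vars (near_formula N d c) \<subseteq> {..<N + Suc d}"
  by (auto simp: near_formula_def column_formula_def split: if_splits)

lemma defect_sup_bdd: "bdd_above ((\<lambda>z. norm (z - col_sum d x * z)) ` {z\<in>S. norm z \<le> real 1})"
proof (rule bdd_aboveI2)
  fix z assume "z \<in> {z\<in>S. norm z \<le> real 1}"
  then show "norm (z - col_sum d x * z) \<le> 1 + norm (col_sum d x) * 1"
    by (intro order.trans[OF norm_triangle_ineq4] add_mono norm_mult_le) auto
qed

lemma defect_nonneg:
  assumes "0 \<in> S" shows "0 \<le> defect S d x"
  \<comment> \<open>With \<open>N = 0\<close> the column occupies the variables
    \<open>1, ..., d\<close>, whence the shift by one.\<close>
  using interp_nonneg[OF assms, of "\<lambda>i. x (i - 1)" "column_formula 0 d"] by (simp add: interp_column_formula)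

text \<open>Turns a bound on the value of a formula into the hypotheses of
  \<open>unital_column_near\<close>; homogeneity extends the second estimate from the unit ball to
  all of \<open>S\<close>.\<close>

lemma defect_le:
  assumes S: "cstar_subalgebra S" and le: "defect S d x \<le> \<delta>"
  shows "\<And>a b. a < d \<Longrightarrow> b < d \<Longrightarrow> norm (star (x a) * x b - (if a = b then x 0 else 0)) \<le> \<delta>"
    "\<And>z. z \<in> S \<Longrightarrow> norm (z - col_sum d x * z) \<le> \<delta> * norm z"
proof -
  have 0: "0 \<le> (SUP z\<in>{z\<in>S. norm z \<le> real 1}. norm (z - col_sum d x * z))"
    by (rule cSUP_upper2[OF defect_sup_bdd, of 0]) (use cstar_subalgebraD(2)[OF S] in auto)
  show "norm (star (x a) * x b - (if a = b then x 0 else 0)) \<le> \<delta>" if "a < d" "b < d" for a b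
  proof -
    have "norm (star (x a) * x b - (if a = b then x 0 else 0))
        \<le> (\<Sum>b<d. norm (star (x a) * x b - (if a = b then x 0 else 0)))"
      using that by (intro member_le_sum) auto
    also have "\<dots> \<le> (\<Sum>a<d. \<Sum>b<d. norm (star (x a) * x b - (if a = b then x 0 else 0)))"
      using that by (intro member_le_sum[of a _ "\<lambda>a. \<Sum>b<d. norm (star (x a) * x b - (if a = b then x 0 else 0))"])
        (auto intro: sum_nonneg)
    also have "\<dots> \<le> \<delta>" using le 0 unfolding defect_def by linarith
    finally show ?thesis .
  qed
  have 1: "norm (z - col_sum d x * z) \<le> \<delta>" if "z \<in> S" "norm z \<le> 1" for z
  proof -
    have "norm (z - col_sum d x * z) \<le> (SUP z\<in>{z\<in>S. norm z \<le> real 1}. norm (z - col_sum d x * z))"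
      by (rule cSUP_upper[OF _ defect_sup_bdd]) (use that in auto)
    moreover have "0 \<le> (\<Sum>a<d. \<Sum>b<d. norm (star (x a) * x b - (if a = b then x 0 else 0)))"
      by (intro sum_nonneg) auto
    ultimately show ?thesis using le unfolding defect_def by linarith
  qed
  show "norm (z - col_sum d x * z) \<le> \<delta> * norm z" if "z \<in> S" for z
  proof (cases "z = 0")
    case False
    define y where "y = (1 / norm z) *\<^sub>R z"
    have y: "y \<in> S" "norm y = 1" "z = norm z *\<^sub>R y"
      using that False cstar_subalgebraD(7)[OF S] by (auto simp: y_def)
    have "norm (z - col_sum d x * z) = norm (norm z *\<^sub>R (y - col_sum d x * y))"
      using y(3) by (metis mult_scaleR_right scaleR_diff_right)
    also have "\<dots> \<le> norm z * \<delta>" using 1[OF y(1)] y(2) by (simp add: mult_left_mono)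
    finally show ?thesis by (simp add: mult.commute)
  qed simp
qed

lemma defect_eq_0:
  assumes "0 \<in> S" "unit_column d x" "\<And>z. z \<in> S \<Longrightarrow> col_sum d x * z = z"
  shows "defect S d x = 0"
proof -
  have "(\<lambda>z. norm (z - col_sum d x * z)) ` {z\<in>S. norm z \<le> real 1} = {0}"
    using assms(1,3) by (auto intro!: rev_image_eqI[of 0])
  then show ?thesis using columnD(4)[OF assms(2)] by (simp add: defect_def)
qed

subsection \<open>Blocks of quantifiers\<close>

primrec FSups :: "nat list \<Rightarrow> nat \<Rightarrow> formula \<Rightarrow> formula" where
  "FSups [] K \<phi> = \<phi>"
| "FSups (n # ns) K \<phi> = FSup n K (FSups ns K \<phi>)"

primrec FInfs :: "nat list \<Rightarrow> nat \<Rightarrow> formula \<Rightarrow> formula" where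
  "FInfs [] K \<phi> = \<phi>"
| "FInfs (n # ns) K \<phi> = FInf n K (FInfs ns K \<phi>)"

lemma free_vars_FSups: "free_vars (FSups ns K \<phi>) = free_vars \<phi> - set ns"
  by (induction ns) auto

lemma free_vars_FInfs: "free_vars (FInfs ns K \<phi>) = free_vars \<phi> - set ns"
  by (induction ns) auto

text \<open>Formulas are nonnegative, so a supremum with value 0 is a genuine universal quantifier.
  For an infimum, \<open>interp_FInfs_lessD\<close> yields only approximate witnesses.\<close>

lemma interp_FSup_eq_0_iff:
  assumes "0 \<in> S"
  shows "interp S v (FSup n k \<phi>) = 0 \<longleftrightarrow> (\<forall>x\<in>S. norm x \<le> real k \<longrightarrow> interp S (v(n := x)) \<phi> = 0)"
proof -
  have bdd: "bdd_above ((\<lambda>x. interp S (v(n := x)) \<phi>) ` {x \<in> S. norm x \<le> real k})"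
  proof -
    obtain B where "\<And>x. norm x \<le> real k \<Longrightarrow> interp S (v(n := x)) \<phi> \<le> B" using interp_update_bounded[OF assms] by metis
    then show ?thesis by (intro bdd_aboveI2[of _ _ B]) simp
  qed
  show ?thesis
  proof (intro iffI ballI impI)
    fix x assume 0: "interp S v (FSup n k \<phi>) = 0" and x: "x \<in> S" "norm x \<le> real k"
    have "interp S (v(n := x)) \<phi> \<le> interp S v (FSup n k \<phi>)"
      unfolding interp.simps by (rule cSUP_upper[OF _ bdd]) (use x in simp)
    then show "interp S (v(n := x)) \<phi> = 0" using 0 interp_nonneg[OF assms, of "v(n := x)" \<phi>] by simp
  next
    assume "\<forall>x\<in>S. norm x \<le> real k \<longrightarrow> interp S (v(n := x)) \<phi> = 0"
    then have "interp S v (FSup n k \<phi>) \<le> 0"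
      unfolding interp.simps by (intro cSUP_least[OF zero_ball_nonempty[OF assms]]) auto
    then show "interp S v (FSup n k \<phi>) = 0" using interp_nonneg[OF assms, of v "FSup n k \<phi>"] by linarith
  qed
qed

lemma interp_FSups_eq_0I:
  assumes "0 \<in> S" "\<And>w. (\<And>i. i \<notin> set ns \<Longrightarrow> w i = v i) \<Longrightarrow>
    (\<And>i. i \<in> set ns \<Longrightarrow> w i \<in> S \<and> norm (w i) \<le> real K) \<Longrightarrow> interp S w \<phi> = 0"
  shows "interp S v (FSups ns K \<phi>) = 0"
  using assms(2)
proof (induction ns arbitrary: v)
  case Nil
  then show ?case by simp
next
  case (Cons n ns)
  have "interp S (v(n := x)) (FSups ns K \<phi>) = 0" if x: "x \<in> S" "norm x \<le> real K" for x
  proof (rule Cons.IH)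
    fix w assume w: "\<And>i. i \<notin> set ns \<Longrightarrow> w i = (v(n := x)) i"
      "\<And>i. i \<in> set ns \<Longrightarrow> w i \<in> S \<and> norm (w i) \<le> real K"
    show "interp S w \<phi> = 0"
    proof (rule Cons.prems)
      show "w i = v i" if "i \<notin> set (n # ns)" for i using w(1)[of i] that by simp
      show "w i \<in> S \<and> norm (w i) \<le> real K" if "i \<in> set (n # ns)" for i
        using w that x by (cases "i \<in> set ns") auto
    qed
  qed
  then show ?case unfolding FSups.simps interp_FSup_eq_0_iff[OF assms(1)] by blast
qed

lemma interp_FSups_eq_0D:
  assumes "0 \<in> S" "interp S v (FSups ns K \<phi>) = 0" "\<And>i. i \<notin> set ns \<Longrightarrow> w i = v i"
    "\<And>i. i \<in> set ns \<Longrightarrow> w i \<in> S \<and> norm (w i) \<le> real K"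
  shows "interp S w \<phi> = 0"
  using assms(2-)
proof (induction ns arbitrary: v)
  case Nil
  then have "w = v" by auto
  with Nil show ?case by simp
next
  case (Cons n ns)
  have "interp S (v(n := w n)) (FSups ns K \<phi>) = 0"
    using Cons.prems(1,3) unfolding FSups.simps interp_FSup_eq_0_iff[OF assms(1)] by simp
  then show ?case by (rule Cons.IH) (use Cons.prems in auto)
qed

lemma interp_FInf_le:
  assumes "0 \<in> S" "x \<in> S" "norm x \<le> real k"
  shows "interp S v (FInf n k \<phi>) \<le> interp S (v(n := x)) \<phi>"
  unfolding interp.simps
  by (rule cINF_lower[OF bdd_belowI2[of _ 0]]) (use assms in \<open>simp_all add: interp_nonneg\<close>)

lemma interp_FInfs_le:
  assumes "0 \<in> S" "\<And>i. i \<notin> set ns \<Longrightarrow> w i = v i"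
    "\<And>i. i \<in> set ns \<Longrightarrow> w i \<in> S \<and> norm (w i) \<le> real K"
  shows "interp S v (FInfs ns K \<phi>) \<le> interp S w \<phi>"
  using assms(2-)
proof (induction ns arbitrary: v)
  case Nil
  then have "w = v" by auto
  then show ?case by simp
next
  case (Cons n ns)
  have "interp S v (FInfs (n # ns) K \<phi>) \<le> interp S (v(n := w n)) (FInfs ns K \<phi>)"
    unfolding FInfs.simps using Cons.prems by (intro interp_FInf_le assms) auto
  also have "\<dots> \<le> interp S w \<phi>" by (rule Cons.IH) (use Cons.prems in auto)
  finally show ?case .
qed

lemma interp_FInfs_lessD:
  assumes "0 \<in> S" "interp S v (FInfs ns K \<phi>) < r"
  shows "\<exists>w. (\<forall>i. i \<notin> set ns \<longrightarrow> w i = v i) \<and> (\<forall>i\<in>set ns. w i \<in> S \<and> norm (w i) \<le> real K) \<and> interp S w \<phi> < r"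
  using assms(2)
proof (induction ns arbitrary: v)
  case Nil
  then show ?case by auto
next
  case (Cons n ns)
  have "(INF x\<in>{x \<in> S. norm x \<le> real K}. interp S (v(n := x)) (FInfs ns K \<phi>)) < r"
    using Cons.prems by simp
  then obtain x where x: "x \<in> S" "norm x \<le> real K" "interp S (v(n := x)) (FInfs ns K \<phi>) < r"
    using cINF_less_iff[OF zero_ball_nonempty[OF assms(1)] bdd_belowI2[of _ 0]] interp_nonneg[OF assms(1)]
    by (metis (mono_tags, lifting) mem_Collect_eq)
  obtain w where w: "\<forall>i. i \<notin> set ns \<longrightarrow> w i = (v(n := x)) i" "\<forall>i\<in>set ns. w i \<in> S \<and> norm (w i) \<le> real K"
    "interp S w \<phi> < r" using Cons.IH[OF x(3)] by blast
  have "w n \<in> S \<and> norm (w n) \<le> real K" using w x by (cases "n \<in> set ns") auto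
  then show ?case using w by (intro exI[of _ w]) auto
qed

subsection \<open>Isolation of the types of columns\<close>

lemma mat_val_in_subalgebra:
  assumes "cstar_subalgebra S" "\<And>a. a < d \<Longrightarrow> v a \<in> S"
  shows "mat_val d c v \<in> S"
  unfolding mat_val_def using assms
  by (intro cstar_subalgebra_sum[OF assms(1)] cstar_subalgebraD(6)[OF assms(1)]
      cstar_subalgebraD(4)[OF assms(1)] cstar_subalgebraD(5)[OF assms(1)]) auto

lemma norm_mat_val_diff_le:
  assumes x: "\<And>a. a < d \<Longrightarrow> norm (x a) \<le> K" and y: "\<And>a. a < d \<Longrightarrow> norm (y a) \<le> 1"
    and xy: "\<And>a. a < d \<Longrightarrow> norm (x a - y a) \<le> \<eta>"
  shows "norm (mat_val d c x - mat_val d c y) \<le> (\<Sum>p<d. \<Sum>q<d. cmod (c p q)) * (\<eta> * (K + 1))"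
proof -
  have "norm (x p * star (x q) - y p * star (y q)) \<le> \<eta> * (K + 1)" if "p < d" "q < d" for p q
  proof -
    have eq: "x p * star (x q) - y p * star (y q) = (x p - y p) * star (x q) + y p * star (x q - y q)"
      by (simp add: algebra_simps star_diff)
    have "norm (x p * star (x q) - y p * star (y q)) \<le> \<eta> * K + 1 * \<eta>"
      unfolding eq using assms that
      by (intro order.trans[OF norm_triangle_ineq] add_mono norm_mult_le) simp_all
    then show ?thesis by (simp add: algebra_simps)
  qed
  then have "norm (c p q *\<^sub>C (x p * star (x q)) - c p q *\<^sub>C (y p * star (y q))) \<le> cmod (c p q) * (\<eta> * (K + 1))"
    if "p < d" "q < d" for p q
    using that by (simp add: norm_scaleC mult_left_mono flip: scaleC_diff_right)
  then have "norm (mat_val d c x - mat_val d c y) \<le> (\<Sum>p<d. \<Sum>q<d. cmod (c p q) * (\<eta> * (K + 1)))"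
    unfolding mat_val_def sum_subtractf[symmetric]
    by (intro order.trans[OF norm_sum] sum_mono) (auto intro!: order.trans[OF norm_sum] sum_mono)
  then show ?thesis by (simp add: sum_distrib_right)
qed

lemma unitary_conjugation:
  fixes u :: "'a::unital_cstar_algebra"
  assumes u: "star u * u = 1" "u * star u = 1"
  defines "\<alpha> \<equiv> \<lambda>x. u * x * star u"
  shows "star_hom UNIV UNIV \<alpha>" "range \<alpha> = UNIV" "norm (\<alpha> x) = norm x"
    "\<alpha> (mat_val d c v) = mat_val d c (\<lambda>a. \<alpha> (v a))"
proof -
  have m: "\<alpha> (x * y) = \<alpha> x * \<alpha> y" for x y
  proof -
    have "\<alpha> x * \<alpha> y = u * x * (star u * u) * y * star u" unfolding \<alpha>_def by (simp only: mult.assoc)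
    then show ?thesis by (simp add: u \<alpha>_def mult.assoc)
  qed
  have a: "\<alpha> (x + y) = \<alpha> x + \<alpha> y" for x y by (simp add: \<alpha>_def distrib_left distrib_right)
  have s: "\<alpha> (star x) = star (\<alpha> x)" for x by (simp add: \<alpha>_def star_mult star_star mult.assoc)
  have c: "\<alpha> (c *\<^sub>C x) = c *\<^sub>C \<alpha> x" for c x by (simp add: \<alpha>_def mult_scaleC_left mult_scaleC_right)
  show "star_hom UNIV UNIV \<alpha>" by (simp add: star_hom_def m a s c)
  have "\<alpha> (star u * y * u) = y" for y
  proof -
    have "\<alpha> (star u * y * u) = (u * star u) * y * (u * star u)" unfolding \<alpha>_def by (simp only: mult.assoc)
    then show ?thesis by (simp add: u)
  qed
  then show "range \<alpha> = UNIV" by (metis surj_def)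
  have iso: "norm (u * y) = norm y" for y
  proof -
    have "star (u * y) * (u * y) = star y * (star u * u) * y" by (simp only: star_mult mult.assoc)
    then have "(norm (u * y))\<^sup>2 = (norm y)\<^sup>2" by (simp add: u flip: cstar_identity)
    then show ?thesis by simp
  qed
  \<comment> \<open>Left multiplication by \<open>u\<close> is isometric; right multiplication by
    \<open>star u\<close> becomes left multiplication by \<open>u\<close> after taking
    adjoints.\<close>
  have "norm (\<alpha> x) = norm (star (\<alpha> x))" by simp
  also have "star (\<alpha> x) = u * (star (u * x))" by (simp add: \<alpha>_def star_mult star_star mult.assoc)
  also have "norm \<dots> = norm x" unfolding iso norm_star by (rule refl)
  finally show "norm (\<alpha> x) = norm x" .
  have sm: "\<alpha> (\<Sum>i\<in>I. f i) = (\<Sum>i\<in>I. \<alpha> (f i))" for f :: "nat \<Rightarrow> 'a" and I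
    by (simp add: \<alpha>_def sum_distrib_left sum_distrib_right)
  show "\<alpha> (mat_val d c v) = mat_val d c (\<lambda>a. \<alpha> (v a))"
    by (simp add: mat_val_def sm c m s)
qed

section \<open>Chains of matrix algebras and the isolation of types in them\<close>

locale uhf_chain =
  fixes D :: "nat \<Rightarrow> nat" and E :: "nat \<Rightarrow> nat \<Rightarrow> 'a::unital_cstar_algebra"
  assumes nontrivial: "1 \<noteq> (0::'a)"
    and level: "unital_column (D n) (E n)"
    and inclusion: "a < D n \<Longrightarrow> E n a \<in> mat_alg (D (Suc n)) (E (Suc n))"
    and dense: "closure (\<Union>n. mat_alg (D n) (E n)) = UNIV"
begin

abbreviation "C n \<equiv> mat_alg (D n) (E n)"

lemmas C_sub = unital_column.mat_alg_subalgebra[OF level]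
lemmas E_column = unital_column.E[OF level]
lemmas E_unit = unital_column.unit[OF level]

lemma C_Suc: "C n \<subseteq> C (Suc n)"
  unfolding unital_column.mat_alg_eq_range[OF level[of n]]
  by (auto intro!: mat_val_in_subalgebra C_sub inclusion)

lemma C_mono: "m \<le> n \<Longrightarrow> C m \<subseteq> C n"
  by (rule lift_Suc_mono_le[of C, OF C_Suc])

lemma one_in_C: "1 \<in> C n"
  unfolding E_unit[symmetric, of n] col_sum_def
  by (intro cstar_subalgebra_sum[OF C_sub] cstar_subalgebraD(4)[OF C_sub] cstar_subalgebraD(5)[OF C_sub]
      unital_column.E_in[OF level]) auto

text \<open>Take almost best approximations in each stage; the distances tend to 0 because the
  stages increase with dense union. Having the \<open>m\<close>-th member in \<open>C m\<close>
  allows several elements to be approximated at a common stage.\<close>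

lemma approximating_sequence: "\<exists>y. (\<forall>m. y m \<in> C m) \<and> y \<longlonglongrightarrow> x"
proof -
  have ex: "\<exists>y. y \<in> C m \<and> dist y x < infdist x (C m) + inverse (real (Suc m))" for m
  proof -
    have "C m \<noteq> {}" using cstar_subalgebraD(2)[OF C_sub[of m]] by auto
    then have "(INF y\<in>C m. dist x y) < infdist x (C m) + inverse (real (Suc m))"
      by (simp add: infdist_def)
    from cInf_lessD[OF _ this] \<open>C m \<noteq> {}\<close>
    obtain y where "y \<in> C m" "dist x y < infdist x (C m) + inverse (real (Suc m))" by blast
    then show ?thesis by (auto simp: dist_commute)
  qed
  then obtain y where y: "\<And>m. y m \<in> C m" "\<And>m. dist (y m) x < infdist x (C m) + inverse (real (Suc m))"
    using ex choice[of "\<lambda>m y. y \<in> C m \<and> dist y x < infdist x (C m) + inverse (real (Suc m))"] by blast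
  have "y \<longlonglongrightarrow> x"
  proof (rule metric_LIMSEQ_I)
    fix r :: real assume "0 < r"
    have "x \<in> closure (\<Union>n. C n)" using dense by simp
    then have "\<exists>z\<in>\<Union>n. C n. dist z x < r/2"
      unfolding closure_approachable by (rule allE[of _ "r/2"]) (use \<open>0 < r\<close> in simp)
    then obtain n z where z: "z \<in> C n" "dist z x < r/2" by blast
    obtain k where k: "inverse (real (Suc k)) < r/2" using \<open>0 < r\<close> reals_Archimedean[of "r/2"] by auto
    show "\<exists>no. \<forall>m\<ge>no. dist (y m) x < r"
    proof (intro exI[of _ "max n k"] allI impI)
      fix m assume m: "max n k \<le> m"
      then have "z \<in> C m" using z(1) C_mono[of n m] by auto
      then have "infdist x (C m) \<le> dist x z" by (rule infdist_le)
      moreover have "inverse (real (Suc m)) \<le> inverse (real (Suc k))" using m by simp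
      ultimately show "dist (y m) x < r" using y(2)[of m] z(2) k dist_commute[of x z] by linarith
    qed
  qed
  with y(1) show ?thesis by blast
qed

text \<open>An approximate column is moved into a stage \<open>C m\<close> and corrected there to an
  exact unital column \<open>x'\<close>. A unitary conjugates \<open>E n\<close> to
  \<open>x'\<close>, and conjugation preserves \<open>\<phi>\<close>; the tuple \<open>w\<close> is
  close to the conjugate of the tuple of matrices over \<open>E n\<close>, so uniform continuity
  applies.\<close>

lemma near_formula_isolates:
  fixes n :: nat
  assumes fv: "free_vars \<phi> \<subseteq> {..<N}" and "0 < \<epsilon>"
  defines "d \<equiv> D n"
  shows "\<exists>\<delta>>0. \<forall>w :: nat \<Rightarrow> 'a. (\<forall>i<N + Suc d. norm (w i) \<le> K) \<longrightarrow> interp UNIV w (near_formula N d c) < \<delta> \<longrightarrow>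
    \<bar>interp UNIV w \<phi> - interp UNIV (\<lambda>j. mat_val d (c j) (E n)) \<phi>\<bar> \<le> \<epsilon>"
proof -
  define va where "va = (\<lambda>j. mat_val d (c j) (E n))"
  define K' where "K' = max K (\<Sum>j<N. norm (va j))"
  have K': "K \<le> K'" "j < N \<Longrightarrow> norm (va j) \<le> K'" for j
    unfolding K'_def by (auto simp: le_max_iff_disj intro!: disjI2 member_le_sum)
  obtain \<delta>1 where \<delta>1: "\<delta>1 > 0" "\<And>v w :: nat \<Rightarrow> 'a. (\<forall>i\<in>free_vars \<phi>. norm (v i) \<le> K' \<and> norm (w i) \<le> K' \<and> norm (v i - w i) < \<delta>1)
    \<Longrightarrow> \<bar>interp UNIV v \<phi> - interp UNIV w \<phi>\<bar> \<le> \<epsilon>"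
    using interp_uniformly_continuous[OF UNIV_I \<open>0 < \<epsilon>\<close>, of \<phi> K'] by metis
  define L where "L = 1 + (\<Sum>j<N. \<Sum>p<d. \<Sum>q<d. cmod (c j p q)) * (\<bar>K\<bar> + 1)"
  have L: "(\<Sum>p<d. \<Sum>q<d. cmod (c j p q)) * (\<bar>K\<bar> + 1) \<le> L" if "j < N" for j
  proof -
    have "(\<Sum>p<d. \<Sum>q<d. cmod (c j p q)) \<le> (\<Sum>j<N. \<Sum>p<d. \<Sum>q<d. cmod (c j p q))"
      using that by (intro member_le_sum[of j _ "\<lambda>j. \<Sum>p<d. \<Sum>q<d. cmod (c j p q)"]) (auto intro!: sum_nonneg)
    then have "(\<Sum>p<d. \<Sum>q<d. cmod (c j p q)) * (\<bar>K\<bar> + 1) \<le> (\<Sum>j<N. \<Sum>p<d. \<Sum>q<d. cmod (c j p q)) * (\<bar>K\<bar> + 1)"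
      by (intro mult_right_mono) auto
    then show ?thesis unfolding L_def by linarith
  qed
  have L0: "L > 0" unfolding L_def by (intro add_pos_nonneg mult_nonneg_nonneg sum_nonneg) auto
  \<comment> \<open>The passage from \<open>x\<close> to \<open>x'\<close> costs
    \<open>2 * \<eta>\<close>, which moves the matrices by at most \<open>2 * \<eta> * L\<close>,
    half of \<open>\<delta>1\<close>. The other half is left for the distance from
    \<open>w j\<close> to the matrix over \<open>x\<close>.\<close>
  define \<eta> where "\<eta> = \<delta>1 / (4 * L)"
  have \<eta>: "\<eta> > 0" using \<delta>1(1) L0 by (simp add: \<eta>_def)
  have d: "0 < d" unfolding d_def by (rule columnD(1)[OF E_column])
  obtain \<delta>2 where \<delta>2: "\<delta>2 > 0" "\<And>S (x :: nat \<Rightarrow> 'a). cstar_subalgebra S \<Longrightarrow> (\<forall>a<d. x a \<in> S) \<Longrightarrow>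
    (\<forall>a<d. \<forall>b<d. norm (star (x a) * x b - (if a = b then x 0 else 0)) \<le> \<delta>2) \<Longrightarrow>
    (\<forall>z\<in>S. norm (z - col_sum d x * z) \<le> \<delta>2 * norm z) \<Longrightarrow>
    (\<exists>w. (\<forall>a<d. w a \<in> S) \<and> unit_column d w \<and> (\<forall>z\<in>S. col_sum d w * z = z) \<and> (\<forall>a<d. norm (w a - x a) \<le> \<eta>))"
    using unital_column_near[OF d \<eta>, where 'a='a] by blast
  show ?thesis
  proof (intro exI[of _ "min \<delta>2 (\<delta>1/2)"] conjI allI impI)
    fix w :: "nat \<Rightarrow> 'a"
    assume wK: "\<forall>i<N + Suc d. norm (w i) \<le> K" and near: "interp UNIV w (near_formula N d c) < min \<delta>2 (\<delta>1/2)"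
    define x where "x = (\<lambda>a. w (N + Suc a))"
    have df: "defect UNIV d x < \<delta>2" and nr: "\<And>j. j < N \<Longrightarrow> norm (w j - mat_val d (c j) x) < \<delta>1/2"
    proof -
      have 0: "0 \<le> defect UNIV d x" by (simp add: defect_nonneg)
      have 1: "0 \<le> (\<Sum>j<N. norm (w j - mat_val d (c j) x))" by (simp add: sum_nonneg)
      show "defect UNIV d x < \<delta>2" using near 1 unfolding interp_near_formula x_def by linarith
      have 2: "(\<Sum>j<N. norm (w j - mat_val d (c j) x)) < \<delta>1/2"
        using near 0 unfolding interp_near_formula x_def by linarith
      show "norm (w j - mat_val d (c j) x) < \<delta>1/2" if "j < N" for j
        using that 2 by (intro order.strict_trans1[OF _ 2] member_le_sum) auto
    qed
    obtain y where y: "\<And>a m. y a m \<in> C m" "\<And>a. y a \<longlonglongrightarrow> x a"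
      using choice[of "\<lambda>a y. (\<forall>m. y m \<in> C m) \<and> y \<longlonglongrightarrow> x a"] approximating_sequence by blast
    \<comment> \<open>Continuity of the defect comes from the continuity of the column formula, read
      with \<open>N = 0\<close>.\<close>
    have "(\<lambda>m. interp UNIV (\<lambda>i. y (i - 1) m) (column_formula 0 d)) \<longlonglongrightarrow> interp UNIV (\<lambda>i. x (i - 1)) (column_formula 0 d)"
      by (intro tendsto_interp y) simp
    then have "(\<lambda>m. defect UNIV d (\<lambda>a. y a m)) \<longlonglongrightarrow> defect UNIV d x"
      by (simp add: interp_column_formula)
    then have "eventually (\<lambda>m. defect UNIV d (\<lambda>a. y a m) < \<delta>2) sequentially"
      using df by (rule order_tendstoD)
    moreover have "eventually (\<lambda>m. \<forall>a\<in>{..<d}. norm (y a m - x a) < \<eta>) sequentially"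
      using y(2) \<eta> by (intro eventually_ball_finite ballI) (auto simp: tendsto_iff dist_norm)
    ultimately have "eventually (\<lambda>m. defect UNIV d (\<lambda>a. y a m) < \<delta>2 \<and> (\<forall>a\<in>{..<d}. norm (y a m - x a) < \<eta>) \<and> n \<le> m) sequentially"
      by (intro eventually_conj eventually_ge_at_top)
    then obtain m where m: "defect UNIV d (\<lambda>a. y a m) < \<delta>2" "\<And>a. a < d \<Longrightarrow> norm (y a m - x a) < \<eta>" "n \<le> m"
      by (auto simp: eventually_sequentially)
    note dl = defect_le[OF cstar_subalgebra_UNIV less_imp_le[OF m(1)]]
    \<comment> \<open>The correction is carried out inside \<open>C m\<close>, which contains 1: the
      resulting left unit of \<open>C m\<close> is therefore 1 itself, and conjugacy in a matrix
      algebra becomes available.\<close>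
    obtain x' where x': "\<And>a. a < d \<Longrightarrow> x' a \<in> C m" "unit_column d x'" "\<And>z. z \<in> C m \<Longrightarrow> col_sum d x' * z = z"
      "\<And>a. a < d \<Longrightarrow> norm (x' a - y a m) \<le> \<eta>"
      using \<delta>2(2)[OF C_sub[of m], of "\<lambda>a. y a m"] y(1) dl by blast
    have "col_sum d x' = 1" using x'(3)[OF one_in_C] by simp
    moreover have "E n a \<in> C m" if "a < d" for a
      using unital_column.E_in[OF level, of a n] that C_mono[OF m(3)] by (auto simp: d_def)
    ultimately obtain u where u: "star u * u = 1" "u * star u = 1" "\<And>a. a < d \<Longrightarrow> u * E n a * star u = x' a"
      using unital_column.unital_columns_conjugate[OF level nontrivial x'(2,1) _
          E_column[of n, folded d_def] _ E_unit[of n, folded d_def]] by blast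
    define \<alpha> where "\<alpha> = (\<lambda>x. u * x * star u)"
    have \<alpha>: "star_hom UNIV UNIV \<alpha>" "range \<alpha> = UNIV" "\<And>x. norm (\<alpha> x) = norm x"
      "\<And>d c v. \<alpha> (mat_val d c v) = mat_val d c (\<lambda>a. \<alpha> (v a))"
      unfolding \<alpha>_def by (rule unitary_conjugation[OF u(1,2)])+
    have \<alpha>va: "\<alpha> (va j) = mat_val d (c j) x'" for j
      unfolding va_def \<alpha>(4) using u(3) by (simp add: mat_val_def) (simp add: \<alpha>_def)
    have inv: "interp UNIV (\<alpha> \<circ> va) \<phi> = interp UNIV va \<phi>"
      by (rule interp_star_iso[OF cstar_subalgebra_UNIV \<alpha>(1,2)]) (auto simp: \<alpha>(3))
    have "\<bar>interp UNIV w \<phi> - interp UNIV (\<alpha> \<circ> va) \<phi>\<bar> \<le> \<epsilon>"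
    proof (intro \<delta>1(2) ballI conjI)
      fix j assume "j \<in> free_vars \<phi>"
      then have j: "j < N" using fv by auto
      show "norm (w j) \<le> K'" using wK K'(1) j by (meson order.trans trans_less_add1)
      show "norm ((\<alpha> \<circ> va) j) \<le> K'" using K'(2)[OF j] by (simp add: \<alpha>(3))
      have "norm (mat_val d (c j) x - mat_val d (c j) x') \<le> (\<Sum>p<d. \<Sum>q<d. cmod (c j p q)) * (2 * \<eta> * (\<bar>K\<bar> + 1))"
      proof (rule norm_mat_val_diff_le)
        fix a assume a: "a < d"
        have "norm (x a) \<le> K" using wK a by (simp add: x_def)
        then show "norm (x a) \<le> \<bar>K\<bar>" by linarith
        show "norm (x' a) \<le> 1" by (rule columnD(8)[OF x'(2) a])
        show "norm (x a - x' a) \<le> 2 * \<eta>"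
          using norm_triangle_ineq[of "x a - y a m" "y a m - x' a"] m(2)[OF a] x'(4)[OF a]
          by (simp add: norm_minus_commute)
      qed
      also have "\<dots> = 2 * \<eta> * ((\<Sum>p<d. \<Sum>q<d. cmod (c j p q)) * (\<bar>K\<bar> + 1))" by (simp add: mult_ac)
      also have "\<dots> \<le> 2 * \<eta> * L" using L[OF j] \<eta> by (intro mult_left_mono) auto
      also have "\<dots> = \<delta>1/2" using L0 by (simp add: \<eta>_def)
      finally have "norm (mat_val d (c j) x - mat_val d (c j) x') \<le> \<delta>1/2" .
      then show "norm (w j - (\<alpha> \<circ> va) j) < \<delta>1"
        using norm_triangle_ineq[of "w j - mat_val d (c j) x" "mat_val d (c j) x - mat_val d (c j) x'"] nr[OF j]
        by (simp add: \<alpha>va)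
    qed
    then have "\<bar>interp UNIV w \<phi> - interp UNIV va \<phi>\<bar> \<le> \<epsilon>" by (simp only: inv)
    then show "\<bar>interp UNIV w \<phi> - interp UNIV (\<lambda>j. mat_val d (c j) (E n)) \<phi>\<bar> \<le> \<epsilon>"
      by (simp only: va_def)
  qed (use \<delta>1 \<delta>2 in auto)
qed

end

section \<open>Transfer of types to a model\<close>

locale uhf_model = uhf_chain D E for D and E :: "nat \<Rightarrow> nat \<Rightarrow> 'a::unital_cstar_algebra" +
  fixes B :: "'b::cstar_algebra set"
  assumes B: "cstar_subalgebra B" and theory_B: "theory_of B = theory_of (UNIV :: 'a set)"
begin

lemmas BD = cstar_subalgebraD[OF B]

lemma sentence_value:
  assumes "free_vars \<sigma> = {}"
  shows "interp B (\<lambda>_. 0) \<sigma> = interp (UNIV :: 'a set) (\<lambda>_. 0) \<sigma>"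
  using fun_cong[OF theory_B, of \<sigma>] assms by (simp add: theory_of_def is_sentence_def)

definition B_column :: "nat \<Rightarrow> (nat \<Rightarrow> 'b) \<Rightarrow> bool" where
  "B_column d f \<longleftrightarrow> unit_column d f \<and> (\<forall>a<d. f a \<in> B) \<and> (\<forall>z\<in>B. col_sum d f * z = z)"

text \<open>For each \<open>\<epsilon>\<close> a sentence says that assignments at which the near
  formula is below \<open>\<delta>\<close> give \<open>\<phi>\<close> a value within
  \<open>\<epsilon>\<close> of \<open>r\<close>. It has value 0 in \<open>A\<close> by isolation,
  hence in \<open>B\<close>, where the exact column \<open>f\<close> makes the near formula
  vanish.\<close>

lemma elementary_on_matrices:
  assumes f: "B_column (D n) f"
  shows "interp B (\<lambda>j. mat_val (D n) (c j) f) \<phi> = interp UNIV (\<lambda>j. mat_val (D n) (c j) (E n)) \<phi>"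
proof -
  define d where "d = D n"
  define va where "va = (\<lambda>j. mat_val d (c j) (E n))"
  define vb where "vb = (\<lambda>j. mat_val d (c j) f)"
  define r where "r = interp UNIV va \<phi>"
  have f': "unit_column d f" "\<And>a. a < d \<Longrightarrow> f a \<in> B" "\<And>z. z \<in> B \<Longrightarrow> col_sum d f * z = z"
    using f by (auto simp: B_column_def d_def)
  have d: "0 < d" by (rule columnD(1)[OF f'(1)])
  obtain N where N: "free_vars \<phi> \<subseteq> {..<N}" using finite_nat_bounded[of "free_vars \<phi>"] by auto
  \<comment> \<open>Quantifier bounds are natural numbers; the summand 1 makes room for the entries
    of the column.\<close>
  obtain K where K: "1 + (\<Sum>j<N. norm (vb j)) \<le> real K" using real_arch_simple by blast
  have "0 \<le> (\<Sum>j<N. norm (vb j))" by (simp add: sum_nonneg)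
  then have K1: "1 \<le> real K" using K by linarith
  have Kb: "norm (vb j) \<le> real K" if "j < N" for j
  proof -
    have "norm (vb j) \<le> (\<Sum>j<N. norm (vb j))" using that by (intro member_le_sum) auto
    then show ?thesis using K by linarith
  qed
  have "\<bar>interp B vb \<phi> - r\<bar> \<le> \<epsilon>" if "0 < \<epsilon>" for \<epsilon>
  proof -
    note pos = \<open>0 < \<epsilon>\<close>
    obtain \<delta> where \<delta>: "\<delta> > 0" "\<And>w :: nat \<Rightarrow> 'a. (\<forall>i<N + Suc d. norm (w i) \<le> real K) \<Longrightarrow> interp UNIV w (near_formula N d c) < \<delta> \<Longrightarrow>
      \<bar>interp UNIV w \<phi> - r\<bar> \<le> \<epsilon>"
      using near_formula_isolates[OF N pos, of n "real K" c] unfolding r_def va_def d_def by metis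
    \<comment> \<open>\<open>g (s, t) = 0\<close> holds exactly if \<open>s\<close> is within
      \<open>\<epsilon>\<close> of \<open>r\<close> or \<open>t\<close> is at least
      \<open>\<delta>\<close>; the minimum is a continuous form of the implication.\<close>
    define g where "g = (\<lambda>(s, t). min (max 0 (\<bar>s - r\<bar> - \<epsilon>)) (max 0 (\<delta> - t)))"
    have g: "Rep_connective (Abs_connective g) = g"
      by (rule Rep_Abs_connective) (auto simp: g_def case_prod_unfold intro!: continuous_intros)
    define \<psi> where "\<psi> = FConn (Abs_connective g) \<phi> (near_formula N d c)"
    define \<sigma> where "\<sigma> = FSups [0..<N + Suc d] K \<psi>"
    have fv\<sigma>: "free_vars \<sigma> = {}"
      using N free_vars_near_formula[OF d, of N c] by (fastforce simp: \<sigma>_def free_vars_FSups \<psi>_def)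
    have "interp (UNIV :: 'a set) (\<lambda>_. 0) \<sigma> = 0"
      unfolding \<sigma>_def
    proof (rule interp_FSups_eq_0I)
      fix w :: "nat \<Rightarrow> 'a" assume w: "\<And>i. i \<in> set [0..<N + Suc d] \<Longrightarrow> w i \<in> UNIV \<and> norm (w i) \<le> real K"
      show "interp UNIV w \<psi> = 0"
      proof (cases "interp UNIV w (near_formula N d c) < \<delta>")
        case True
        have "norm (w i) \<le> real K" if "i < N + Suc d" for i using w[of i] that by (auto simp: less_Suc_eq)
        with True have "\<bar>interp UNIV w \<phi> - r\<bar> \<le> \<epsilon>" by (intro \<delta>(2)) auto
        then show ?thesis unfolding \<psi>_def interp.simps g by (simp add: g_def)
      next
        case False
        then show ?thesis unfolding \<psi>_def interp.simps g by (simp add: g_def)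
      qed
    qed simp
    then have 0: "interp B (\<lambda>_. 0) \<sigma> = 0" using sentence_value[OF fv\<sigma>] by simp
    \<comment> \<open>The variable \<open>N\<close> is bound in the column formula but belongs to
      the quantified block, so it receives the value 0.\<close>
    define w where "w = (\<lambda>i. if i < N then vb i else if N < i \<and> i < N + Suc d then f (i - Suc N) else 0)"
    have vbB: "vb j \<in> B" for j unfolding vb_def by (rule mat_val_in_subalgebra[OF B f'(2)])
    have wf: "w (N + Suc a) = (if a < d then f a else 0)" for a by (simp add: w_def)
    have "interp B w \<psi> = 0"
    proof (rule interp_FSups_eq_0D[OF BD(2) 0[unfolded \<sigma>_def]])
      show "w i = 0" if "i \<notin> set [0..<N + Suc d]" for i using that by (auto simp: w_def)
      show "w i \<in> B \<and> norm (w i) \<le> real K" if "i \<in> set [0..<N + Suc d]" for i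
      proof (cases "N < i \<and> i < N + Suc d")
        case True
        then have "i - Suc N < d" by auto
        then show ?thesis using True f'(2) columnD(8)[OF f'(1), of "i - Suc N"] K1 by (auto simp: w_def)
      next
        case False
        then show ?thesis using vbB Kb BD(2) by (auto simp: w_def)
      qed
    qed
    moreover have "interp B w (near_formula N d c) = 0"
    proof -
      have "mat_val d c' (\<lambda>a. w (N + Suc a)) = mat_val d c' f" for c'
        unfolding mat_val_def wf by simp
      moreover have "defect B d (\<lambda>a. w (N + Suc a)) = 0"
        using f'(1,3) d by (intro defect_eq_0 BD) (simp_all only: wf unit_column_def col_sum_def, simp_all)
      ultimately show ?thesis unfolding interp_near_formula by (simp add: w_def vb_def)
    qed
    ultimately have "\<bar>interp B w \<phi> - r\<bar> \<le> \<epsilon>"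
      using \<delta>(1) unfolding \<psi>_def interp.simps g by (auto simp: g_def min_def max_def split: if_splits)
    moreover have "interp B w \<phi> = interp B vb \<phi>"
      using N by (intro interp_cong_free_vars) (auto simp: w_def)
    ultimately show ?thesis by simp
  qed
  then have "\<bar>interp B vb \<phi> - r\<bar> \<le> 0" by (rule field_le_epsilon) simp
  then show ?thesis by (simp add: vb_def va_def r_def d_def)
qed

end

subsection \<open>The embedding as a limit of approximately compatible matrix embeddings\<close>

text \<open>Let a fresh variable \<open>x_k\<close> stand for the value of \<open>t\<close>. The
  norm of \<open>x_k - t\<close> is then 0 in \<open>A\<close>, hence also after applying
  \<open>h\<close>. Thus preservation of formulas already makes \<open>h\<close> respect the
  algebraic operations.\<close>

lemma elementary_term_val:
  fixes h :: "'a::cstar_algebra \<Rightarrow> 'b::cstar_algebra"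
  assumes h: "\<And>\<phi> v. range v \<subseteq> S \<Longrightarrow> interp B (\<lambda>i. h (v i)) \<phi> = interp A v \<phi>"
    and v: "range v \<subseteq> S" "term_val v t \<in> S"
  shows "h (term_val v t) = term_val (\<lambda>i. h (v i)) t"
proof -
  obtain k where k: "k \<notin> term_vars t" using ex_new_if_finite[OF infinite_UNIV_nat finite_term_vars] by blast
  have cong: "term_val v t = term_val w t" if "\<And>i. i \<in> term_vars t \<Longrightarrow> v i = w i" for v w :: "nat \<Rightarrow> 'c::cstar_algebra"
    using that by (induction t) auto
  define w where "w = v(k := term_val v t)"
  have "range w \<subseteq> S" using v by (auto simp: w_def)
  from h[OF this, of "FNorm (TDiff (TVar k) t)"]
  have "norm (h (w k) - term_val (\<lambda>i. h (w i)) t) = norm (w k - term_val w t)"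
    by (simp add: scaleC_minus_one)
  moreover have "term_val w t = term_val v t" using k by (intro cong) (auto simp: w_def)
  moreover have "term_val (\<lambda>i. h (w i)) t = term_val (\<lambda>i. h (v i)) t" using k by (intro cong) (auto simp: w_def)
  ultimately show ?thesis by (simp add: w_def)
qed

text \<open>Presents the column itself as a tuple of matrices, so that
  \<open>elementary_on_matrices\<close> can be applied to formulas about it.\<close>

lemma mat_val_unit:
  assumes "unit_column d v"
  shows "mat_val d (\<lambda>p q. if p = j \<and> q = 0 then 1 else 0) v = (if j < d then v j else 0)"
proof -
  note vD = columnD[OF assms]
  have "(\<Sum>q<d. (if p = j \<and> q = 0 then 1 else 0) *\<^sub>C (v p * star (v q))) = (if p = j then v j else 0)"
    if "p < d" for p
  proof -
    have "(\<Sum>q<d. (if p = j \<and> q = 0 then 1 else 0) *\<^sub>C (v p * star (v q)))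
        = (\<Sum>q<d. if q = 0 then (if p = j then v j else 0) else 0)"
      using that by (intro sum.cong refl) (auto simp: vD)
    then show ?thesis using vD(1) by simp
  qed
  then show ?thesis by (simp add: mat_val_def)
qed

context uhf_chain begin

definition coef :: "nat \<Rightarrow> 'a \<Rightarrow> nat \<Rightarrow> nat \<Rightarrow> complex" where
  "coef n x = (SOME c. x = mat_val (D n) c (E n))"

lemma mat_val_coef: "x \<in> C n \<Longrightarrow> mat_val (D n) (coef n x) (E n) = x"
  unfolding coef_def unital_column.mat_alg_eq_range[OF level] by (metis (mono_tags) imageE someI)

lemma norm_E0: "norm (E n 0) = 1"
proof -
  have "norm (E n 0) * norm (E n 0) = norm (E n 0)"
    using cstar_identity[of "E n 0"] columnD(2,3)[OF E_column[of n]] by (simp add: power2_eq_square)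
  then show ?thesis using unital_column.E0_neq_0[OF level nontrivial, of n] by simp
qed

text \<open>The compression by \<open>E n p\<close> and \<open>E n q\<close> is contractive and
  returns the entry times \<open>E n 0\<close>, which has norm 1.\<close>

lemma norm_coef_le:
  assumes "x \<in> C n" "p < D n" "q < D n"
  shows "cmod (coef n x p q) \<le> norm x"
proof -
  have "cmod (coef n x p q) = norm (star (E n p) * x * E n q)"
    using unital_column.entry_mat_val[OF level assms(2,3), of "coef n x"]
    by (simp add: mat_val_coef[OF assms(1)] norm_scaleC norm_E0)
  also have "\<dots> \<le> 1 * norm x * 1"
    using columnD(8)[OF E_column] assms by (intro norm_mult_le) auto
  finally show ?thesis by simp
qed

end

context uhf_model begin

text \<open>The vanishing infimum provides approximate witnesses in \<open>B\<close>, and stability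
  replaces one of them by an exact column at the cost of the error \<open>\<epsilon>\<close> in the
  parameters.\<close>

lemma column_of_near_formula:
  assumes v: "interp B v (FInfs [N..<N + Suc d] 1 (near_formula N d c)) = 0" and d: "0 < d" and "0 < \<epsilon>"
  shows "\<exists>f. B_column d f \<and> (\<forall>j<N. norm (v j - mat_val d (c j) f) < \<epsilon>)"
proof -
  define L where "L = 1 + (\<Sum>j<N. \<Sum>p<d. \<Sum>q<d. cmod (c j p q)) * 2"
  have L: "(\<Sum>p<d. \<Sum>q<d. cmod (c j p q)) * 2 \<le> L" if "j < N" for j
  proof -
    have "(\<Sum>p<d. \<Sum>q<d. cmod (c j p q)) \<le> (\<Sum>j<N. \<Sum>p<d. \<Sum>q<d. cmod (c j p q))"
      using that by (intro member_le_sum[of j _ "\<lambda>j. \<Sum>p<d. \<Sum>q<d. cmod (c j p q)"]) (auto intro!: sum_nonneg)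
    then show ?thesis unfolding L_def by linarith
  qed
  have L0: "L > 0" unfolding L_def by (intro add_pos_nonneg mult_nonneg_nonneg sum_nonneg) auto
  \<comment> \<open>Correcting the column by \<open>\<eta>\<close> moves the matrices by at most
    \<open>\<eta> * L\<close>, half of \<open>\<epsilon>\<close>; the near formula contributes the
    other half.\<close>
  define \<eta> where "\<eta> = \<epsilon> / (2 * L)"
  have \<eta>: "\<eta> > 0" using \<open>0 < \<epsilon>\<close> L0 by (simp add: \<eta>_def)
  obtain \<delta> where \<delta>: "\<delta> > 0" "\<And>S (x :: nat \<Rightarrow> 'b). cstar_subalgebra S \<Longrightarrow> (\<forall>a<d. x a \<in> S) \<Longrightarrow>
    (\<forall>a<d. \<forall>b<d. norm (star (x a) * x b - (if a = b then x 0 else 0)) \<le> \<delta>) \<Longrightarrow>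
    (\<forall>z\<in>S. norm (z - col_sum d x * z) \<le> \<delta> * norm z) \<Longrightarrow>
    (\<exists>w. (\<forall>a<d. w a \<in> S) \<and> unit_column d w \<and> (\<forall>z\<in>S. col_sum d w * z = z) \<and> (\<forall>a<d. norm (w a - x a) \<le> \<eta>))"
    using unital_column_near[OF d \<eta>, where 'a='b] by blast
  have "interp B v (FInfs [N..<N + Suc d] 1 (near_formula N d c)) < min \<delta> (\<epsilon>/2)"
    using v \<delta>(1) \<open>0 < \<epsilon>\<close> by simp
  from interp_FInfs_lessD[OF BD(2) this]
  obtain w where w: "\<And>i. i \<notin> set [N..<N + Suc d] \<Longrightarrow> w i = v i"
    "\<And>i. i \<in> set [N..<N + Suc d] \<Longrightarrow> w i \<in> B \<and> norm (w i) \<le> real 1"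
    "interp B w (near_formula N d c) < min \<delta> (\<epsilon>/2)" by blast
  define x where "x = (\<lambda>a. w (N + Suc a))"
  have x: "x a \<in> B" "norm (x a) \<le> 1" if "a < d" for a
  proof -
    have "N + Suc a \<in> set [N..<N + Suc d]" using that by (simp only: set_upt atLeastLessThan_iff) linarith
    from w(2)[OF this] show "x a \<in> B" "norm (x a) \<le> 1" by (simp_all add: x_def)
  qed
  have wv: "w j = v j" if "j < N" for j using that by (intro w(1)) simp
  have 0: "0 \<le> defect B d x" by (simp add: defect_nonneg BD)
  have 1: "0 \<le> (\<Sum>j<N. norm (w j - mat_val d (c j) x))" by (simp add: sum_nonneg)
  have df: "defect B d x \<le> \<delta>" using w(3) 1 unfolding interp_near_formula x_def by linarith
  have 2: "(\<Sum>j<N. norm (w j - mat_val d (c j) x)) < \<epsilon>/2"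
    using w(3) 0 unfolding interp_near_formula x_def by linarith
  have nr: "norm (w j - mat_val d (c j) x) < \<epsilon>/2" if "j < N" for j
    using that 2 by (intro order.strict_trans1[OF _ 2] member_le_sum) auto
  obtain f where f: "\<And>a. a < d \<Longrightarrow> f a \<in> B" "unit_column d f" "\<And>z. z \<in> B \<Longrightarrow> col_sum d f * z = z"
    "\<And>a. a < d \<Longrightarrow> norm (f a - x a) \<le> \<eta>"
    using \<delta>(2)[OF B, of x] x(1) defect_le[OF B df] by blast
  have "norm (v j - mat_val d (c j) f) < \<epsilon>" if j: "j < N" for j
  proof -
    have "norm (mat_val d (c j) x - mat_val d (c j) f) \<le> (\<Sum>p<d. \<Sum>q<d. cmod (c j p q)) * (\<eta> * (1 + 1))"
      using x(2) f(4) columnD(8)[OF f(2)] by (intro norm_mat_val_diff_le) (auto simp: norm_minus_commute)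
    also have "\<dots> = \<eta> * ((\<Sum>p<d. \<Sum>q<d. cmod (c j p q)) * 2)" by (simp add: mult_ac)
    also have "\<dots> \<le> \<eta> * L" using L[OF j] \<eta> by (intro mult_left_mono) auto
    also have "\<dots> = \<epsilon>/2" using L0 by (simp add: \<eta>_def)
    finally have "norm (mat_val d (c j) x - mat_val d (c j) f) \<le> \<epsilon>/2" .
    then show ?thesis
      using norm_triangle_ineq[of "v j - mat_val d (c j) x" "mat_val d (c j) x - mat_val d (c j) f"] nr[OF j]
      unfolding wv[OF j] by simp
  qed
  with f show ?thesis unfolding B_column_def by blast
qed

lemma near_formula_realized:
  assumes "\<And>j. j < N \<Longrightarrow> v j = mat_val (D n) (c j) (E n)"
  shows "interp (UNIV :: 'a set) v (FInfs [N..<N + Suc (D n)] 1 (near_formula N (D n) c)) = 0"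
proof -
  \<comment> \<open>In \<open>A\<close> the infimum is attained at the column \<open>E n\<close>.
    The variable \<open>N\<close>, also in the block, is set to 0.\<close>
  define w where "w = (\<lambda>i. if N < i \<and> i < N + Suc (D n) then E n (i - Suc N) else if i = N then 0 else v i)"
  have wE: "w (N + Suc a) = (if a < D n then E n a else v (N + Suc a))" for a by (simp add: w_def)
  have "interp UNIV v (FInfs [N..<N + Suc (D n)] 1 (near_formula N (D n) c)) \<le> interp UNIV w (near_formula N (D n) c)"
  proof (rule interp_FInfs_le)
    show "w i \<in> UNIV \<and> norm (w i) \<le> real 1" if i: "i \<in> set [N..<N + Suc (D n)]" for i
    proof (cases "i = N")
      case False
      then have "i - Suc N < D n" "w i = E n (i - Suc N)" using i by (auto simp: w_def)
      then show ?thesis using columnD(8)[OF E_column] by simp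
    qed (simp add: w_def)
  qed (auto simp: w_def)
  also have "\<dots> = 0"
  proof -
    have "mat_val (D n) c' (\<lambda>a. w (N + Suc a)) = mat_val (D n) c' (E n)" for c'
      unfolding mat_val_def wE by simp
    moreover have "defect UNIV (D n) (\<lambda>a. w (N + Suc a)) = 0"
      using E_column[of n] E_unit[of n] columnD(1)[OF E_column[of n]]
      by (intro defect_eq_0) (simp_all only: wE unit_column_def col_sum_def, simp_all)
    ultimately show ?thesis unfolding interp_near_formula using assms by (simp add: w_def)
  qed
  finally show ?thesis using interp_nonneg[of "UNIV :: 'a set" v] by (simp add: order_antisym)
qed

text \<open>Without parameters the formula is a sentence expressing the approximate existence of a
  unital column of length \<open>D 0\<close>, so it has the same value in \<open>B\<close> as in
  \<open>A\<close>.\<close>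

lemma initial_column: "\<exists>f. B_column (D 0) f"
proof -
  have d: "0 < D 0" by (rule columnD(1)[OF E_column])
  define \<sigma> where "\<sigma> = FInfs [0..<0 + Suc (D 0)] 1 (near_formula 0 (D 0) (\<lambda>_ _ _. 0))"
  have "free_vars \<sigma> = {}" using free_vars_near_formula[OF d, of 0] by (fastforce simp: \<sigma>_def free_vars_FInfs)
  then have "interp B (\<lambda>_. 0) \<sigma> = 0"
    using near_formula_realized[of 0] by (simp only: sentence_value) (simp add: \<sigma>_def)
  then show ?thesis
    using column_of_near_formula[of "\<lambda>_. 0" 0 "D 0" "\<lambda>_ _ _. 0" 1] d unfolding \<sigma>_def by auto
qed

text \<open>That the entries of \<open>E n\<close> have prescribed matrices over some unital column
  of length \<open>D (Suc n)\<close> is a formula in these entries with value 0 in \<open>A\<close>.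
  By \<open>elementary_on_matrices\<close> at stage \<open>n\<close>, it has value 0 at the entries
  of \<open>f\<close>.\<close>

lemma extend_column:
  assumes f: "B_column (D n) f" and "0 < \<epsilon>"
  shows "\<exists>f'. B_column (D (Suc n)) f' \<and>
    (\<forall>a<D n. norm (f a - mat_val (D (Suc n)) (coef (Suc n) (E n a)) f') < \<epsilon>)"
proof -
  \<comment> \<open>The matrices of the entries of the column itself; an index beyond the column
    gives 0.\<close>
  define e :: "nat \<Rightarrow> nat \<Rightarrow> nat \<Rightarrow> complex" where "e = (\<lambda>j p q. if p = j \<and> q = 0 then 1 else (0::complex))"
  have e: "mat_val (D n) (e j) v = (if j < D n then v j else 0)" if "unit_column (D n) v" for j and v :: "nat \<Rightarrow> 'a"
    unfolding e_def by (rule mat_val_unit[OF that])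
  have eB: "mat_val (D n) (e j) f = (if j < D n then f j else 0)" for j
    unfolding e_def by (rule mat_val_unit) (use f in \<open>simp add: B_column_def\<close>)
  define \<sigma> where "\<sigma> = FInfs [D n..<D n + Suc (D (Suc n))] 1 (near_formula (D n) (D (Suc n)) (\<lambda>j. coef (Suc n) (E n j)))"
  have "interp B (\<lambda>j. mat_val (D n) (e j) f) \<sigma> = interp UNIV (\<lambda>j. mat_val (D n) (e j) (E n)) \<sigma>"
    by (rule elementary_on_matrices[OF f])
  also have "\<dots> = 0"
    unfolding \<sigma>_def by (intro near_formula_realized) (simp add: e E_column mat_val_coef inclusion)
  finally show ?thesis
    using column_of_near_formula[OF _ columnD(1)[OF E_column] \<open>0 < \<epsilon>\<close>, of "\<lambda>j. mat_val (D n) (e j) f" "D n"] f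
    unfolding \<sigma>_def by (fastforce simp: eB)
qed

text \<open>An element \<open>x\<close> of stage \<open>n\<close> has \<open>D n\<close> squared
  coefficients of modulus at most \<open>norm x\<close>, and replacing the column in a product of
  two entries costs twice the tolerance. The choice bounds the total change by
  \<open>(1/2) ^ n * norm x\<close>.\<close>

definition tolerance :: "nat \<Rightarrow> real" where
  "tolerance n = (1/2) ^ n / (2 * (real (D n))\<^sup>2)"

lemma column_sequence:
  obtains F where "\<And>n. B_column (D n) (F n)"
    "\<And>n a. a < D n \<Longrightarrow> norm (F n a - mat_val (D (Suc n)) (coef (Suc n) (E n a)) (F (Suc n))) < tolerance n"
proof -
  have "0 < tolerance n" for n using columnD(1)[OF E_column[of n]] by (simp add: tolerance_def)
  then obtain F where "\<And>n. B_column (D n) (F n)"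
    "\<And>n. \<forall>a<D n. norm (F n a - mat_val (D (Suc n)) (coef (Suc n) (E n a)) (F (Suc n))) < tolerance n"
    using dependent_nat_choice[of "\<lambda>n f. B_column (D n) f" "\<lambda>n f f'. \<forall>a<D n. norm (f a - mat_val (D (Suc n)) (coef (Suc n) (E n a)) f') < tolerance n"]
      initial_column extend_column by blast
  then show thesis using that by blast
qed

end

section \<open>The limit of the stage embeddings\<close>

locale uhf_model_columns = uhf_model D E B for D and E :: "nat \<Rightarrow> nat \<Rightarrow> 'a::unital_cstar_algebra"
    and B :: "'b::cstar_algebra set" +
  fixes F :: "nat \<Rightarrow> nat \<Rightarrow> 'b"
  assumes F: "B_column (D n) (F n)"
    and F_step: "a < D n \<Longrightarrow> norm (F n a - mat_val (D (Suc n)) (coef (Suc n) (E n a)) (F (Suc n))) < tolerance n"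
begin

definition \<Phi> :: "nat \<Rightarrow> 'a \<Rightarrow> 'b" where
  "\<Phi> n x = mat_val (D n) (coef n x) (F n)"

lemma \<Phi>_elementary:
  assumes "range v \<subseteq> C n"
  shows "interp B (\<lambda>i. \<Phi> n (v i)) \<phi> = interp UNIV v \<phi>"
proof -
  have "mat_val (D n) (coef n (v i)) (E n) = v i" for i using assms by (intro mat_val_coef) auto
  then show ?thesis
    unfolding \<Phi>_def using elementary_on_matrices[OF F[of n], of "\<lambda>i. coef n (v i)" \<phi>] by simp
qed

lemmas \<Phi>_term_val = elementary_term_val[where h = "\<Phi> n" and S = "C n" for n, OF \<Phi>_elementary]

lemma \<Phi>_in_B: "\<Phi> n x \<in> B"
  unfolding \<Phi>_def using F[of n] by (intro mat_val_in_subalgebra B) (simp add: B_column_def)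

lemma norm_\<Phi>: "x \<in> C n \<Longrightarrow> norm (\<Phi> n x) = norm x"
  using \<Phi>_elementary[of "\<lambda>_. x" n "FNorm (TVar 0)"] by simp

lemma \<Phi>_diff:
  assumes "x \<in> C n" "y \<in> C n"
  shows "\<Phi> n (x - y) = \<Phi> n x - \<Phi> n y"
  using \<Phi>_term_val[of n "\<lambda>i. if i = 0 then x else y" "TDiff (TVar 0) (TVar 1)"] assms
    cstar_subalgebraD(9)[OF C_sub assms]
  by (simp add: image_subset_iff scaleC_minus_one)

lemma \<Phi>_mat_val:
  assumes "\<And>a. v a \<in> C n"
  shows "\<Phi> n (mat_val d c v) = mat_val d c (\<lambda>a. \<Phi> n (v a))"
  using \<Phi>_term_val[of n v "term_sum (\<lambda>p. term_sum (\<lambda>q. TScale (c p q) (TMult (TVar p) (TStar (TVar q)))) d) d"]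
    mat_val_in_subalgebra[OF C_sub, of d v n c] assms
  by (simp add: image_subset_iff mat_val_def)

text \<open>Both images are combinations with the same coefficients, once over the images of
  \<open>E n\<close> under the next embedding and once over \<open>F n\<close>; these two columns
  differ by at most the tolerance.\<close>

lemma \<Phi>_step:
  assumes x: "x \<in> C n"
  shows "norm (\<Phi> (Suc n) x - \<Phi> n x) \<le> (1/2) ^ n * norm x"
proof -
  \<comment> \<open>Padding by 0 puts all values into the next stage, as
    \<open>\<Phi>_mat_val\<close> requires.\<close>
  define E' where "E' = (\<lambda>a. if a < D n then E n a else 0)"
  have E'C: "E' a \<in> C (Suc n)" for a by (auto simp: E'_def inclusion cstar_subalgebraD[OF C_sub])
  have "x = mat_val (D n) (coef n x) E'" using mat_val_coef[OF x] by (simp add: mat_val_def E'_def)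
  then have "\<Phi> (Suc n) x = \<Phi> (Suc n) (mat_val (D n) (coef n x) E')" by (rule arg_cong)
  also have "\<dots> = mat_val (D n) (coef n x) (\<lambda>a. \<Phi> (Suc n) (E' a))"
    by (rule \<Phi>_mat_val) (rule E'C)
  finally have "\<Phi> (Suc n) x = mat_val (D n) (coef n x) (\<lambda>a. \<Phi> (Suc n) (E' a))" .
  moreover have "norm (mat_val (D n) (coef n x) (\<lambda>a. \<Phi> (Suc n) (E' a)) - \<Phi> n x)
      \<le> (\<Sum>p<D n. \<Sum>q<D n. cmod (coef n x p q)) * (tolerance n * (1 + 1))"
    unfolding \<Phi>_def[of n]
  proof (rule norm_mat_val_diff_le)
    fix a assume a: "a < D n"
    show "norm (\<Phi> (Suc n) (E' a)) \<le> 1"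
      using norm_\<Phi>[OF E'C[of a]] columnD(8)[OF E_column a] a by (simp add: E'_def)
    show "norm (F n a) \<le> 1" using F[of n] columnD(8)[OF _ a] by (auto simp: B_column_def)
    show "norm (\<Phi> (Suc n) (E' a) - F n a) \<le> tolerance n"
      using F_step[OF a] a by (simp add: \<Phi>_def E'_def norm_minus_commute)
  qed
  moreover have "(\<Sum>p<D n. \<Sum>q<D n. cmod (coef n x p q)) * (tolerance n * (1 + 1)) \<le> (1/2) ^ n * norm x"
  proof -
    have "(\<Sum>p<D n. \<Sum>q<D n. cmod (coef n x p q)) \<le> (\<Sum>p<D n. \<Sum>q<D n. norm x)"
      using x by (intro sum_mono norm_coef_le) auto
    then have "(\<Sum>p<D n. \<Sum>q<D n. cmod (coef n x p q)) * (tolerance n * (1 + 1)) \<le> ((real (D n))\<^sup>2 * norm x) * (tolerance n * (1 + 1))"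
      by (intro mult_right_mono) (simp_all add: power2_eq_square tolerance_def mult.assoc)
    also have "\<dots> = (1/2) ^ n * norm x"
      using columnD(1)[OF E_column[of n]] by (simp add: tolerance_def field_simps)
    finally show ?thesis .
  qed
  ultimately show ?thesis by simp
qed

lemma \<Phi>_compare:
  assumes "m \<le> p" "x \<in> C m"
  shows "norm (\<Phi> p x - \<Phi> m x) \<le> 2 * (1/2) ^ m * norm x"
proof -
  \<comment> \<open>The exact partial sum of the geometric series is the bound that passes through
    the induction.\<close>
  have "norm (\<Phi> p x - \<Phi> m x) \<le> (2 * (1/2) ^ m - 2 * (1/2) ^ p) * norm x"
    using assms(1)
  proof (induction p rule: dec_induct)
    case base
    then show ?case by simp
  next
    case (step p)
    have "norm (\<Phi> (Suc p) x - \<Phi> m x) \<le> norm (\<Phi> (Suc p) x - \<Phi> p x) + norm (\<Phi> p x - \<Phi> m x)"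
      using norm_triangle_ineq[of "\<Phi> (Suc p) x - \<Phi> p x" "\<Phi> p x - \<Phi> m x"] by simp
    also have "\<dots> \<le> (1/2) ^ p * norm x + (2 * (1/2) ^ m - 2 * (1/2) ^ p) * norm x"
      using C_mono[of m p] step.hyps assms(2) by (intro add_mono \<Phi>_step step.IH) auto
    also have "\<dots> = (2 * (1/2) ^ m - 2 * (1/2) ^ Suc p) * norm x" by (simp add: algebra_simps)
    finally show ?case .
  qed
  also have "\<dots> \<le> 2 * (1/2) ^ m * norm x" by (intro mult_right_mono) auto
  finally show ?thesis .
qed

text \<open>For \<open>m < n\<close> compare through \<open>\<Phi> n (y m)\<close>: changing the
  argument is isometric within stage \<open>n\<close>, and changing the stage costs at most
  \<open>2 * (1/2) ^ m\<close> times a common bound of the norms.\<close>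

lemma Cauchy_\<Phi>:
  assumes y: "\<And>m. y m \<in> C m" "y \<longlonglongrightarrow> x"
  shows "Cauchy (\<lambda>m. \<Phi> m (y m))"
proof (rule CauchyI')
  fix r :: real assume r: "0 < r"
  obtain K where K: "0 < K" "\<And>m. norm (y m) \<le> K"
    using convergent_imp_Bseq[of y] y(2) by (auto simp: convergent_def Bseq_def)
  obtain M1 where M1: "\<And>m n. M1 \<le> m \<Longrightarrow> M1 \<le> n \<Longrightarrow> norm (y m - y n) < r/2"
    using LIMSEQ_imp_Cauchy[OF y(2)] r unfolding Cauchy_iff by (metis half_gt_zero)
  have "(\<lambda>m. 2 * (1/2) ^ m * K) \<longlonglongrightarrow> 2 * 0 * K"
    by (intro tendsto_intros LIMSEQ_power_zero) simp
  then have "eventually (\<lambda>m. 2 * (1/2) ^ m * K < r/2) sequentially"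
    using r by (intro order_tendstoD(2)) auto
  then obtain M2 where M2: "\<And>m. M2 \<le> m \<Longrightarrow> 2 * (1/2) ^ m * K < r/2"
    unfolding eventually_sequentially by blast
  have "dist (\<Phi> m (y m)) (\<Phi> n (y n)) < r" if m: "max M1 M2 \<le> m" and n: "m < n" for m n
  proof -
    have ymn: "y m \<in> C n" using C_mono[of m n] n y(1) by auto
    have "norm (\<Phi> n (y n) - \<Phi> n (y m)) = norm (y n - y m)"
      using \<Phi>_diff[OF y(1) ymn] norm_\<Phi>[OF cstar_subalgebraD(9)[OF C_sub y(1) ymn]] by simp
    also have "\<dots> < r/2" using m n by (intro M1) auto
    finally have 1: "norm (\<Phi> n (y n) - \<Phi> n (y m)) < r/2" .
    have "norm (\<Phi> n (y m) - \<Phi> m (y m)) \<le> 2 * (1/2) ^ m * norm (y m)" using n y by (intro \<Phi>_compare) auto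
    also have "\<dots> \<le> 2 * (1/2) ^ m * K" by (intro mult_left_mono K) auto
    also have "\<dots> < r/2" using m by (intro M2) auto
    finally have 2: "norm (\<Phi> n (y m) - \<Phi> m (y m)) < r/2" .
    have "norm (\<Phi> n (y n) - \<Phi> m (y m)) < r"
      using norm_triangle_ineq[of "\<Phi> n (y n) - \<Phi> n (y m)" "\<Phi> n (y m) - \<Phi> m (y m)"] 1 2 by simp
    then show ?thesis by (simp add: dist_norm norm_minus_commute)
  qed
  then show "\<exists>M. \<forall>m\<ge>M. \<forall>n>m. dist (\<Phi> m (y m)) (\<Phi> n (y n)) < r" by blast
qed

definition approx :: "'a \<Rightarrow> nat \<Rightarrow> 'a" where
  "approx x = (SOME y. (\<forall>m. y m \<in> C m) \<and> y \<longlonglongrightarrow> x)"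

lemma approx: "approx x m \<in> C m" "approx x \<longlonglongrightarrow> x"
  using someI_ex[OF approximating_sequence[of x]] unfolding approx_def by auto

text \<open>The approximating sequences are chosen separately for each \<open>x\<close>; additivity
  and the other algebraic laws are deduced from \<open>\<Psi>_elementary\<close> instead of from the
  sequences.\<close>

definition \<Psi> :: "'a \<Rightarrow> 'b" where
  "\<Psi> x = lim (\<lambda>m. \<Phi> m (approx x m))"

lemma \<Phi>_tendsto_\<Psi>: "(\<lambda>m. \<Phi> m (approx x m)) \<longlonglongrightarrow> \<Psi> x"
  unfolding \<Psi>_def using Cauchy_\<Phi>[OF approx] by (simp add: Cauchy_convergent_iff convergent_LIMSEQ_iff)

lemma \<Psi>_in_B: "\<Psi> x \<in> B"
  using closed_sequentially[OF BD(1) _ \<Phi>_tendsto_\<Psi>] \<Phi>_in_B by blast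

text \<open>The \<open>m\<close>-th approximations of all elements of the tuple lie in the same
  stage \<open>C m\<close>, on which \<open>\<Phi> m\<close> preserves formulas; continuity of
  formulas passes to the limit on both sides.\<close>

lemma \<Psi>_elementary: "interp B (\<lambda>i. \<Psi> (v i)) \<phi> = interp UNIV v \<phi>"
proof (rule LIMSEQ_unique)
  show "(\<lambda>m. interp B (\<lambda>i. \<Phi> m (approx (v i) m)) \<phi>) \<longlonglongrightarrow> interp B (\<lambda>i. \<Psi> (v i)) \<phi>"
    by (intro tendsto_interp BD \<Phi>_tendsto_\<Psi>)
  have "(\<lambda>m. interp UNIV (\<lambda>i. approx (v i) m) \<phi>) \<longlonglongrightarrow> interp UNIV v \<phi>"
    by (intro tendsto_interp UNIV_I approx)
  moreover have "interp B (\<lambda>i. \<Phi> m (approx (v i) m)) \<phi> = interp UNIV (\<lambda>i. approx (v i) m) \<phi>" for m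
    by (rule \<Phi>_elementary) (auto simp: approx)
  ultimately show "(\<lambda>m. interp B (\<lambda>i. \<Phi> m (approx (v i) m)) \<phi>) \<longlonglongrightarrow> interp UNIV v \<phi>" by simp
qed

lemma \<Psi>_term_val: "\<Psi> (term_val v t) = term_val (\<lambda>i. \<Psi> (v i)) t"
  by (rule elementary_term_val[where S = UNIV and A = UNIV and B = B]) (simp_all add: \<Psi>_elementary)

lemma \<Psi>_hom:
  "\<Psi> (x + y) = \<Psi> x + \<Psi> y" "\<Psi> (x * y) = \<Psi> x * \<Psi> y" "\<Psi> (star x) = star (\<Psi> x)" "\<Psi> (c *\<^sub>C x) = c *\<^sub>C \<Psi> x"
  using \<Psi>_term_val[of "\<lambda>i. if i = 0 then x else y" "TAdd (TVar 0) (TVar 1)"]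
    \<Psi>_term_val[of "\<lambda>i. if i = 0 then x else y" "TMult (TVar 0) (TVar 1)"]
    \<Psi>_term_val[of "\<lambda>i. x" "TStar (TVar 0)"] \<Psi>_term_val[of "\<lambda>i. x" "TScale c (TVar 0)"]
  by simp_all

lemma norm_\<Psi>: "norm (\<Psi> x) = norm x"
  using \<Psi>_elementary[of "\<lambda>_. x" "FNorm (TVar 0)"] by simp

lemma inj_\<Psi>: "inj \<Psi>"
proof (rule injI)
  fix x y assume "\<Psi> x = \<Psi> y"
  have "\<Psi> (x - y) = \<Psi> x - \<Psi> y"
    using \<Psi>_hom(1)[of x "- y"] \<Psi>_hom(4)[of "-1" y] by (simp add: scaleC_minus_one)
  then show "x = y" using norm_\<Psi>[of "x - y"] \<open>\<Psi> x = \<Psi> y\<close> by simp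
qed

lemma range_\<Psi>_subalgebra: "cstar_subalgebra (range \<Psi>)"
  unfolding cstar_subalgebra_def
proof (intro conjI ballI allI)
  have "\<Psi> (r *\<^sub>R x) = r *\<^sub>R \<Psi> x" for r x using \<Psi>_hom(4)[of "of_real r" x] by (simp add: scaleC_of_real)
  then have "bounded_linear \<Psi>" by (intro bounded_linear_intro[of _ 1]) (simp_all add: \<Psi>_hom norm_\<Psi>)
  then have "complete (range \<Psi>)"
    by (intro complete_isometric_image[of 1]) (auto simp: norm_\<Psi> complete_UNIV)
  then show "closed (range \<Psi>)" by (rule complete_imp_closed)
  have "\<Psi> 0 = 0" using norm_\<Psi>[of 0] by simp
  then show "0 \<in> range \<Psi>" using rangeI[of \<Psi> 0] by simp
  fix x y assume "x \<in> range \<Psi>" "y \<in> range \<Psi>"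
  then show "x + y \<in> range \<Psi>" "x * y \<in> range \<Psi>"
    by (auto simp flip: \<Psi>_hom)
next
  fix x c assume "x \<in> range \<Psi>"
  then show "star x \<in> range \<Psi>" "c *\<^sub>C x \<in> range \<Psi>"
    by (auto simp flip: \<Psi>_hom)
qed

lemma range_\<Psi>_elementary: "elementary_submodel (range \<Psi>) B" "star_isomorphic (UNIV :: 'a set) (range \<Psi>)"
proof -
  have hom: "star_hom UNIV (range \<Psi>) \<Psi>" by (simp add: star_hom_def \<Psi>_hom)
  have "interp B ((\<lambda>x. x) \<circ> v) \<phi> = interp (range \<Psi>) v \<phi>" if v: "range v \<subseteq> range \<Psi>" for v \<phi>
  proof -
    have "v i \<in> range \<Psi>" for i using v by auto
    then have w: "v = \<Psi> \<circ> w" if "w = (\<lambda>i. inv \<Psi> (v i))" for w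
      unfolding that by (intro ext) (simp add: f_inv_into_f)
    define w where "w = (\<lambda>i. inv \<Psi> (v i))"
    note w = w[OF w_def]
    \<comment> \<open>Values in the range and values in \<open>B\<close> are both equal to values in
      \<open>A\<close>: the former by isomorphism, the latter by elementarity of
      \<open>\<Psi>\<close>.\<close>
    have "interp (range \<Psi>) (\<Psi> \<circ> w) \<phi> = interp UNIV w \<phi>"
      by (rule interp_star_iso[OF cstar_subalgebra_UNIV hom]) (auto simp: norm_\<Psi>)
    then show ?thesis using \<Psi>_elementary[of w \<phi>] by (simp add: w comp_def)
  qed
  moreover have "range \<Psi> \<subseteq> B" using \<Psi>_in_B by auto
  ultimately show "elementary_submodel (range \<Psi>) B"
    unfolding elementary_submodel_def elementary_embedding_def
    using range_\<Psi>_subalgebra by (auto simp: star_hom_def)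
  show "star_isomorphic (UNIV :: 'a set) (range \<Psi>)"
    unfolding star_isomorphic_def using hom inj_\<Psi> by (auto simp: bij_betw_def)
qed

end

lemma (in uhf_model) elementary_copy:
  "\<exists>S. elementary_submodel S B \<and> star_isomorphic (UNIV :: 'a set) S"
proof -
  obtain F where "\<And>n. B_column (D n) (F n)"
    "\<And>n a. a < D n \<Longrightarrow> norm (F n a - mat_val (D (Suc n)) (coef (Suc n) (E n a)) (F (Suc n))) < tolerance n"
    by (rule column_sequence) blast
  then interpret uhf_model_columns D E B F by unfold_locales
  show ?thesis using range_\<Psi>_elementary by blast
qed

subsection \<open>UHF algebras as chains of matrix algebras\<close>

definition matrix_unit :: "'x \<Rightarrow> 'x \<Rightarrow> 'x cmatrix" where
  "matrix_unit p q = (\<lambda>r s. if r = p \<and> s = q then 1 else 0)"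

locale finite_matrix_embedding =
  fixes X :: "'x set" and \<theta> :: "'x cmatrix \<Rightarrow> 'a::unital_cstar_algebra"
  assumes emb: "matrix_embedding X \<theta>" and X: "finite X" "X \<noteq> {}"
begin

lemma theta_simps:
  "\<theta> (matrix_add a b) = \<theta> a + \<theta> b" "\<theta> (matrix_scale c a) = c *\<^sub>C \<theta> a"
  "\<theta> (matrix_mult X a b) = \<theta> a * \<theta> b" "\<theta> (matrix_adjoint a) = star (\<theta> a)"
  "\<theta> matrix_one = 1" "norm (\<theta> a) = matrix_norm X a"
  using emb unfolding matrix_embedding_def by blast+

text \<open>The operator norm over \<open>X\<close> of the difference is 0, and the embedding is
  isometric for it.\<close>

lemma \<theta>_cong:
  assumes "\<And>p q. p \<in> X \<Longrightarrow> q \<in> X \<Longrightarrow> a p q = b p q"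
  shows "\<theta> a = \<theta> b"
proof -
  define m where "m = matrix_add a (matrix_scale (-1) b)"
  have z: "cmod (\<Sum>q\<in>X. m p q * v q) = 0" if "p \<in> X" for p v
  proof -
    have "m p q * v q = 0" if "q \<in> X" for q
      unfolding m_def matrix_add_def matrix_scale_def assms[OF \<open>p \<in> X\<close> that] by simp
    then show ?thesis by (simp only: sum.neutral_const norm_zero cong: sum.cong)
  qed
  have eq: "L2_set (\<lambda>p. cmod (\<Sum>q\<in>X. m p q * v q)) X = 0" for v
  proof -
    have "L2_set (\<lambda>p. cmod (\<Sum>q\<in>X. m p q * v q)) X = L2_set (\<lambda>p. 0) X"
      by (rule L2_set_cong[OF refl z])
    then show ?thesis by (simp only: L2_set_constant)
  qed
  have mem: "(\<lambda>_. 0) \<in> {v :: 'x \<Rightarrow> complex. L2_set (\<lambda>q. cmod (v q)) X \<le> 1}"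
    by (simp add: L2_set_def)
  have ne: "{v :: 'x \<Rightarrow> complex. L2_set (\<lambda>q. cmod (v q)) X \<le> 1} \<noteq> {}"
  proof
    assume "{v :: 'x \<Rightarrow> complex. L2_set (\<lambda>q. cmod (v q)) X \<le> 1} = {}"
    from equals0D[OF this] mem show False by (rule notE)
  qed
  have "matrix_norm X m = 0" unfolding matrix_norm_def using cSUP_const[OF ne, of 0] by (simp only: eq)
  then have "\<theta> m = 0" using theta_simps(6)[of m] by simp
  then have "\<theta> a + (-1) *\<^sub>C \<theta> b = 0" unfolding m_def theta_simps(1,2) .
  then show ?thesis by (simp add: scaleC_minus_one)
qed

lemma \<theta>_zero: "\<theta> (\<lambda>_ _. 0) = 0"
  using theta_simps(2)[of 0 matrix_one] by (simp add: matrix_scale_def)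

lemma \<theta>_sum: "finite J \<Longrightarrow> \<theta> (\<lambda>p q. \<Sum>j\<in>J. m j p q) = (\<Sum>j\<in>J. \<theta> (m j))"
proof (induction J rule: finite_induct)
  case (insert j J)
  have "(\<lambda>p q. \<Sum>j\<in>insert j J. m j p q) = matrix_add (m j) (\<lambda>p q. \<Sum>j\<in>J. m j p q)"
    using insert.hyps by (simp add: matrix_add_def)
  then have "\<theta> (\<lambda>p q. \<Sum>j\<in>insert j J. m j p q) = \<theta> (m j) + (\<Sum>j\<in>J. \<theta> (m j))"
    by (simp only: theta_simps(1) insert.IH)
  then show ?case unfolding sum.insert[OF insert.hyps] .
qed (simp add: \<theta>_zero)

lemma matrix_unit_adjoint: "matrix_adjoint (matrix_unit p q) = matrix_unit q p"
  by (auto simp: matrix_adjoint_def matrix_unit_def intro!: ext)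

lemma unit_mult_left:
  assumes "p \<in> X"
  shows "matrix_mult X (matrix_unit q p) a = (\<lambda>r s. if r = q then a p s else 0)"
proof (intro ext)
  fix r s
  have "matrix_mult X (matrix_unit q p) a r s = (\<Sum>t\<in>X. if t = p then (if r = q then a p s else 0) else 0)"
    unfolding matrix_mult_def matrix_unit_def by (intro sum.cong refl) auto
  then show "matrix_mult X (matrix_unit q p) a r s = (if r = q then a p s else 0)" using assms X by simp
qed

lemma mult_unit_right:
  assumes "p \<in> X"
  shows "matrix_mult X a (matrix_unit p q) = (\<lambda>r s. if s = q then a r p else 0)"
proof (intro ext)
  fix r s
  have "matrix_mult X a (matrix_unit p q) r s = (\<Sum>t\<in>X. if t = p then (if s = q then a r p else 0) else 0)"
    unfolding matrix_mult_def matrix_unit_def by (intro sum.cong refl) auto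
  then show "matrix_mult X a (matrix_unit p q) r s = (if s = q then a r p else 0)" using assms X by simp
qed

text \<open>Columns are indexed by natural numbers, so the basis \<open>X\<close> is enumerated;
  \<open>enum 0\<close> serves as the base point of the column.\<close>

definition enum :: "nat \<Rightarrow> 'x" where
  "enum = (SOME h. bij_betw h {..<card X} X)"

lemma enum: "bij_betw enum {..<card X} X"
  unfolding enum_def using ex_bij_betw_nat_finite[OF X(1)] by (metis atLeast0LessThan someI_ex)

lemma enum_in: "a < card X \<Longrightarrow> enum a \<in> X"
  using enum by (auto dest: bij_betwE)

lemma enum_eq_iff: "a < card X \<Longrightarrow> b < card X \<Longrightarrow> enum a = enum b \<longleftrightarrow> a = b"
  using enum by (auto simp: bij_betw_def inj_on_def)

definition col :: "nat \<Rightarrow> 'a" where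
  "col a = \<theta> (matrix_unit (enum a) (enum 0))"

lemma card_pos: "0 < card X"
  using X by (simp add: card_gt_0_iff)

lemma star_col: "star (col a) = \<theta> (matrix_unit (enum 0) (enum a))"
  by (simp add: col_def matrix_unit_adjoint flip: theta_simps(4))

lemma unital_column_col: "unital_column (card X) col"
proof
  have "star (col a) * col b = (if a = b then col 0 else 0)" if "a < card X" "b < card X" for a b
  proof -
    have "star (col a) * col b = \<theta> (matrix_mult X (matrix_unit (enum 0) (enum a)) (matrix_unit (enum b) (enum 0)))"
      unfolding star_col by (simp add: col_def theta_simps(3))
    also have "matrix_mult X (matrix_unit (enum 0) (enum a)) (matrix_unit (enum b) (enum 0)) =
        (if a = b then matrix_unit (enum 0) (enum 0) else (\<lambda>_ _. 0))"
      unfolding unit_mult_left[OF enum_in[OF that(1)]]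
      using enum_eq_iff[OF that] by (auto simp: matrix_unit_def intro!: ext)
    finally show ?thesis by (simp add: \<theta>_zero col_def)
  qed
  then show "unit_column (card X) col" using card_pos by (simp add: unit_column_def)
  have "col a * star (col a) = \<theta> (matrix_unit (enum a) (enum a))" if "a < card X" for a
  proof -
    have "col a * star (col a) = \<theta> (matrix_mult X (matrix_unit (enum a) (enum 0)) (matrix_unit (enum 0) (enum a)))"
      unfolding star_col by (simp add: col_def theta_simps(3))
    also have "matrix_mult X (matrix_unit (enum a) (enum 0)) (matrix_unit (enum 0) (enum a)) = matrix_unit (enum a) (enum a)"
      unfolding unit_mult_left[OF enum_in[OF card_pos]] by (auto simp: matrix_unit_def intro!: ext)
    finally show ?thesis .
  qed
  then have "col_sum (card X) col = \<theta> (\<lambda>p q. \<Sum>a<card X. matrix_unit (enum a) (enum a) p q)"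
    by (simp add: col_sum_def \<theta>_sum)
  \<comment> \<open>The two matrices agree on \<open>X\<close> only: the sum vanishes on the
    diagonal outside \<open>X\<close>.\<close>
  also have "\<dots> = \<theta> matrix_one"
  proof (rule \<theta>_cong)
    fix p q assume pq: "p \<in> X" "q \<in> X"
    have "(\<Sum>a<card X. matrix_unit (enum a) (enum a) p q) = (\<Sum>x\<in>X. matrix_unit x x p q)"
      by (rule sum.reindex_bij_betw[OF enum, of "\<lambda>x. matrix_unit x x p q"])
    also have "\<dots> = (\<Sum>x\<in>X. if x = p then (if p = q then 1 else 0) else 0)"
      by (intro sum.cong refl) (auto simp: matrix_unit_def)
    also have "\<dots> = matrix_one p q" using pq X by (simp add: matrix_one_def)
    finally show "(\<Sum>a<card X. matrix_unit (enum a) (enum a) p q) = matrix_one p q" .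
  qed
  finally show "col_sum (card X) col = 1" by (simp add: theta_simps(5))
qed

lemma range_subset_mat_alg: "\<theta> m \<in> mat_alg (card X) col"
proof (rule unital_column.mat_algI[OF unital_column_col])
  fix a b assume ab: "a < card X" "b < card X"
  have "star (col a) * \<theta> m * col b =
      \<theta> (matrix_mult X (matrix_mult X (matrix_unit (enum 0) (enum a)) m) (matrix_unit (enum b) (enum 0)))"
    unfolding star_col by (simp add: col_def theta_simps(3))
  also have "matrix_mult X (matrix_mult X (matrix_unit (enum 0) (enum a)) m) (matrix_unit (enum b) (enum 0))
      = matrix_scale (m (enum a) (enum b)) (matrix_unit (enum 0) (enum 0))"
    unfolding unit_mult_left[OF enum_in[OF ab(1)]] mult_unit_right[OF enum_in[OF ab(2)]]
    by (auto simp: matrix_scale_def matrix_unit_def intro!: ext)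
  finally show "star (col a) * \<theta> m * col b = m (enum a) (enum b) *\<^sub>C col 0"
    by (simp add: theta_simps(2) col_def)
qed

end

section \<open>From a tensor product to a sequence of stages\<close>

locale tensor_product =
  fixes I :: "'i set" and k :: "'i \<Rightarrow> nat" and \<theta> :: "'i set \<Rightarrow> ('i \<Rightarrow> nat) cmatrix \<Rightarrow> 'a::unital_cstar_algebra"
  assumes k: "\<And>i. i \<in> I \<Longrightarrow> 1 \<le> k i" and tensor: "is_matrix_tensor_product I k \<theta>"
begin

lemma embedding:
  assumes "finite F" "F \<subseteq> I"
  shows "finite_matrix_embedding (tensor_index k F) (\<theta> F)"
proof
  show "matrix_embedding (tensor_index k F) (\<theta> F)"
    using tensor assms by (simp add: is_matrix_tensor_product_def)
  show "finite (tensor_index k F)" unfolding tensor_index_def using assms by (intro finite_PiE) auto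
  have "0 < k i" if "i \<in> F" for i using k[of i] that assms(2) by auto
  then have "restrict (\<lambda>_. 0) F \<in> tensor_index k F" unfolding tensor_index_def by auto
  then show "tensor_index k F \<noteq> {}" by auto
qed

definition alg :: "'i set \<Rightarrow> 'a set" where
  "alg F = mat_alg (card (tensor_index k F)) (finite_matrix_embedding.col (tensor_index k F) (\<theta> F))"

lemma \<theta>_in_alg: "finite F \<Longrightarrow> F \<subseteq> I \<Longrightarrow> \<theta> F m \<in> alg F"
  unfolding alg_def by (rule finite_matrix_embedding.range_subset_mat_alg[OF embedding])

text \<open>A matrix unit of a tensor product is an elementary tensor of matrix units. Padded by
  identity matrices outside \<open>F\<close>, it is identified with an elementary tensor over
  \<open>G\<close> by the compatibility of the canonical maps.\<close>

lemma col_in_alg: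
  assumes FG: "F \<subseteq> G" "finite G" "G \<subseteq> I" and a: "a < card (tensor_index k F)"
  shows "finite_matrix_embedding.col (tensor_index k F) (\<theta> F) a \<in> alg G"
proof -
  have F: "finite F" "F \<subseteq> I" using FG finite_subset by auto
  interpret finite_matrix_embedding "tensor_index k F" "\<theta> F" by (rule embedding[OF F])
  define u where "u = (\<lambda>i r s. if r = enum a i \<and> s = enum 0 i then 1 else (0::complex))"
  define u' where "u' = (\<lambda>i. if i \<in> F then u i else matrix_one)"
  have "col a = \<theta> F (elementary_tensor F u)"
    unfolding col_def
  proof (rule \<theta>_cong)
    fix p q assume "p \<in> tensor_index k F" "q \<in> tensor_index k F"
    then show "matrix_unit (enum a) (enum 0) p q = elementary_tensor F u p q"
      unfolding u_def using enum_in[OF a] enum_in[OF card_pos] F(1)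
      by (subst elementary_tensor_matrix_unit[of F "enum a" k]) (auto simp: matrix_unit_def)
  qed
  also have "elementary_tensor F u = elementary_tensor F u'"
    unfolding elementary_tensor_def u'_def by (intro ext prod.cong) auto
  also have "\<theta> F (elementary_tensor F u') = \<theta> G (elementary_tensor G u')"
  proof -
    have "\<theta> G (elementary_tensor G a) = \<theta> F (elementary_tensor F a)" if "\<forall>i\<in>G - F. a i = matrix_one" for a
      using tensor FG that unfolding is_matrix_tensor_product_def by blast
    then show ?thesis by (simp add: u'_def)
  qed
  finally show ?thesis using \<theta>_in_alg[OF FG(2,3)] by simp
qed

lemma alg_mono:
  assumes "F \<subseteq> G" "finite G" "G \<subseteq> I"
  shows "alg F \<subseteq> alg G"
proof -
  have F: "finite F" "F \<subseteq> I" using assms finite_subset by auto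
  have "cstar_subalgebra (alg G)" unfolding alg_def
    by (intro unital_column.mat_alg_subalgebra finite_matrix_embedding.unital_column_col embedding assms)
  then show ?thesis
    unfolding alg_def[of F]
      unital_column.mat_alg_eq_range[OF finite_matrix_embedding.unital_column_col[OF embedding[OF F]]]
    using col_in_alg[OF assms] by (auto intro!: mat_val_in_subalgebra)
qed

text \<open>The tensor product over the empty family consists of the scalars on a one-dimensional
  space, where the identity has norm 1; its canonical map is isometric and unital.\<close>

lemma one_neq_zero: "1 \<noteq> (0::'a)"
proof
  assume 0: "1 = (0::'a)"
  interpret finite_matrix_embedding "tensor_index k {}" "\<theta> {}" by (rule embedding) auto
  define x :: "'i \<Rightarrow> nat" where "x = (\<lambda>_. undefined)"
  have X: "tensor_index k {} = {x}" by (simp add: tensor_index_def x_def)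
  have "1 \<le> matrix_norm {x} matrix_one"
  proof -
    have eq: "L2_set (\<lambda>p. cmod (\<Sum>q\<in>{x}. matrix_one p q * v q)) {x} = cmod (v x)" for v :: "('i \<Rightarrow> nat) \<Rightarrow> complex"
      by (simp add: matrix_one_def L2_set_def)
    show ?thesis
      unfolding matrix_norm_def eq
    proof (rule cSUP_upper2[of _ _ "\<lambda>_. 1"])
      show "bdd_above ((\<lambda>v :: ('i \<Rightarrow> nat) \<Rightarrow> complex. cmod (v x)) ` {v. L2_set (\<lambda>q. cmod (v q)) {x} \<le> 1})"
        by (rule bdd_aboveI2[of _ _ 1]) (simp add: L2_set_def)
    qed (simp_all add: L2_set_def)
  qed
  then show False using theta_simps(5) theta_simps(6)[of matrix_one] 0 by (simp add: X)
qed

text \<open>The index set \<open>I\<close> may be uncountable, for instance through factors of size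
  1. A countable dense set supplies countably many finite subsets of \<open>I\<close> whose tensor
  products already have dense union.\<close>

lemma uhf_chain_exists:
  assumes "separable_space (euclidean :: 'a topology)"
  shows "\<exists>D (E :: nat \<Rightarrow> nat \<Rightarrow> 'a). uhf_chain D E"
proof -
  obtain Q :: "'a set" where Q: "countable Q" "closure Q = UNIV"
    using assms unfolding separable_space_def by auto
  then have "Q \<noteq> {}" by auto
  have "\<exists>F m. finite F \<and> F \<subseteq> I \<and> dist (\<theta> F m) (from_nat_into Q i) < inverse (real (Suc j))" for i j
  proof -
    have "from_nat_into Q i \<in> closure (\<Union>F\<in>{F. finite F \<and> F \<subseteq> I}. range (\<theta> F))"
      using tensor by (simp add: is_matrix_tensor_product_def)
    then have "\<exists>y\<in>\<Union>F\<in>{F. finite F \<and> F \<subseteq> I}. range (\<theta> F). dist y (from_nat_into Q i) < inverse (real (Suc j))"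
      unfolding closure_approachable by (rule allE[of _ "inverse (real (Suc j))"]) simp
    then show ?thesis by blast
  qed
  then obtain Fs m where Fs: "\<And>i j. finite (Fs i j)" "\<And>i j. Fs i j \<subseteq> I"
    "\<And>i j. dist (\<theta> (Fs i j) (m i j)) (from_nat_into Q i) < inverse (real (Suc j))" by metis
  \<comment> \<open>Collecting all subsets with both indices up to \<open>n\<close> makes the stages
    increasing; \<open>Fs i j\<close> is contained in \<open>G (max i j)\<close>.\<close>
  define G where "G = (\<lambda>n. \<Union>i\<le>n. \<Union>j\<le>n. Fs i j)"
  have G: "finite (G n)" "G n \<subseteq> I" for n using Fs(1,2) unfolding G_def by blast+
  have G_Suc: "G n \<subseteq> G (Suc n)" for n unfolding G_def by (intro UN_mono) auto
  define D where "D = (\<lambda>n. card (tensor_index k (G n)))"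
  define E where "E = (\<lambda>n. finite_matrix_embedding.col (tensor_index k (G n)) (\<theta> (G n)))"
  have algG: "mat_alg (D n) (E n) = alg (G n)" for n by (simp add: D_def E_def alg_def)
  have "uhf_chain D E"
  proof (rule uhf_chain.intro)
    show "1 \<noteq> (0::'a)" by (rule one_neq_zero)
    show "unital_column (D n) (E n)" for n
      unfolding D_def E_def by (rule finite_matrix_embedding.unital_column_col[OF embedding[OF G]])
    show "E n a \<in> mat_alg (D (Suc n)) (E (Suc n))" if "a < D n" for n a
      unfolding algG using col_in_alg[OF G_Suc G] that by (simp add: D_def E_def)
    show "closure (\<Union>n. mat_alg (D n) (E n)) = UNIV"
    proof (intro equalityI subset_UNIV subsetI)
      fix x :: 'a
      show "x \<in> closure (\<Union>n. mat_alg (D n) (E n))"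
        unfolding closure_approachable
      proof (intro allI impI)
        fix r :: real assume r: "0 < r"
        have "x \<in> closure Q" using Q by simp
        then have "\<exists>y\<in>Q. dist y x < r/2"
          unfolding closure_approachable by (rule allE[of _ "r/2"]) (use r in simp)
        then obtain i where i: "dist (from_nat_into Q i) x < r/2"
          using from_nat_into_surj[OF Q(1)] by metis
        obtain j where j: "inverse (real (Suc j)) < r/2" using r reals_Archimedean[of "r/2"] by auto
        define y where "y = \<theta> (Fs i j) (m i j)"
        have sub: "Fs i j \<subseteq> G (max i j)"
          unfolding G_def by (rule order.trans[OF UN_upper[of j] UN_upper[of i]]) auto
        have "y \<in> alg (Fs i j)" unfolding y_def by (rule \<theta>_in_alg[OF Fs(1,2)])
        then have "y \<in> mat_alg (D (max i j)) (E (max i j))" unfolding algG using alg_mono[OF sub G] by auto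
        moreover have "dist y x < r"
          using dist_triangle[of y x "from_nat_into Q i"] Fs(3)[of i j] i j unfolding y_def by linarith
        ultimately show "\<exists>y\<in>\<Union>n. mat_alg (D n) (E n). dist y x < r" by blast
      qed
    qed
  qed
  then show ?thesis by blast
qed

end

theorem theorem4p1:
  assumes "uhf TYPE('i) TYPE('a::unital_cstar_algebra)"
    and "separable_space (euclidean :: 'a topology)"
  shows "prime_model TYPE('b::cstar_algebra) (theory_of (UNIV :: 'a set)) (UNIV :: 'a set)"
proof -
  obtain I :: "'i set" and k \<theta> where "\<forall>i\<in>I. 1 \<le> k i"
    "is_matrix_tensor_product I k (\<theta> :: 'i set \<Rightarrow> ('i \<Rightarrow> nat) cmatrix \<Rightarrow> 'a)"
    using assms(1) unfolding uhf_def by blast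
  then interpret tensor_product I k \<theta> by unfold_locales auto
  obtain D and E :: "nat \<Rightarrow> nat \<Rightarrow> 'a" where "uhf_chain D E"
    using uhf_chain_exists[OF assms(2)] by blast
  then interpret uhf_chain D E .
  have "\<exists>S. elementary_submodel S B \<and> star_isomorphic (UNIV :: 'a set) S"
    if "models B (theory_of (UNIV :: 'a set))" for B :: "'b set"
  proof -
    interpret uhf_model D E B by unfold_locales (use that in \<open>auto simp: models_def\<close>)
    show ?thesis by (rule elementary_copy)
  qed
  then show ?thesis by (auto simp: prime_model_def models_def cstar_subalgebra_UNIV)
qed

end
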